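(* Every Garside group $G$ admits a finite $K(G,1)$, i.e. there is a finite CW complex that is an Eilenberg–MacLane space $K(G,1)$.
   Context: An element $m\neq 1$ of a monoid $M$ is indivisible if $m=ab$ implies $a=1$ or $b=1$. For $m\in M$, $\|m\|$ is the supremum of the lengths of all expressions of $m$ as a product of indivisible elements. $M$ is atomic if it is generated by its indivisible elements and $\|m\|<\infty$ for all $m\in M$. A Garside monoid is an atomic monoid $M$ such that: (1) left and right cancellation laws hold; (2) any two elements admit a least common multiple and a greatest common divisor on both the left and the right; (3) there is an element $\Delta\in M$ (a Garside element) whose set of left divisors equals its set of right divisors, this set is finite, and it generates $M$. A Garside monoid satisfies Ore's criterion, hence embeds in its group of fractions. A Garside group is the group of fractions of a Garside monoid. *)

theory Defs
  imports "HOL-Analysis.Analysis" "HOL-Algebra.Divisibility" "HOL-Algebra.Elementary_Groups" "HOL-Library.Extended_Nat"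
begin

section \<open>Garside monoids\<close>

definition indivisible :: "('a, 'b) monoid_scheme \<Rightarrow> 'a \<Rightarrow> bool" where
  "indivisible M m \<longleftrightarrow> m \<in> carrier M \<and> m \<noteq> \<one>\<^bsub>M\<^esub> \<and>
     (\<forall>a\<in>carrier M. \<forall>b\<in>carrier M. m = a \<otimes>\<^bsub>M\<^esub> b \<longrightarrow> a = \<one>\<^bsub>M\<^esub> \<or> b = \<one>\<^bsub>M\<^esub>)"

definition list_product :: "('a, 'b) monoid_scheme \<Rightarrow> 'a list \<Rightarrow> 'a" where
  "list_product M xs = foldr (\<otimes>\<^bsub>M\<^esub>) xs \<one>\<^bsub>M\<^esub>"

definition generates_monoid :: "('a, 'b) monoid_scheme \<Rightarrow> 'a set \<Rightarrow> bool" where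
  "generates_monoid M S \<longleftrightarrow> S \<subseteq> carrier M \<and> carrier M = list_product M ` lists S"

definition length_norm :: "('a, 'b) monoid_scheme \<Rightarrow> 'a \<Rightarrow> enat" where
  "length_norm M m = Sup {enat (length xs) | xs. xs \<in> lists {a. indivisible M a} \<and> list_product M xs = m}"

definition atomic_monoid :: "('a, 'b) monoid_scheme \<Rightarrow> bool" where
  "atomic_monoid M \<longleftrightarrow> monoid M \<and> generates_monoid M {a. indivisible M a} \<and>
     (\<forall>m\<in>carrier M. length_norm M m < \<infinity>)"

text \<open>The library relation \<^const>\<open>factor\<close> is left divisibility: \<open>a\<close> divides \<open>a \<otimes> c\<close>. Right
  divisibility, and the gcds and lcms formed with it, are the same notions in the opposite monoid.\<close>

definition opposite_monoid :: "('a, 'b) monoid_scheme \<Rightarrow> 'a monoid" where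
  "opposite_monoid M = \<lparr>carrier = carrier M, mult = (\<lambda>x y. y \<otimes>\<^bsub>M\<^esub> x), one = \<one>\<^bsub>M\<^esub>\<rparr>"

definition has_gcd_lcm :: "('a, 'b) monoid_scheme \<Rightarrow> bool" where
  "has_gcd_lcm M \<longleftrightarrow> (\<forall>a\<in>carrier M. \<forall>b\<in>carrier M.
     (\<exists>d\<in>carrier M. d gcdof\<^bsub>M\<^esub> a b) \<and> (\<exists>m\<in>carrier M. m lcmof\<^bsub>M\<^esub> a b))"

definition left_divisors :: "('a, 'b) monoid_scheme \<Rightarrow> 'a \<Rightarrow> 'a set" where
  "left_divisors M m = {a \<in> carrier M. a divides\<^bsub>M\<^esub> m}"

definition right_divisors :: "('a, 'b) monoid_scheme \<Rightarrow> 'a \<Rightarrow> 'a set" where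
  "right_divisors M m = left_divisors (opposite_monoid M) m"

definition garside_element :: "('a, 'b) monoid_scheme \<Rightarrow> 'a \<Rightarrow> bool" where
  "garside_element M \<Delta> \<longleftrightarrow> \<Delta> \<in> carrier M \<and> left_divisors M \<Delta> = right_divisors M \<Delta> \<and>
     finite (left_divisors M \<Delta>) \<and> generates_monoid M (left_divisors M \<Delta>)"

definition garside_monoid :: "('a, 'b) monoid_scheme \<Rightarrow> bool" where
  "garside_monoid M \<longleftrightarrow> atomic_monoid M \<and> monoid_cancel M \<and>
     has_gcd_lcm M \<and> has_gcd_lcm (opposite_monoid M) \<and> (\<exists>\<Delta>. garside_element M \<Delta>)"


section \<open>The group of fractions\<close>

text \<open>Ore's construction; the pair \<open>(a, b)\<close> stands for the left fraction \<open>a\<inverse>b\<close>. If \<open>u b = v c\<close>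
  then \<open>b c\<inverse> = u\<inverse>v\<close>, so \<open>(a\<inverse>b) (c\<inverse>d) = (u a)\<inverse>(v d)\<close>.\<close>

definition fraction_rel :: "('a, 'b) monoid_scheme \<Rightarrow> (('a \<times> 'a) \<times> ('a \<times> 'a)) set" where
  "fraction_rel M = {((a, b), (c, d)) | a b c d.
     {a, b, c, d} \<subseteq> carrier M \<and>
     (\<exists>u\<in>carrier M. \<exists>v\<in>carrier M.
        u \<otimes>\<^bsub>M\<^esub> a = v \<otimes>\<^bsub>M\<^esub> c \<and> u \<otimes>\<^bsub>M\<^esub> b = v \<otimes>\<^bsub>M\<^esub> d)}"

definition group_of_fractions :: "('a, 'b) monoid_scheme \<Rightarrow> ('a \<times> 'a) set monoid" where
  "group_of_fractions M =
     \<lparr>carrier = (carrier M \<times> carrier M) // fraction_rel M,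
      mult = (\<lambda>A B. fraction_rel M ``
        {(u \<otimes>\<^bsub>M\<^esub> a, v \<otimes>\<^bsub>M\<^esub> d) | a b c d u v.
           (a, b) \<in> A \<and> (c, d) \<in> B \<and> u \<in> carrier M \<and> v \<in> carrier M \<and>
           u \<otimes>\<^bsub>M\<^esub> b = v \<otimes>\<^bsub>M\<^esub> c}),
      one = fraction_rel M `` {(\<one>\<^bsub>M\<^esub>, \<one>\<^bsub>M\<^esub>)}\<rparr>"


section \<open>Finite CW complexes\<close>

definition closed_disc :: "nat \<Rightarrow> (nat \<Rightarrow> real) topology" where
  "closed_disc n = subtopology (Euclidean_space n) {x. (\<Sum>i<n. x i ^ 2) \<le> 1}"

definition open_disc :: "nat \<Rightarrow> (nat \<Rightarrow> real) set" where
  "open_disc n = {x \<in> topspace (Euclidean_space n). (\<Sum>i<n. x i ^ 2) < 1}"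

definition disc_boundary :: "nat \<Rightarrow> (nat \<Rightarrow> real) set" where
  "disc_boundary n = {x \<in> topspace (Euclidean_space n). (\<Sum>i<n. x i ^ 2) = 1}"

text \<open>A finite cell structure is a finite set of pairs \<open>(n, \<phi>)\<close>, with \<open>\<phi>\<close> the characteristic map
  of an \<open>n\<close>-cell. For finitely many cells, Whitehead's closure-finiteness and weak topology
  conditions hold automatically.\<close>

definition finite_cell_structure ::
    "'x topology \<Rightarrow> (nat \<times> ((nat \<Rightarrow> real) \<Rightarrow> 'x)) set \<Rightarrow> bool" where
  "finite_cell_structure X \<C> \<longleftrightarrow>
     finite \<C> \<and>
     (\<forall>(n, \<phi>)\<in>\<C>. continuous_map (closed_disc n) X \<phi> \<and>
        embedding_map (subtopology (closed_disc n) (open_disc n)) X \<phi> \<and>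
        \<phi> ` disc_boundary n \<subseteq> (\<Union>(m, \<psi>)\<in>{(m, \<psi>)\<in>\<C>. m < n}. \<psi> ` open_disc m)) \<and>
     disjoint_family_on (\<lambda>(n, \<phi>). \<phi> ` open_disc n) \<C> \<and>
     topspace X = (\<Union>(n, \<phi>)\<in>\<C>. \<phi> ` open_disc n)"

definition finite_CW_complex :: "'x topology \<Rightarrow> bool" where
  "finite_CW_complex X \<longleftrightarrow> Hausdorff_space X \<and> (\<exists>\<C>. finite_cell_structure X \<C>)"


section \<open>Homotopy groups and Eilenberg--MacLane spaces\<close>

definition unit_cube :: "nat \<Rightarrow> (nat \<Rightarrow> real) topology" where
  "unit_cube n = subtopology (Euclidean_space n) {x. \<forall>i<n. 0 \<le> x i \<and> x i \<le> 1}"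

definition cube_boundary :: "nat \<Rightarrow> (nat \<Rightarrow> real) set" where
  "cube_boundary n = {x \<in> topspace (unit_cube n). \<exists>i<n. x i = 0 \<or> x i = 1}"

definition cube_maps :: "nat \<Rightarrow> 'x topology \<Rightarrow> 'x \<Rightarrow> ((nat \<Rightarrow> real) \<Rightarrow> 'x) set" where
  "cube_maps n X x0 = {f. continuous_map (unit_cube n) X f \<and> (\<forall>x\<in>cube_boundary n. f x = x0)}"

definition cube_homotopy_rel ::
    "nat \<Rightarrow> 'x topology \<Rightarrow> 'x \<Rightarrow> (((nat \<Rightarrow> real) \<Rightarrow> 'x) \<times> ((nat \<Rightarrow> real) \<Rightarrow> 'x)) set" where
  "cube_homotopy_rel n X x0 = {(f, g). f \<in> cube_maps n X x0 \<and> g \<in> cube_maps n X x0 \<and>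
     homotopic_with (\<lambda>h. \<forall>x\<in>cube_boundary n. h x = x0) (unit_cube n) X f g}"

definition cube_concat ::
    "((nat \<Rightarrow> real) \<Rightarrow> 'x) \<Rightarrow> ((nat \<Rightarrow> real) \<Rightarrow> 'x) \<Rightarrow> (nat \<Rightarrow> real) \<Rightarrow> 'x" where
  "cube_concat f g = (\<lambda>x. if x 0 \<le> 1/2 then f (x(0 := 2 * x 0)) else g (x(0 := 2 * x 0 - 1)))"

text \<open>A group for \<open>n \<ge> 1\<close> only, since \<^const>\<open>cube_concat\<close> uses coordinate \<open>0\<close>.\<close>

definition homotopy_group :: "nat \<Rightarrow> 'x topology \<Rightarrow> 'x \<Rightarrow> ((nat \<Rightarrow> real) \<Rightarrow> 'x) set monoid" where
  "homotopy_group n X x0 =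
     \<lparr>carrier = cube_maps n X x0 // cube_homotopy_rel n X x0,
      mult = (\<lambda>A B. cube_homotopy_rel n X x0 `` {cube_concat f g | f g. f \<in> A \<and> g \<in> B}),
      one = cube_homotopy_rel n X x0 `` {\<lambda>_. x0}\<rparr>"

definition eilenberg_maclane_1 :: "'x topology \<Rightarrow> ('g, 'h) monoid_scheme \<Rightarrow> bool" where
  "eilenberg_maclane_1 X G \<longleftrightarrow> topspace X \<noteq> {} \<and> path_connected_space X \<and>
     (\<forall>x0\<in>topspace X. homotopy_group 1 X x0 \<cong> G \<and>
        (\<forall>n\<ge>2. trivial_group (homotopy_group n X x0)))"

end

theory Submission
  imports Defs
begin

text \<open>
  The group of fractions \<open>G\<close> of a Garside monoid \<open>M\<close> is partially ordered by left divisibility: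
  \<open>g \<le> h\<close> if \<open>g\<inverse>h\<close> lies in \<open>M\<close>. This order is invariant under left translations, any two elements
  have a meet, and right multiplication by \<open>\<Delta>\<close> is an order automorphism, because conjugation by
  \<open>\<Delta>\<close> permutes \<open>M\<close>. The interval \<open>[1, \<Delta>]\<close> is finite, and the powers of \<open>\<Delta>\<close> are cofinal in both
  directions. The construction starts from these properties, which are collected in
  the locale \<open>garside_order\<close>.

  Let \<open>E\<close> be the simplicial complex with vertex set \<open>G\<close> whose simplices are the finite nonempty
  subsets of the intervals \<open>[g, g\<Delta>]\<close>. Its points are weights on \<open>G\<close> of total mass 1, and the metric
  is the \<open>\<ell>\<^sup>1\<close> distance.

  \<^item> \<^emph>\<open>Contractibility.\<close> For \<open>z\<close> in \<open>G\<close> the vertex map \<open>h \<mapsto> h \<and> z\<close> extends linearly to \<open>E\<close>, since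
    \<open>g\<Delta> \<and> z\<Delta> = (g \<and> z)\<Delta>\<close>. For the same reason the maps for \<open>z\<close> and for \<open>z\<Delta>\<close> send a simplex to faces
    of one common simplex, so a straight line homotopy joins them. On a finite set of vertices
    the map is the identity if \<open>z\<close> is a high power of \<open>\<Delta>\<close>, and constant if \<open>z\<close> is a low one. Hence
    every map from a compact space to \<open>E\<close> is null-homotopic (\<open>null_homotopic\<close>).

  \<^item> \<^emph>\<open>Freeness.\<close> If \<open>gB \<subseteq> B\<close> for a finite nonempty \<open>B\<close>, then \<open>g\<close> fixes the meet of \<open>B\<close>, so \<open>g = 1\<close>
    (\<open>translate_fixes_finite_set\<close>). Applied to level sets of a weight this shows that \<open>G\<close> moves
    every point of \<open>E\<close> by at least a fixed positive distance (\<open>act_gap\<close>).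

  \<^item> \<^emph>\<open>Finiteness.\<close> The orbit of a simplex contains exactly one simplex with meet \<open>1\<close>, and that one
    is a subset of \<open>[1, \<Delta>]\<close>. So \<open>E/G\<close> is a finite CW complex (\<open>finite_CW\<close>).

  The uniform gap makes the projection \<open>E \<rightarrow> E/G\<close> a covering in a metric sense: a map to \<open>E/G\<close> that
  is uniformly close to the projection of a map to \<open>E\<close> lifts uniquely to a nearby map. Shrinking
  the time parameter turns this into homotopy lifting (\<open>homotopy_lift\<close>). The usual arguments then
  give \<open>\<pi>\<^sub>1(E/G) \<cong> G\<close> and the vanishing of the higher homotopy groups (\<open>eilenberg_maclane\<close>). The
  set \<open>E/G\<close> is coded inside the functions from naturals to reals by enumerating \<open>[1, \<Delta>]\<close>, and its
  topology comes from the orbit distance.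
\<close>


section \<open>Garside monoids and their fractions\<close>

lemma list_product_closed:
  assumes "monoid M" "set xs \<subseteq> carrier M" shows "list_product M xs \<in> carrier M"
  using assms(2) by (induction xs) (auto simp: list_product_def monoid.m_closed[OF assms(1)] monoid.one_closed[OF assms(1)])

lemma list_product_append:
  assumes "monoid M" "set xs \<subseteq> carrier M" "set ys \<subseteq> carrier M"
  shows "list_product M (xs @ ys) = list_product M xs \<otimes>\<^bsub>M\<^esub> list_product M ys"
proof -
  interpret monoid M by fact
  show ?thesis using assms(2)
  proof (induction xs)
    case Nil
    then show ?case using list_product_closed[OF assms(1,3)] by (simp add: list_product_def)
  next
    case (Cons x xs)
    have "list_product M (x # zs) = x \<otimes>\<^bsub>M\<^esub> list_product M zs" for zs by (simp add: list_product_def)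
    then show ?case using Cons list_product_closed[OF assms(1), of xs] list_product_closed[OF assms(1,3)]
      by (simp add: m_assoc)
  qed
qed

lemma generates_monoid_induct:
  assumes gen: "generates_monoid M S" and m: "m \<in> carrier M" and mon: "monoid M"
    and one: "P \<one>\<^bsub>M\<^esub>" and step: "\<And>s m. \<lbrakk>s \<in> S; m \<in> carrier M; P m\<rbrakk> \<Longrightarrow> P (s \<otimes>\<^bsub>M\<^esub> m)"
  shows "P m"
proof -
  have S: "S \<subseteq> carrier M" and img: "carrier M = list_product M ` lists S"
    using gen by (auto simp: generates_monoid_def)
  obtain xs where xs: "xs \<in> lists S" "m = list_product M xs" using m img by blast
  have "P (list_product M xs)" using xs(1)
  proof (induction xs)
    case Nil
    show ?case using one by (simp add: list_product_def)
  next
    case (Cons x xs)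
    have "list_product M xs \<in> carrier M" using list_product_closed[OF mon] Cons S by auto
    then have "P (x \<otimes>\<^bsub>M\<^esub> list_product M xs)" using step Cons by blast
    then show ?case by (simp add: list_product_def)
  qed
  then show ?thesis using xs by simp
qed

text \<open>If \<open>m\<close> and \<open>n\<close> are mutually inverse and \<open>m \<noteq> 1\<close>, concatenating a nonempty factorization of \<open>m\<close>
  with one of \<open>n\<close> gives a nonempty word of indivisible elements with product \<open>1\<close>. Its powers
  have the same product and unbounded length, which contradicts the finiteness of the norm of \<open>1\<close>.\<close>

lemma atomic_no_units:
  assumes at: "atomic_monoid M" and m: "m \<in> carrier M" and n: "n \<in> carrier M"
    and mn: "m \<otimes>\<^bsub>M\<^esub> n = \<one>\<^bsub>M\<^esub>"
  shows "m = \<one>\<^bsub>M\<^esub>"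
proof (rule ccontr)
  assume ne: "m \<noteq> \<one>\<^bsub>M\<^esub>"
  let ?A = "{a. indivisible M a}"
  have mon: "monoid M" and img: "carrier M = list_product M ` lists ?A" and A: "?A \<subseteq> carrier M"
    and fin: "\<And>m. m \<in> carrier M \<Longrightarrow> length_norm M m < \<infinity>"
    using at unfolding atomic_monoid_def generates_monoid_def by blast+
  interpret monoid M by (rule mon)
  have rep: "\<exists>xs\<in>lists ?A. list_product M xs = k" if "k \<in> carrier M" for k
    using that unfolding img by (metis imageE)
  obtain xs where xs: "xs \<in> lists ?A" "list_product M xs = m" using rep[OF m] by (rule bexE)
  obtain ys where ys: "ys \<in> lists ?A" "list_product M ys = n" using rep[OF n] by (rule bexE)
  have "xs \<noteq> []" using ne xs by (auto simp: list_product_def)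
  let ?ws = "xs @ ys"
  have sub: "set zs \<subseteq> carrier M" if "zs \<in> lists ?A" for zs using that A by auto
  have ws: "?ws \<in> lists ?A" "list_product M ?ws = \<one>\<^bsub>M\<^esub>"
    using xs ys mn list_product_append[OF mon sub[OF xs(1)] sub[OF ys(1)]] by auto
  have pow: "concat (replicate k ?ws) \<in> lists ?A \<and> list_product M (concat (replicate k ?ws)) = \<one>\<^bsub>M\<^esub>" for k
  proof (induction k)
    case 0
    show ?case by (simp add: list_product_def)
  next
    case (Suc k)
    then show ?case using ws list_product_append[OF mon sub[OF ws(1)] sub, of "concat (replicate k ?ws)"]
      by (auto simp del: append_assoc)
  qed
  have len: "k \<le> length (concat (replicate k ?ws))" for k
  proof (induction k)
    case (Suc k)
    have "length ?ws \<ge> 1" using \<open>xs \<noteq> []\<close> by (cases xs) auto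
    then show ?case using Suc by simp
  qed simp
  have "enat k \<le> length_norm M \<one>\<^bsub>M\<^esub>" for k
  proof -
    have "enat (length (concat (replicate k ?ws))) \<le> length_norm M \<one>\<^bsub>M\<^esub>"
      unfolding length_norm_def by (rule Sup_upper) (use pow[of k] in blast)
    then show ?thesis using len[of k] by (meson enat_ord_simps(1) order_trans)
  qed
  then have "length_norm M \<one>\<^bsub>M\<^esub> = \<infinity>" by (metis enat_ile enat_ord_simps(1) not_enat_eq not_less_eq_eq order_refl)
  then show False using fin[of "\<one>\<^bsub>M\<^esub>"] by simp
qed

text \<open>The embedding is \<open>m \<mapsto> 1\<inverse>m\<close>. Fractions are multiplied without choosing representatives: as \<open>G\<close>
  is a group isomorphic to the fractions, a product of two classes is again a single class, hence
  the class of any one of its members.\<close>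

lemma fractions_hom:
  fixes M :: "('a, 'b) monoid_scheme" (structure) and G :: "('g, 'h) monoid_scheme"
  assumes M: "monoid_cancel M" and G: "group G" and iso: "G \<cong> group_of_fractions M"
    and ore: "\<And>a b. \<lbrakk>a \<in> carrier M; b \<in> carrier M\<rbrakk> \<Longrightarrow>
      \<exists>u\<in>carrier M. \<exists>v\<in>carrier M. u \<otimes> a = v \<otimes> b"
  obtains \<iota> where "\<iota> \<in> hom M G" "inj_on \<iota> (carrier M)" "\<iota> \<one> = \<one>\<^bsub>G\<^esub>"
    "\<And>g. g \<in> carrier G \<Longrightarrow> \<exists>a\<in>carrier M. \<exists>b\<in>carrier M. \<iota> a \<otimes>\<^bsub>G\<^esub> g = \<iota> b"
proof -
  interpret M: monoid_cancel M by fact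
  interpret G: group G by fact
  let ?R = "fraction_rel M" and ?F = "group_of_fractions M"
  let ?C = "carrier M \<times> carrier M"
  have R: "((a, b), (c, d)) \<in> ?R \<longleftrightarrow> a \<in> carrier M \<and> b \<in> carrier M \<and> c \<in> carrier M \<and> d \<in> carrier M \<and>
     (\<exists>u\<in>carrier M. \<exists>v\<in>carrier M. u \<otimes> a = v \<otimes> c \<and> u \<otimes> b = v \<otimes> d)" for a b c d
    by (auto simp: fraction_rel_def)
  have equiv: "equiv ?C ?R"
  proof (rule equivI)
    show "?R \<subseteq> ?C \<times> ?C" by (auto simp: fraction_rel_def)
    show "refl_on ?C ?R" by (intro refl_onI) (force simp: R)
    show "sym ?R"
    proof (rule symI)
      fix p q assume "(p, q) \<in> ?R"
      then show "(q, p) \<in> ?R" by (cases p, cases q) (auto simp: R, metis)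
    qed
    show "trans ?R"
    proof (rule transI)
      fix p q r assume pq: "(p, q) \<in> ?R" and qr: "(q, r) \<in> ?R"
      obtain a b c d e f where pqr: "p = (a, b)" "q = (c, d)" "r = (e, f)" by (metis surj_pair)
      obtain u v where uv: "u \<in> carrier M" "v \<in> carrier M" "u \<otimes> a = v \<otimes> c" "u \<otimes> b = v \<otimes> d"
        and ab: "a \<in> carrier M" "b \<in> carrier M" "c \<in> carrier M" "d \<in> carrier M"
        using pq unfolding pqr R by blast
      obtain u' v' where uv': "u' \<in> carrier M" "v' \<in> carrier M" "u' \<otimes> c = v' \<otimes> e" "u' \<otimes> d = v' \<otimes> f"
        and ef: "e \<in> carrier M" "f \<in> carrier M"
        using qr unfolding pqr R by blast
      obtain s t where st: "s \<in> carrier M" "t \<in> carrier M" "s \<otimes> v = t \<otimes> u'" using ore uv uv' by blast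
      have "(s \<otimes> u) \<otimes> a = (t \<otimes> v') \<otimes> e" "(s \<otimes> u) \<otimes> b = (t \<otimes> v') \<otimes> f"
        using uv uv' st ab ef by (metis M.m_assoc)+
      then show "(p, r) \<in> ?R" unfolding pqr R using uv uv' st ab ef by (meson M.m_closed)
    qed
  qed
  obtain \<theta> where \<theta>: "\<theta> \<in> iso G ?F" using iso by (auto simp: is_iso_def)
  then have \<theta>hom: "\<And>x y. \<lbrakk>x \<in> carrier G; y \<in> carrier G\<rbrakk> \<Longrightarrow> \<theta> (x \<otimes>\<^bsub>G\<^esub> y) = \<theta> x \<otimes>\<^bsub>?F\<^esub> \<theta> y"
    and bij: "bij_betw \<theta> (carrier G) (carrier ?F)"
    by (auto simp: iso_def hom_mult)
  have carF: "carrier ?F = ?C // ?R" by (simp add: group_of_fractions_def)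
  define cls where "cls a b = ?R `` {(a, b)}" for a b
  have cls_in: "cls a b \<in> carrier ?F" if "a \<in> carrier M" "b \<in> carrier M" for a b
    using that by (auto simp: carF cls_def intro: quotientI)
  have F_closed: "A \<otimes>\<^bsub>?F\<^esub> B \<in> carrier ?F" if "A \<in> carrier ?F" "B \<in> carrier ?F" for A B
  proof -
    have img: "\<theta> ` carrier G = carrier ?F" using bij by (simp add: bij_betw_def)
    obtain x y where xy: "x \<in> carrier G" "A = \<theta> x" "y \<in> carrier G" "B = \<theta> y"
      using \<open>A \<in> _\<close> \<open>B \<in> _\<close> unfolding img[symmetric] by blast
    have "\<theta> (x \<otimes>\<^bsub>G\<^esub> y) \<in> carrier ?F" unfolding img[symmetric] using xy by blast
    then show ?thesis using \<theta>hom[OF xy(1,3)] xy by simp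
  qed
  have cls_mult: "cls a b \<otimes>\<^bsub>?F\<^esub> cls c d = cls (u \<otimes> a) (v \<otimes> d)"
    if c: "a \<in> carrier M" "b \<in> carrier M" "c \<in> carrier M" "d \<in> carrier M" "u \<in> carrier M" "v \<in> carrier M"
      and eq: "u \<otimes> b = v \<otimes> c" for a b c d u v
  proof -
    let ?P = "{(u \<otimes> a', v \<otimes> d') | a' b' c' d' u v.
           (a', b') \<in> cls a b \<and> (c', d') \<in> cls c d \<and> u \<in> carrier M \<and> v \<in> carrier M \<and>
           u \<otimes> b' = v \<otimes> c'}"
    have prod: "cls a b \<otimes>\<^bsub>?F\<^esub> cls c d = ?R `` ?P" by (simp add: group_of_fractions_def)
    have "(a, b) \<in> cls a b" "(c, d) \<in> cls c d"
      using equiv_class_self[OF equiv, of "(a, b)"] equiv_class_self[OF equiv, of "(c, d)"] c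
      unfolding cls_def by simp_all
    then have "(u \<otimes> a, v \<otimes> d) \<in> ?P" using c eq by blast
    moreover have "((u \<otimes> a, v \<otimes> d), (u \<otimes> a, v \<otimes> d)) \<in> ?R"
      using equiv c by (auto simp: equiv_def refl_on_def)
    ultimately have "(u \<otimes> a, v \<otimes> d) \<in> cls a b \<otimes>\<^bsub>?F\<^esub> cls c d" unfolding prod by blast
    moreover have "cls a b \<otimes>\<^bsub>?F\<^esub> cls c d \<in> ?C // ?R"
      using F_closed cls_in c by (simp flip: carF)
    moreover have "A = ?R `` {x}" if A: "A \<in> ?C // ?R" and x: "x \<in> A" for A x
    proof -
      obtain q where q: "A = ?R `` {q}" using A by (rule quotientE)
      then have "(q, x) \<in> ?R" using x by simp
      then show ?thesis unfolding q by (rule equiv_class_eq[OF equiv])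
    qed
    ultimately show ?thesis unfolding cls_def by blast
  qed
  define \<iota> where "\<iota> m = inv_into (carrier G) \<theta> (cls \<one> m)" for m
  have \<iota>_in: "\<iota> m \<in> carrier G" and \<theta>\<iota>: "\<theta> (\<iota> m) = cls \<one> m" if "m \<in> carrier M" for m
  proof -
    have "cls \<one> m \<in> \<theta> ` carrier G" using cls_in[of "\<one>" m] that bij by (simp add: bij_betw_def)
    then show "\<iota> m \<in> carrier G" "\<theta> (\<iota> m) = cls \<one> m"
      unfolding \<iota>_def by (rule inv_into_into, rule f_inv_into_f)
  qed
  have \<theta>inj: "x = y" if "x \<in> carrier G" "y \<in> carrier G" "\<theta> x = \<theta> y" for x y
    using bij that by (auto simp: bij_betw_def inj_on_def)
  have \<iota>hom: "\<iota> (m \<otimes> n) = \<iota> m \<otimes>\<^bsub>G\<^esub> \<iota> n" if m: "m \<in> carrier M" and n: "n \<in> carrier M" for m n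
  proof (rule \<theta>inj)
    have "cls \<one> m \<otimes>\<^bsub>?F\<^esub> cls \<one> n = cls (\<one> \<otimes> \<one>) (m \<otimes> n)"
      by (rule cls_mult) (use m n in auto)
    then show "\<theta> (\<iota> (m \<otimes> n)) = \<theta> (\<iota> m \<otimes>\<^bsub>G\<^esub> \<iota> n)"
      using \<theta>hom[OF \<iota>_in[OF m] \<iota>_in[OF n]] \<theta>\<iota> m n by simp
  qed (use \<iota>_in m n in auto)
  show ?thesis
  proof (rule that)
    show "\<iota> \<in> hom M G" using \<iota>_in \<iota>hom by (auto simp: hom_def)
    show "inj_on \<iota> (carrier M)"
    proof (rule inj_onI)
      fix m n assume mn: "m \<in> carrier M" "n \<in> carrier M" "\<iota> m = \<iota> n"
      then have "cls \<one> m = cls \<one> n" using \<theta>\<iota> by metis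
      then have "((\<one>, m), (\<one>, n)) \<in> ?R"
        using equiv mn unfolding cls_def by (intro eq_equiv_class[OF _ equiv]) auto
      then show "m = n" unfolding R using M.l_cancel by auto
    qed
    have "\<iota> \<one> \<otimes>\<^bsub>G\<^esub> \<iota> \<one> = \<iota> \<one>" using \<iota>hom[of "\<one>" "\<one>"] by simp
    then show "\<iota> \<one> = \<one>\<^bsub>G\<^esub>" using \<iota>_in[of "\<one>"] by (metis G.l_cancel_one M.one_closed)
    fix g assume g: "g \<in> carrier G"
    then have "\<theta> g \<in> ?C // ?R" using bij unfolding carF by (auto simp: bij_betw_def)
    then obtain a b where ab: "a \<in> carrier M" "b \<in> carrier M" "\<theta> g = cls a b"
      unfolding cls_def by (auto elim!: quotientE)
    have "cls \<one> a \<otimes>\<^bsub>?F\<^esub> cls a b = cls (\<one> \<otimes> \<one>) (\<one> \<otimes> b)"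
      by (rule cls_mult) (use ab in auto)
    then have "\<iota> a \<otimes>\<^bsub>G\<^esub> g = \<iota> b"
      using \<theta>hom[OF \<iota>_in[OF ab(1)] g] \<theta>\<iota> ab g \<iota>_in by (intro \<theta>inj) auto
    then show "\<exists>a\<in>carrier M. \<exists>b\<in>carrier M. \<iota> a \<otimes>\<^bsub>G\<^esub> g = \<iota> b" using ab by blast
  qed
qed


section \<open>Maps on cubes\<close>

lemma unit_cube_eq:
  "unit_cube n = top_of_set {x. (\<forall>i<n. 0 \<le> x i \<and> x i \<le> 1) \<and> (\<forall>i\<ge>n. x i = 0)}"
  unfolding unit_cube_def Euclidean_space_def euclidean_product_topology subtopology_subtopology
  by (rule arg_cong[of _ _ top_of_set]) auto

lemma topspace_unit_cube:
  "topspace (unit_cube n) = {x. (\<forall>i<n. 0 \<le> x i \<and> x i \<le> 1) \<and> (\<forall>i\<ge>n. x i = 0)}"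
  by (simp add: unit_cube_eq)

lemma cube_boundary_subset: "cube_boundary n \<subseteq> topspace (unit_cube n)"
  by (auto simp: cube_boundary_def)

lemma compact_space_unit_cube: "compact_space (unit_cube n)"
proof -
  have eq: "{x::nat\<Rightarrow>real. (\<forall>i<n. 0 \<le> x i \<and> x i \<le> 1) \<and> (\<forall>i\<ge>n. x i = 0)}
      = PiE UNIV (\<lambda>i. if i < n then {0..1} else {0})"
    by (force simp: PiE_UNIV_domain Pi_iff split: if_splits)
  have "compactin (product_topology (\<lambda>_. euclideanreal) UNIV) (PiE UNIV (\<lambda>i. if i < n then {0..1::real} else {0}))"
    by (subst compactin_PiE) auto
  then show ?thesis
    unfolding unit_cube_eq eq by (simp add: compact_space_subtopology euclidean_product_topology)
qed

lemma compact_space_cube_boundary: "compact_space (subtopology (unit_cube n) (cube_boundary n))"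
proof -
  have 1: "compact (topspace (unit_cube n))"
    using compact_space_unit_cube[of n] by (simp add: unit_cube_eq compact_space_subtopology compact_space_def)
  have cl: "closed {x::nat \<Rightarrow> real. x i = a}" for i a
    by (intro closed_Collect_eq continuous_on_product_then_coordinatewise[OF continuous_on_id] continuous_on_const)
  have "closed (\<Union>i<n. {x::nat \<Rightarrow> real. x i = 0} \<union> {x. x i = 1})"
    by (intro closed_UN ballI closed_Un cl finite_lessThan)
  then have "compact (topspace (unit_cube n) \<inter> (\<Union>i<n. {x. x i = 0} \<union> {x. x i = 1}))"
    by (rule compact_Int_closed[OF 1])
  also have "topspace (unit_cube n) \<inter> (\<Union>i<n. {x. x i = 0} \<union> {x. x i = 1}) = cube_boundary n"
    unfolding cube_boundary_def by blast
  finally have "compact (cube_boundary n)" .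
  moreover have "subtopology (unit_cube n) (cube_boundary n) = top_of_set (cube_boundary n)"
    using cube_boundary_subset[of n]
    by (auto simp: unit_cube_eq subtopology_subtopology intro!: arg_cong[of _ _ top_of_set])
  ultimately show ?thesis by (simp add: compact_space_subtopology)
qed

lemma continuous_on_coordinate [continuous_intros]:
  "continuous_on A (\<lambda>x. x (i::nat) :: real)"
  by (rule continuous_on_product_then_coordinatewise[OF continuous_on_id])

lemma continuous_on_fun_upd:
  assumes "continuous_on A f" "continuous_on A g"
  shows "continuous_on A (\<lambda>x. (f x)(i := g x) :: nat \<Rightarrow> real)"
proof (rule continuous_on_coordinatewise_then_product)
  fix j show "continuous_on A (\<lambda>x. ((f x)(i := g x)) j)"
    using assms by (cases "j = i") (auto intro: continuous_on_product_then_coordinatewise)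
qed

lemma continuous_on_Max:
  fixes f :: "'i \<Rightarrow> 'a::topological_space \<Rightarrow> real"
  assumes "finite I" "I \<noteq> {}" "\<And>i. i \<in> I \<Longrightarrow> continuous_on A (f i)"
  shows "continuous_on A (\<lambda>x. Max ((\<lambda>i. f i x) ` I))"
  using assms
proof (induction rule: finite_ne_induct)
  case (insert i I)
  then show ?case by (auto intro!: continuous_on_max)
qed auto

text \<open>The cone construction. The inner half of the cube is mapped to the end point of the null-homotopy;
  in the outer half, the point at sup-norm distance \<open>r/2\<close> from the centre is projected radially to
  the boundary and then moved along the null-homotopy for the time \<open>2(1 - r)\<close>.\<close>

lemma cube_boundary_extension:
  assumes m: "m > 0"
    and hom: "homotopic_with (\<lambda>_. True) (subtopology (unit_cube m) (cube_boundary m)) Y b (\<lambda>_. y0)"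
  obtains F where "continuous_map (unit_cube m) Y F" "\<And>x. x \<in> cube_boundary m \<Longrightarrow> F x = b x"
proof -
  let ?B = "subtopology (unit_cube m) (cube_boundary m)"
  let ?I = "top_of_set {0..1::real}"
  have topB: "topspace ?B = cube_boundary m" using cube_boundary_subset by auto
  obtain h where h: "continuous_map (prod_topology ?I ?B) Y h" "\<And>x. h (0, x) = b x" "\<And>x. h (1, x) = y0"
    using hom unfolding homotopic_with_def by auto
  have "(\<lambda>_. 0) \<in> cube_boundary m"
    using m by (auto simp: cube_boundary_def topspace_unit_cube)
  then have y0: "y0 \<in> topspace Y"
    using continuous_map_image_subset_topspace[OF h(1)] h(3) topB
    by (metis SigmaI atLeastAtMost_iff image_subset_iff order_refl topspace_euclidean_subtopology
        topspace_prod_topology zero_le_one)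
  define r where "r z = Max ((\<lambda>i. \<bar>2 * z i - 1\<bar>) ` {..<m})" for z :: "nat \<Rightarrow> real"
  define \<rho> where "\<rho> z = (\<lambda>i. if i < m then 1/2 + (z i - 1/2) / r z else 0)" for z :: "nat \<Rightarrow> real"
  define F where "F z = (if r z \<le> 1/2 then y0 else h (2 * (1 - r z), \<rho> z))" for z
  have ne: "{..<m} \<noteq> {}" using m by auto
  have r_ge: "\<bar>2 * z i - 1\<bar> \<le> r z" if "i < m" for z i
    unfolding r_def using that by (intro Max_ge) auto
  have r_at: "\<exists>i<m. \<bar>2 * z i - 1\<bar> = r z" for z
  proof -
    have "r z \<in> (\<lambda>i. \<bar>2 * z i - 1\<bar>) ` {..<m}" unfolding r_def using ne by (intro Max_in) auto
    then show ?thesis by auto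
  qed
  have r_le: "r z \<le> 1" if "z \<in> topspace (unit_cube m)" for z
  proof -
    obtain i where "i < m" "\<bar>2 * z i - 1\<bar> = r z" using r_at by blast
    moreover then have "0 \<le> z i" "z i \<le> 1" using that by (auto simp: topspace_unit_cube)
    ultimately show ?thesis by linarith
  qed
  have r_bd: "r z = 1" if z: "z \<in> cube_boundary m" for z
  proof -
    obtain i where i: "i < m" "z i = 0 \<or> z i = 1" using z unfolding cube_boundary_def by blast
    then have "r z \<ge> 1" using r_ge[OF i(1), of z] by auto
    moreover have "r z \<le> 1" using r_le z cube_boundary_subset by blast
    ultimately show ?thesis by simp
  qed
  have \<rho>_bd: "\<rho> z \<in> cube_boundary m" if rz: "1/2 \<le> r z" for z
  proof -
    have abs_eq: "\<bar>\<rho> z i - 1/2\<bar> = \<bar>2 * z i - 1\<bar> / r z / 2" if "i < m" for i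
    proof -
      have "\<bar>2 * z i - 1\<bar> = 2 * \<bar>z i - 1/2\<bar>" by (auto simp: abs_if)
      then show ?thesis using rz that by (simp add: \<rho>_def abs_divide)
    qed
    have "\<bar>2 * z i - 1\<bar> / r z \<le> 1" if "i < m" for i
      using r_ge[OF that, of z] rz by (simp add: field_simps)
    then have le: "\<bar>\<rho> z i - 1/2\<bar> \<le> 1/2" if "i < m" for i using that abs_eq by force
    obtain i where i: "i < m" "\<bar>2 * z i - 1\<bar> = r z" using r_at by blast
    then have "\<bar>\<rho> z i - 1/2\<bar> = 1/2" using rz abs_eq[OF i(1)] by simp
    then have "\<rho> z i = 0 \<or> \<rho> z i = 1" by linarith
    moreover have "0 \<le> \<rho> z j \<and> \<rho> z j \<le> 1" if "j < m" for j using le[OF that] by linarith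
    moreover have "\<rho> z j = 0" if "j \<ge> m" for j using that by (simp add: \<rho>_def)
    ultimately show ?thesis using i(1) by (auto simp: cube_boundary_def topspace_unit_cube)
  qed
  have cr: "continuous_on A r" for A
    unfolding r_def using ne by (intro continuous_on_Max continuous_intros) auto
  let ?C = "topspace (unit_cube m)"
  have c\<rho>: "continuous_on (?C \<inter> {z. 1/2 \<le> r z}) \<rho>"
    unfolding \<rho>_def
  proof (intro continuous_on_coordinatewise_then_product)
    fix i show "continuous_on (?C \<inter> {z. 1/2 \<le> r z}) (\<lambda>z. if i < m then 1/2 + (z i - 1/2) / r z else 0)"
    proof (cases "i < m")
      case True
      have "continuous_on (?C \<inter> {z. 1/2 \<le> r z}) (\<lambda>z. 1/2 + (z i - 1/2) / r z)"
        by (intro continuous_intros cr) auto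
      then show ?thesis using True by simp
    qed simp
  qed
  have "continuous_map (unit_cube m) Y F"
    unfolding F_def
  proof (rule continuous_map_cases_le)
    show "continuous_map (unit_cube m) euclideanreal r" by (simp add: unit_cube_eq cr)
    show "continuous_map (subtopology (unit_cube m) {x \<in> ?C. 1/2 \<le> r x}) Y (\<lambda>z. h (2 * (1 - r z), \<rho> z))"
    proof (rule continuous_map_compose[OF _ h(1), unfolded o_def], intro continuous_map_pairedI)
      have top: "subtopology (unit_cube m) {x \<in> ?C. 1/2 \<le> r x} = top_of_set (?C \<inter> {z. 1/2 \<le> r z})"
        by (auto simp: unit_cube_eq subtopology_subtopology intro!: arg_cong[of _ _ top_of_set])
      show "continuous_map (subtopology (unit_cube m) {x \<in> ?C. 1/2 \<le> r x}) ?I (\<lambda>z. 2 * (1 - r z))"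
        unfolding top using r_le
        by (auto simp: continuous_map_in_subtopology intro!: continuous_intros cr)
      have "?B = top_of_set (cube_boundary m)"
        using cube_boundary_subset[of m]
        by (auto simp: unit_cube_eq subtopology_subtopology topspace_unit_cube intro!: arg_cong[of _ _ top_of_set])
      then show "continuous_map (subtopology (unit_cube m) {x \<in> ?C. 1/2 \<le> r x}) ?B \<rho>"
        unfolding top using c\<rho> \<rho>_bd by (auto simp: continuous_map_in_subtopology)
    qed
    show "y0 = h (2 * (1 - r z), \<rho> z)" if "r z = 1/2" for z
    proof -
      have "2 * (1 - r z) = 1" using that by simp
      then show ?thesis using h(3) by metis
    qed
  qed (use y0 in auto)
  moreover have "F x = b x" if "x \<in> cube_boundary m" for x
  proof -
    have "\<rho> x = x" using that by (auto simp: \<rho>_def r_bd cube_boundary_def topspace_unit_cube fun_eq_iff)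
    then show ?thesis using r_bd[OF that] h(2) by (simp add: F_def)
  qed
  ultimately show ?thesis using that by blast
qed

text \<open>Extension from the boundary of the cube one dimension up yields homotopies relative to the
  boundary. The prescribed boundary map uses \<open>F0\<close> in the lower half and \<open>F1\<close> in the upper half of
  the last coordinate; on the sides of the cylinder both agree.\<close>

lemma homotopy_rel_boundary:
  assumes F0: "continuous_map (unit_cube n) Y F0" and F1: "continuous_map (unit_cube n) Y F1"
    and eq: "\<And>x. x \<in> cube_boundary n \<Longrightarrow> F0 x = F1 x"
    and ext: "\<And>b. continuous_map (subtopology (unit_cube (Suc n)) (cube_boundary (Suc n))) Y b \<Longrightarrow>
      \<exists>F. continuous_map (unit_cube (Suc n)) Y F \<and> (\<forall>x\<in>cube_boundary (Suc n). F x = b x)"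
  obtains h where "continuous_map (prod_topology (top_of_set {0..1::real}) (unit_cube n)) Y h"
    "\<And>x. x \<in> topspace (unit_cube n) \<Longrightarrow> h (0, x) = F0 x"
    "\<And>x. x \<in> topspace (unit_cube n) \<Longrightarrow> h (1, x) = F1 x"
    "\<And>t x. \<lbrakk>t \<in> {0..1}; x \<in> cube_boundary n\<rbrakk> \<Longrightarrow> h (t, x) = F0 x"
proof -
  let ?tr = "\<lambda>y::nat\<Rightarrow>real. y(n := 0)"
  let ?B = "subtopology (unit_cube (Suc n)) (cube_boundary (Suc n))"
  define b where "b y = (if y n \<le> 1/2 then F0 (?tr y) else F1 (?tr y))" for y
  have tr: "?tr y \<in> topspace (unit_cube n)" if "y \<in> topspace (unit_cube (Suc n))" for y
    using that by (auto simp: topspace_unit_cube)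
  have ctr: "continuous_map (unit_cube (Suc n)) (unit_cube n) ?tr"
  proof -
    have "continuous_on A ?tr" for A
      by (rule continuous_on_fun_upd; intro continuous_intros)
    then show ?thesis using tr unfolding unit_cube_eq continuous_map_in_subtopology
      by (auto simp: topspace_unit_cube)
  qed
  have cb: "continuous_map ?B Y b"
    unfolding b_def
  proof (rule continuous_map_cases_le)
    show "continuous_map ?B euclideanreal (\<lambda>y. y n)"
      by (auto simp: unit_cube_eq subtopology_subtopology intro!: continuous_intros)
    show "continuous_map (subtopology ?B {y \<in> topspace ?B. y n \<le> 1/2}) Y (\<lambda>y. F0 (?tr y))"
      by (intro continuous_map_from_subtopology continuous_map_compose[OF ctr F0, unfolded o_def])
    show "continuous_map (subtopology ?B {y \<in> topspace ?B. 1/2 \<le> y n}) Y (\<lambda>y. F1 (?tr y))"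
      by (intro continuous_map_from_subtopology continuous_map_compose[OF ctr F1, unfolded o_def])
    show "F0 (?tr y) = F1 (?tr y)" if "y \<in> topspace ?B" "y n = 1/2" for y
      by (rule eq) (use that in \<open>auto simp: cube_boundary_def topspace_unit_cube less_Suc_eq\<close>)
  qed auto
  obtain F where F: "continuous_map (unit_cube (Suc n)) Y F" "\<And>x. x \<in> cube_boundary (Suc n) \<Longrightarrow> F x = b x"
    using ext[OF cb] by blast
  let ?h = "\<lambda>w::real \<times> (nat \<Rightarrow> real). F ((snd w)(n := fst w))"
  have x0: "x(n := 0) = x" if "x \<in> topspace (unit_cube n)" for x
    using that by (auto simp: topspace_unit_cube)
  have bd: "x(n := t) \<in> cube_boundary (Suc n)"
    if "x \<in> topspace (unit_cube n)" "t \<in> {0..1}" "x \<in> cube_boundary n \<or> t = 0 \<or> t = 1" for t x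
  proof -
    have "x(n := t) \<in> topspace (unit_cube (Suc n))"
      using that(1,2) by (auto simp: topspace_unit_cube less_Suc_eq)
    moreover have "\<exists>i<Suc n. (x(n := t)) i = 0 \<or> (x(n := t)) i = 1"
      using that(3)
    proof (elim disjE)
      assume "x \<in> cube_boundary n"
      then obtain i where "i < n" "x i = 0 \<or> x i = 1" unfolding cube_boundary_def by blast
      then show ?thesis by (intro exI[of _ i]) auto
    qed auto
    ultimately show ?thesis by (simp add: cube_boundary_def)
  qed
  show ?thesis
  proof (rule that[of ?h])
    show "continuous_map (prod_topology (top_of_set {0..1::real}) (unit_cube n)) Y ?h"
    proof (rule continuous_map_compose[OF _ F(1), unfolded o_def])
      have "continuous_on A (\<lambda>w::real \<times> (nat \<Rightarrow> real). (snd w)(n := fst w))" for A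
        by (rule continuous_on_fun_upd; intro continuous_intros)
      then show "continuous_map (prod_topology (top_of_set {0..1::real}) (unit_cube n)) (unit_cube (Suc n))
            (\<lambda>w. (snd w)(n := fst w))"
        unfolding unit_cube_eq continuous_map_in_subtopology by (auto simp: less_Suc_eq)
    qed
    show "?h (0, x) = F0 x" "?h (1, x) = F1 x" if "x \<in> topspace (unit_cube n)" for x
    proof -
      have "F (x(n := 0)) = b (x(n := 0))" by (intro F(2) bd that) auto
      also have "\<dots> = F0 (x(n := 0))" by (simp add: b_def)
      also have "\<dots> = F0 x" using x0[OF that] by (rule arg_cong)
      finally show "?h (0, x) = F0 x" by simp
      have "F (x(n := 1)) = b (x(n := 1))" by (intro F(2) bd that) auto
      also have "\<dots> = F1 x" using x0[OF that] by (simp add: b_def)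
      finally show "?h (1, x) = F1 x" by simp
    qed
    show "?h (t, x) = F0 x" if "t \<in> {0..1}" "x \<in> cube_boundary n" for t x
    proof -
      have x: "x \<in> topspace (unit_cube n)" using that(2) cube_boundary_subset by blast
      show ?thesis
        using F(2)[OF bd[OF x that(1) disjI1[OF that(2)]]] x0[OF x] eq[OF that(2)]
        by (simp add: b_def split: if_splits)
    qed
  qed
qed

lemma cube_concat_continuous:
  assumes n: "n > 0" and f: "continuous_map (unit_cube n) Y f" and g: "continuous_map (unit_cube n) Y g"
    and eq: "\<And>x. \<lbrakk>x \<in> topspace (unit_cube n); x 0 = 1\<rbrakk> \<Longrightarrow> f x = g (x(0 := 0))"
  shows "continuous_map (unit_cube n) Y (cube_concat f g)"
  unfolding cube_concat_def
proof (rule continuous_map_cases_le)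
  let ?C = "topspace (unit_cube n)"
  show "continuous_map (unit_cube n) euclideanreal (\<lambda>x. x 0)"
    by (auto simp: unit_cube_eq intro!: continuous_intros)
  have c: "continuous_on A (\<lambda>x::nat \<Rightarrow> real. x(0 := 2 * x 0 - s))" for A and s :: real
    by (rule continuous_on_fun_upd; intro continuous_intros)
  have top: "subtopology (unit_cube n) A = top_of_set (?C \<inter> A)" for A
    by (simp add: unit_cube_eq subtopology_subtopology)
  have "continuous_map (subtopology (unit_cube n) {x \<in> ?C. x 0 \<le> 1/2}) (unit_cube n) (\<lambda>x. x(0 := 2 * x 0))"
    unfolding top using n c[of _ 0] by (auto simp: unit_cube_eq continuous_map_in_subtopology)
  then show "continuous_map (subtopology (unit_cube n) {x \<in> ?C. x 0 \<le> 1/2}) Y (\<lambda>x. f (x(0 := 2 * x 0)))"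
    by (rule continuous_map_compose[OF _ f, unfolded o_def])
  have "continuous_map (subtopology (unit_cube n) {x \<in> ?C. 1/2 \<le> x 0}) (unit_cube n) (\<lambda>x. x(0 := 2 * x 0 - 1))"
    unfolding top using n c[of _ 1] by (auto simp: unit_cube_eq continuous_map_in_subtopology)
  then show "continuous_map (subtopology (unit_cube n) {x \<in> ?C. 1/2 \<le> x 0}) Y (\<lambda>x. g (x(0 := 2 * x 0 - 1)))"
    by (rule continuous_map_compose[OF _ g, unfolded o_def])
  show "f (x(0 := 2 * x 0)) = g (x(0 := 2 * x 0 - 1))" if "x \<in> ?C" "x 0 = 1/2" for x
  proof -
    have "2 * x 0 = 1" "2 * x 0 - 1 = 0" using that by simp_all
    moreover have "x(0 := 1) \<in> ?C" using that(1) n by (auto simp: topspace_unit_cube)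
    then have "f (x(0 := 1)) = g (x(0 := 0))" using eq[of "x(0 := 1)"] by simp
    ultimately show ?thesis by metis
  qed
qed simp

text \<open>Connectedness of the boundary in dimension at least 2. Every face is convex, so \<open>F\<close> is constant on
  it, and any point can be joined to the origin through at most two faces.\<close>

lemma cube_boundary_constant:
  assumes n: "n \<ge> 2"
    and seg: "\<And>x y. (\<And>t. t \<in> {0..1} \<Longrightarrow> (\<lambda>i. (1 - t) * x i + t * y i) \<in> cube_boundary n) \<Longrightarrow> F x = F y"
    and x: "x \<in> cube_boundary n"
  shows "F x = F (\<lambda>_. 0)"
proof -
  have face: "F x = F y" if "x \<in> topspace (unit_cube n)" "y \<in> topspace (unit_cube n)" "i < n"
    "x i = y i" "x i = 0 \<or> x i = 1" for x y i
  proof (rule seg)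
    fix t :: real assume t: "t \<in> {0..1}"
    let ?z = "\<lambda>i. (1 - t) * x i + t * y i"
    have "0 \<le> ?z j \<and> ?z j \<le> 1" if "j < n" for j
      using convex_bound_le[of "x j" 1 "y j" "1 - t" t] t that \<open>x \<in> _\<close> \<open>y \<in> _\<close>
      by (auto simp: topspace_unit_cube)
    moreover have "?z i = x i" using \<open>x i = y i\<close> by (simp add: algebra_simps)
    moreover have "?z j = 0" if "j \<ge> n" for j
      using that \<open>x \<in> _\<close> \<open>y \<in> _\<close> by (auto simp: topspace_unit_cube)
    ultimately have "?z \<in> topspace (unit_cube n)" unfolding topspace_unit_cube by blast
    moreover have "?z i = 0 \<or> ?z i = 1" using \<open>?z i = x i\<close> \<open>x i = 0 \<or> x i = 1\<close> by metis
    ultimately show "?z \<in> cube_boundary n"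
      unfolding cube_boundary_def using \<open>i < n\<close> by blast
  qed
  obtain i where i: "i < n" "x i = 0 \<or> x i = 1" and xc: "x \<in> topspace (unit_cube n)"
    using x unfolding cube_boundary_def by blast
  define j where "j = (if i = 0 then 1 else 0 :: nat)"
  have j: "j < n" "j \<noteq> i" using n by (auto simp: j_def)
  have xj: "x(j := 0) \<in> topspace (unit_cube n)" using xc by (auto simp: topspace_unit_cube)
  have "F x = F (x(j := 0))" using face[OF xc xj i(1)] i j by auto
  also have "\<dots> = F (\<lambda>_. 0)" by (rule face[OF xj _ j(1)]) (auto simp: topspace_unit_cube)
  finally show ?thesis .
qed


section \<open>Discs and simplices\<close>

lemma closed_disc_eq:
  "closed_disc n = top_of_set {x. (\<Sum>i<n. x i ^ 2) \<le> 1 \<and> (\<forall>i\<ge>n. x i = 0)}"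
  unfolding closed_disc_def Euclidean_space_def euclidean_product_topology subtopology_subtopology
  by (rule arg_cong[of _ _ top_of_set]) auto

lemma compact_space_closed_disc: "compact_space (closed_disc n)"
proof -
  let ?D = "{x::nat\<Rightarrow>real. (\<Sum>i<n. x i ^ 2) \<le> 1 \<and> (\<forall>i\<ge>n. x i = 0)}"
  have "compactin (product_topology (\<lambda>_. euclideanreal) UNIV) (PiE UNIV (\<lambda>i. if i < n then {-1..1::real} else {0}))"
    by (subst compactin_PiE) auto
  then have 1: "compact (PiE UNIV (\<lambda>i::nat. if i < n then {-1..1::real} else {0}))"
    by (simp add: euclidean_product_topology)
  have "closed {x::nat\<Rightarrow>real. (\<Sum>i<n. x i ^ 2) \<le> 1}"
    by (intro closed_Collect_le continuous_intros)
  then have "compact (PiE UNIV (\<lambda>i::nat. if i < n then {-1..1::real} else {0}) \<inter> {x. (\<Sum>i<n. x i ^ 2) \<le> 1})"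
    using 1 by (rule compact_Int_closed[rotated])
  also have "PiE UNIV (\<lambda>i::nat. if i < n then {-1..1::real} else {0}) \<inter> {x. (\<Sum>i<n. x i ^ 2) \<le> 1} = ?D"
  proof -
    have "x i \<in> {-1..1}" if "(\<Sum>i<n. x i ^ 2) \<le> 1" "i < n" for x :: "nat \<Rightarrow> real" and i
    proof -
      have "x i ^ 2 \<le> (\<Sum>i<n. x i ^ 2)" by (rule member_le_sum) (use that in auto)
      then have "x i ^ 2 \<le> 1" using that by simp
      then have "\<bar>x i\<bar> \<le> 1" by (simp add: abs_square_le_1)
      then show ?thesis by auto
    qed
    then have "x \<in> PiE UNIV (\<lambda>i. if i < n then {-1..1} else {0}) \<inter> {x. (\<Sum>i<n. x i ^ 2) \<le> 1} \<longleftrightarrow> x \<in> ?D" for x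
      unfolding PiE_UNIV_domain Int_iff mem_Collect_eq Pi_iff by (metis UNIV_I not_le singleton_iff)
    then show ?thesis by blast
  qed
  finally show ?thesis by (simp add: closed_disc_eq compact_space_subtopology)
qed

text \<open>The disc is mapped to the standard simplex in \<open>n + 1\<close> coordinates of sum 0: a point gets
  \<open>- (y\<^sub>0 + \<dots> + y\<^sub>n\<^sub>-\<^sub>1)\<close> as an extra coordinate, and the simplex is the set where all coordinates are
  at least \<open>- 1\<close>. Its gauge is \<open>disc_gauge\<close>, and rescaling by the quotient of the Euclidean norm
  and the gauge carries the unit ball to the simplex. In the centre the quotient is \<open>0 / 0 = 0\<close>.\<close>

definition disc_ext :: "nat \<Rightarrow> (nat \<Rightarrow> real) \<Rightarrow> nat \<Rightarrow> real" where
  "disc_ext n y i = (if i < n then y i else - (\<Sum>j<n. y j))"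

definition disc_gauge :: "nat \<Rightarrow> (nat \<Rightarrow> real) \<Rightarrow> real" where
  "disc_gauge n y = Max ((\<lambda>i. - disc_ext n y i) ` {..n})"

definition disc_norm :: "nat \<Rightarrow> (nat \<Rightarrow> real) \<Rightarrow> real" where
  "disc_norm n y = sqrt (\<Sum>i<n. y i ^ 2)"

definition disc_to_simplex :: "nat \<Rightarrow> (nat \<Rightarrow> real) \<Rightarrow> nat \<Rightarrow> real" where
  "disc_to_simplex n y i = (1 + disc_ext n y i * disc_norm n y / disc_gauge n y) / real (Suc n)"

lemma sum_disc_ext: "(\<Sum>i\<le>n. disc_ext n y i) = 0"
  by (simp add: disc_ext_def lessThan_Suc_atMost[symmetric])

lemma disc_gauge_ge: "i \<le> n \<Longrightarrow> - disc_ext n y i \<le> disc_gauge n y"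
  unfolding disc_gauge_def by (intro Max_ge) auto

lemma disc_gauge_attained: "\<exists>i\<le>n. - disc_ext n y i = disc_gauge n y"
proof -
  have "disc_gauge n y \<in> (\<lambda>i. - disc_ext n y i) ` {..n}" unfolding disc_gauge_def by (intro Max_in) auto
  then show ?thesis by auto
qed

text \<open>The coordinates sum to 0 and each is at least minus the gauge, so none can exceed \<open>n\<close> times the gauge.\<close>

lemma disc_ext_le: "i \<le> n \<Longrightarrow> \<bar>disc_ext n y i\<bar> \<le> real (Suc n) * disc_gauge n y"
proof -
  assume i: "i \<le> n"
  have nonneg: "disc_gauge n y \<ge> 0"
  proof (rule ccontr)
    assume "\<not> ?thesis"
    then have "disc_ext n y i > 0" if "i \<le> n" for i using disc_gauge_ge[OF that, of y] by linarith
    then have "(\<Sum>i\<le>n. disc_ext n y i) > 0" by (intro sum_pos) auto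
    then show False by (simp add: sum_disc_ext)
  qed
  have "disc_ext n y i + disc_gauge n y \<le> (\<Sum>i\<le>n. disc_ext n y i + disc_gauge n y)"
    using disc_gauge_ge[of _ n y] i
    by (intro member_le_sum[of i "{..n}" "\<lambda>i. disc_ext n y i + disc_gauge n y"]) (force simp: algebra_simps)+
  also have "\<dots> = real (Suc n) * disc_gauge n y" by (simp add: sum.distrib sum_disc_ext)
  finally have "disc_ext n y i \<le> real (Suc n) * disc_gauge n y" using nonneg by simp
  moreover have "disc_gauge n y \<le> real (Suc n) * disc_gauge n y" using nonneg by (simp add: algebra_simps)
  ultimately show ?thesis using disc_gauge_ge[OF i, of y] by linarith
qed

lemma disc_gauge_nonneg: "disc_gauge n y \<ge> 0"
  using disc_ext_le[of n n y] abs_ge_zero[of "disc_ext n y n"]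
  by (smt (verit) mult_less_0_iff of_nat_0_less_iff order_refl zero_less_Suc)

lemma disc_gauge_0:
  assumes "disc_gauge n y = 0" shows "i < n \<Longrightarrow> y i = 0" "disc_norm n y = 0"
proof -
  have y: "y i = 0" if "i < n" for i
    using disc_ext_le[of i n y] assms that by (simp add: disc_ext_def)
  then show "i < n \<Longrightarrow> y i = 0" "disc_norm n y = 0" by (auto simp: disc_norm_def)
qed

lemma disc_norm_0: "disc_norm n y = 0 \<Longrightarrow> disc_gauge n y = 0"
proof -
  assume "disc_norm n y = 0"
  then have "y i = 0" if "i < n" for i
    using that by (simp add: disc_norm_def sum_nonneg_eq_0_iff)
  then have "disc_ext n y i = 0" for i by (simp add: disc_ext_def)
  then show ?thesis using disc_gauge_attained[of n y] by simp
qed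

lemma disc_norm_nonneg: "disc_norm n y \<ge> 0" by (simp add: disc_norm_def sum_nonneg)

text \<open>In the centre continuity comes from the bound \<open>\<bar>w\<^sub>i\<bar> \<le> (n + 1) \<parallel>y\<parallel>\<close> for the rescaled coordinates \<open>w\<close>.\<close>

lemma continuous_on_disc_to_simplex:
  assumes i: "i \<le> n" shows "continuous_on A (\<lambda>y. disc_to_simplex n y i)"
proof -
  have cext: "continuous_on A (\<lambda>y. disc_ext n y j)" for A j
    unfolding disc_ext_def by (cases "j < n") (auto intro!: continuous_intros)
  have cgauge: "continuous_on A (disc_gauge n)" for A
    unfolding disc_gauge_def by (intro continuous_on_Max continuous_on_minus cext) auto
  have cnorm: "continuous_on A (disc_norm n)" for A
    unfolding disc_norm_def by (intro continuous_intros)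
  let ?w = "\<lambda>y. disc_ext n y i * disc_norm n y / disc_gauge n y"
  have "isCont ?w y" for y
  proof (cases "disc_gauge n y = 0")
    case False
    then show ?thesis
      using cext[of UNIV i] cgauge[of UNIV] cnorm[of UNIV]
      by (intro continuous_intros) (auto simp: continuous_on_eq_continuous_at)
  next
    case True
    have bound: "norm (?w x) \<le> real (Suc n) * disc_norm n x" for x
    proof (cases "disc_gauge n x = 0")
      case False
      then have "disc_gauge n x > 0" using disc_gauge_nonneg[of n x] by linarith
      then have "\<bar>disc_ext n x i\<bar> / disc_gauge n x \<le> real (Suc n)"
        using disc_ext_le[OF i, of x] by (simp add: pos_divide_le_eq)
      then have "\<bar>disc_ext n x i\<bar> / disc_gauge n x * disc_norm n x \<le> real (Suc n) * disc_norm n x"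
        by (intro mult_right_mono disc_norm_nonneg)
      then show ?thesis using \<open>disc_gauge n x > 0\<close> disc_norm_nonneg[of n x]
        by (simp add: abs_mult)
    qed (simp add: disc_norm_nonneg)
    have "isCont (\<lambda>x. real (Suc n) * disc_norm n x) y"
      using cnorm[of UNIV] by (intro continuous_intros) (auto simp: continuous_on_eq_continuous_at)
    then have "(\<lambda>x. real (Suc n) * disc_norm n x) \<midarrow>y\<rightarrow> 0"
      using disc_gauge_0(2)[OF True] by (simp add: isCont_def)
    then have "?w \<midarrow>y\<rightarrow> 0"
      by (rule Lim_null_comparison[OF always_eventually, rotated]) (use bound in blast)
    then show ?thesis using True by (simp add: isCont_def)
  qed
  then have "continuous_on A ?w" by (simp add: continuous_at_imp_continuous_on)
  then show ?thesis unfolding disc_to_simplex_def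
    by (rule continuous_on_divide[OF continuous_on_add[OF continuous_on_const] continuous_on_const]) simp
qed

lemma sum_disc_to_simplex: "(\<Sum>i\<le>n. disc_to_simplex n y i) = 1"
proof -
  have "(\<Sum>i\<le>n. disc_ext n y i * disc_norm n y / disc_gauge n y) = 0"
    using sum_disc_ext[of n y] by (simp flip: sum_distrib_right sum_divide_distrib)
  then show ?thesis
    by (simp add: disc_to_simplex_def sum.distrib flip: sum_divide_distrib)
qed

lemma disc_to_simplex_ge:
  assumes "i \<le> n" shows "disc_to_simplex n y i \<ge> (1 - disc_norm n y) / real (Suc n)"
proof -
  have "- disc_ext n y i * disc_norm n y / disc_gauge n y \<le> disc_norm n y"
  proof (cases "disc_gauge n y = 0")
    case False
    then have g: "disc_gauge n y > 0" using disc_gauge_nonneg[of n y] by linarith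
    have "- disc_ext n y i * disc_norm n y \<le> disc_gauge n y * disc_norm n y"
      by (intro mult_right_mono disc_gauge_ge disc_norm_nonneg assms)
    then show ?thesis by (subst pos_divide_le_eq[OF g]) (simp add: mult.commute)
  qed (simp add: disc_norm_nonneg)
  then show ?thesis unfolding disc_to_simplex_def by (intro divide_right_mono) auto
qed

text \<open>Together with the preceding bound this recovers the norm of \<open>y\<close> from its barycentric coordinates:
  their least value is \<open>(1 - \<parallel>y\<parallel>) / (n + 1)\<close>.\<close>

lemma disc_to_simplex_attained:
  obtains i where "i \<le> n" "disc_to_simplex n y i = (1 - disc_norm n y) / real (Suc n)"
proof -
  obtain i where i: "i \<le> n" "- disc_ext n y i = disc_gauge n y" using disc_gauge_attained by blast
  then have e: "disc_ext n y i = - disc_gauge n y" by simp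
  have "disc_ext n y i * disc_norm n y / disc_gauge n y = - disc_norm n y"
    using disc_gauge_0(2)[of n y] by (cases "disc_gauge n y = 0") (simp_all add: e)
  then show ?thesis using that[OF i(1)] by (simp add: disc_to_simplex_def)
qed

lemma disc_to_simplex_nonneg:
  assumes "y \<in> topspace (closed_disc n)" "i \<le> n" shows "disc_to_simplex n y i \<ge> 0"
proof -
  have "disc_norm n y \<le> 1" using assms by (simp add: closed_disc_eq disc_norm_def)
  then have "(1 - disc_norm n y) / real (Suc n) \<ge> 0" by simp
  then show ?thesis using disc_to_simplex_ge[OF assms(2), of y] by linarith
qed

lemma disc_to_simplex_pos_iff:
  assumes "y \<in> topspace (closed_disc n)"
  shows "(\<forall>i\<le>n. disc_to_simplex n y i > 0) \<longleftrightarrow> y \<in> open_disc n"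
proof -
  have "y \<in> open_disc n \<longleftrightarrow> disc_norm n y < 1"
    using assms by (simp add: closed_disc_eq open_disc_def topspace_Euclidean_space disc_norm_def)
  moreover have "(\<forall>i\<le>n. disc_to_simplex n y i > 0) \<longleftrightarrow> disc_norm n y < 1"
  proof
    assume *: "\<forall>i\<le>n. disc_to_simplex n y i > 0"
    obtain i where "i \<le> n" "disc_to_simplex n y i = (1 - disc_norm n y) / real (Suc n)"
      using disc_to_simplex_attained .
    with * have "(1 - disc_norm n y) / real (Suc n) > 0" by metis
    then show "disc_norm n y < 1" by (simp add: zero_less_divide_iff)
  next
    assume "disc_norm n y < 1"
    then have "(1 - disc_norm n y) / real (Suc n) > 0" by simp
    then show "\<forall>i\<le>n. disc_to_simplex n y i > 0" using disc_to_simplex_ge by (meson less_le_trans)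
  qed
  ultimately show ?thesis by simp
qed

lemma disc_to_simplex_inj:
  assumes y: "y \<in> topspace (closed_disc n)" and z: "z \<in> topspace (closed_disc n)"
    and eq: "\<And>i. i \<le> n \<Longrightarrow> disc_to_simplex n y i = disc_to_simplex n z i"
  shows "y = z"
proof -
  have le: "disc_norm n v \<le> disc_norm n u" if eq: "\<And>i. i \<le> n \<Longrightarrow> disc_to_simplex n u i = disc_to_simplex n v i" for u v
  proof -
    obtain i where i: "i \<le> n" "disc_to_simplex n v i = (1 - disc_norm n v) / real (Suc n)"
      using disc_to_simplex_attained .
    then have "(1 - disc_norm n u) / real (Suc n) \<le> (1 - disc_norm n v) / real (Suc n)"
      using disc_to_simplex_ge[OF i(1), of u] eq[OF i(1)] by simp
    then show ?thesis by (simp add: divide_le_cancel)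
  qed
  have N: "disc_norm n y = disc_norm n z" using le[of y z] le[of z y] eq by force
  have out: "y i = 0" "z i = 0" if "i \<ge> n" for i using y z that by (auto simp: closed_disc_eq)
  show ?thesis
  proof (cases "disc_gauge n y = 0")
    case True
    then have "disc_gauge n z = 0" using N disc_gauge_0(2)[of n y] disc_norm_0[of n z] by simp
    then show ?thesis using disc_gauge_0(1)[OF True] disc_gauge_0(1)[of n z] out
      by (metis ext not_le)
  next
    case False
    then have gz: "disc_gauge n z \<noteq> 0" using N disc_gauge_0(2)[of n z] disc_norm_0[of n y] by auto
    have N0: "disc_norm n y \<noteq> 0" using False disc_norm_0 by blast
    define k where "k = disc_gauge n y / disc_gauge n z"
    have k: "y i = k * z i" for i
    proof (cases "i < n")
      case True
      then have "disc_ext n y i * disc_norm n y / disc_gauge n y = disc_ext n z i * disc_norm n z / disc_gauge n z"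
        using eq[of i] by (simp add: disc_to_simplex_def)
      then have "y i / disc_gauge n y = z i / disc_gauge n z"
      proof -
        assume "disc_ext n y i * disc_norm n y / disc_gauge n y = disc_ext n z i * disc_norm n z / disc_gauge n z"
        then have "(y i / disc_gauge n y) * disc_norm n y = (z i / disc_gauge n z) * disc_norm n y"
          using True N by (simp add: disc_ext_def)
        then show "y i / disc_gauge n y = z i / disc_gauge n z"
          using mult_right_cancel[OF N0] by blast
      qed
      then show ?thesis using False gz by (simp add: k_def field_simps)
    qed (simp add: out)
    have "k > 0" using False gz disc_gauge_nonneg[of n y] disc_gauge_nonneg[of n z] by (simp add: k_def less_le)
    have "disc_norm n y = k * disc_norm n z"
      using \<open>k > 0\<close> by (simp add: disc_norm_def k power_mult_distrib real_sqrt_mult flip: sum_distrib_left)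
    then have "k = 1" using N N0 by simp
    then show ?thesis using k by (auto simp: fun_eq_iff)
  qed
qed

lemma disc_to_simplex_surj:
  assumes pos: "\<And>i. i \<le> n \<Longrightarrow> b i > 0" and sum: "(\<Sum>i\<le>n. b i) = 1"
  obtains y where "y \<in> open_disc n" "\<And>i. i \<le> n \<Longrightarrow> disc_to_simplex n y i = b i"
proof -
  define v where "v i = (if i < n then real (Suc n) * b i - 1 else 0)" for i
  have "(\<Sum>i<n. b i) = 1 - b n" using sum by (simp flip: lessThan_Suc_atMost)
  then have ext: "disc_ext n v i = real (Suc n) * b i - 1" if "i \<le> n" for i
  proof (cases "i < n")
    case False
    have "(\<Sum>j<n. v j) = real (Suc n) * (\<Sum>j<n. b j) - real n"
      by (simp add: v_def sum_subtractf sum_distrib_left)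
    then show ?thesis using False that \<open>(\<Sum>i<n. b i) = 1 - b n\<close>
      by (simp add: disc_ext_def algebra_simps)
  qed (simp add: disc_ext_def v_def)
  have g: "disc_gauge n v < 1"
  proof -
    obtain i where "i \<le> n" "- disc_ext n v i = disc_gauge n v" using disc_gauge_attained by blast
    then show ?thesis using ext[of i] pos[of i] by (smt (verit) mult_pos_pos of_nat_0_less_iff zero_less_Suc)
  qed
  define k where "k = disc_gauge n v / disc_norm n v"
  define y where "y = (\<lambda>i. k * v i)"
  have k: "k \<ge> 0" unfolding k_def by (simp add: disc_gauge_nonneg disc_norm_nonneg)
  have ey: "disc_ext n y i = k * disc_ext n v i" for i
    by (simp add: disc_ext_def y_def sum_distrib_left)
  have Ny: "disc_norm n y = k * disc_norm n v"
    using k by (simp add: disc_norm_def y_def power_mult_distrib real_sqrt_mult flip: sum_distrib_left)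
  have gy: "disc_gauge n y = k * disc_gauge n v"
  proof (rule antisym)
    obtain i where "i \<le> n" "- disc_ext n y i = disc_gauge n y" using disc_gauge_attained by blast
    then show "disc_gauge n y \<le> k * disc_gauge n v"
      using ey[of i] mult_left_mono[OF disc_gauge_ge[of i n v] k] by simp
    obtain i where i: "i \<le> n" "- disc_ext n v i = disc_gauge n v" using disc_gauge_attained by blast
    then have "k * disc_gauge n v = - disc_ext n y i" using ey[of i] by (metis mult_minus_right)
    then show "k * disc_gauge n v \<le> disc_gauge n y"
      using disc_gauge_ge[OF i(1), of y] by simp
  qed
  have Ng: "disc_norm n y = disc_gauge n v"
    unfolding Ny k_def using disc_norm_0[of n v] by (cases "disc_norm n v = 0") auto
  then have "y \<in> open_disc n"
  proof -
    have "disc_norm n y < 1" using g Ng by simp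
    then have "(\<Sum>i<n. y i ^ 2) < 1" unfolding disc_norm_def real_sqrt_lt_1_iff .
    then show ?thesis by (simp add: open_disc_def topspace_Euclidean_space) (simp add: y_def v_def)
  qed
  moreover have "disc_to_simplex n y i = b i" if i: "i \<le> n" for i
  proof -
    have "disc_ext n y i * disc_norm n y / disc_gauge n y = disc_ext n v i"
    proof (cases "disc_gauge n v = 0")
      case True
      then show ?thesis using disc_ext_le[OF i, of v] by (simp add: ey)
    next
      case False
      then have "k \<noteq> 0" using disc_gauge_0(2)[of n v] disc_norm_0[of n v] by (auto simp: k_def)
      then show ?thesis using False by (simp add: ey gy Ng)
    qed
    then show ?thesis using ext[OF i] by (simp add: disc_to_simplex_def)
  qed
  ultimately show ?thesis using that by blast
qed


section \<open>Metric coverings\<close>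

context Metric_space begin

lemma continuous_map_mtopologyI:
  assumes "\<And>z. z \<in> topspace Z \<Longrightarrow> f z \<in> M"
    and "\<And>z \<epsilon>. \<lbrakk>z \<in> topspace Z; \<epsilon> > 0\<rbrakk> \<Longrightarrow> \<exists>U. openin Z U \<and> z \<in> U \<and> (\<forall>w\<in>U. d (f z) (f w) < \<epsilon>)"
  shows "continuous_map Z mtopology f"
  unfolding continuous_map_to_metric
proof (intro ballI allI impI)
  fix z and \<epsilon> :: real assume z: "z \<in> topspace Z" and e: "\<epsilon> > 0"
  then obtain U where U: "openin Z U" "z \<in> U" "\<forall>w\<in>U. d (f z) (f w) < \<epsilon>"
    using assms(2) by blast
  moreover have "\<forall>w\<in>U. f w \<in> M" using U assms(1) openin_subset by fastforce
  ultimately show "\<exists>U. openin Z U \<and> z \<in> U \<and> (\<forall>y\<in>U. f y \<in> mball (f z) \<epsilon>)"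
    using assms(1) z by (auto simp: in_mball)
qed

lemma continuous_map_mtopologyD:
  assumes "continuous_map Z mtopology f" "z \<in> topspace Z" "\<epsilon> > 0"
  shows "\<exists>U. openin Z U \<and> z \<in> U \<and> (\<forall>w\<in>U. d (f z) (f w) < \<epsilon>)"
proof -
  have "f z \<in> M" using assms by (metis continuous_map_image_subset_topspace image_subset_iff topspace_mtopology)
  then show ?thesis
    using assms unfolding continuous_map_to_metric by (metis in_mball)
qed

lemma continuous_map_in_M:
  assumes "continuous_map Z mtopology f" "z \<in> topspace Z" shows "f z \<in> M"
  using assms by (metis continuous_map_image_subset_topspace image_subset_iff topspace_mtopology)

lemma continuous_map_dist:
  assumes "continuous_map Z mtopology f" "continuous_map Z mtopology g"
  shows "continuous_map Z euclideanreal (\<lambda>z. d (f z) (g z))"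
  using continuous_map_mdist[of Z Self f g] assms by (simp add: mtopology_of_def)

text \<open>Tube lemma over the compact space \<open>Z\<close>, followed by a Lebesgue number for the unit interval.\<close>

lemma uniform_in_parameter:
  assumes H: "continuous_map (prod_topology (top_of_set {0..1::real}) Z) mtopology H"
    and Z: "compact_space Z" and \<epsilon>: "\<epsilon> > 0"
  obtains N :: nat where "N > 0" "\<And>s t z. \<lbrakk>s \<in> {0..1}; t \<in> {0..1}; \<bar>s - t\<bar> \<le> 1 / N; z \<in> topspace Z\<rbrakk>
      \<Longrightarrow> d (H (s, z)) (H (t, z)) < \<epsilon>"
proof -
  let ?I = "top_of_set {0..1::real}"
  have "\<exists>V. open V \<and> s \<in> V \<and> (\<forall>t\<in>V \<inter> {0..1}. \<forall>z\<in>topspace Z. d (H (s, z)) (H (t, z)) < \<epsilon> / 2)"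
    if s: "s \<in> {0..1}" for s
  proof -
    define W where "W = {w \<in> topspace (prod_topology ?I Z). d (H (s, snd w)) (H w) \<in> {..<\<epsilon>/2}}"
    have c1: "continuous_map (prod_topology ?I Z) mtopology (\<lambda>w. H (s, snd w))"
      by (rule continuous_map_compose[OF _ H, unfolded o_def])
        (use s in \<open>auto simp: continuous_map_pairedI continuous_map_snd\<close>)
    have "openin (prod_topology ?I Z) W"
      unfolding W_def
      by (rule openin_continuous_map_preimage[where Y=euclideanreal, OF continuous_map_dist[OF c1 H]]) auto
    moreover have "{s} \<times> topspace Z \<subseteq> W"
      using s \<epsilon> continuous_map_in_M[OF H] by (auto simp: W_def)
    ultimately obtain U V where UV: "openin ?I U" "openin Z V" "s \<in> U" "topspace Z \<subseteq> V" "U \<times> V \<subseteq> W"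
      using tube_lemma_right[of ?I Z W "topspace Z" s] Z s unfolding compact_space_def by auto
    then obtain T where T: "open T" "U = {0..1} \<inter> T" by (auto simp: openin_open)
    have "d (H (s, z)) (H (t, z)) < \<epsilon> / 2" if "t \<in> T \<inter> {0..1}" "z \<in> topspace Z" for t z
    proof -
      have "(t, z) \<in> W" using UV T that by blast
      then show ?thesis by (simp add: W_def)
    qed
    then show ?thesis using UV T by (intro exI[of _ T]) auto
  qed
  then obtain V where V: "\<And>s. s \<in> {0..1} \<Longrightarrow> open (V s) \<and> s \<in> V s \<and>
     (\<forall>t\<in>V s \<inter> {0..1}. \<forall>z\<in>topspace Z. d (H (s, z)) (H (t, z)) < \<epsilon> / 2)" by metis
  have "{0..1::real} \<subseteq> \<Union> (V ` {0..1})" "\<And>G. G \<in> V ` {0..1} \<Longrightarrow> open G"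
    using V by blast+
  then obtain e where e: "e > 0" "\<And>s. s \<in> {0..1} \<Longrightarrow> \<exists>G\<in>V ` {0..1}. ball s e \<subseteq> G"
    using Heine_Borel_lemma[of "{0..1::real}" "V ` {0..1}"] by (metis compact_Icc)
  obtain N :: nat where N: "1 / real (Suc N) < e" using e(1) nat_approx_posE by metis
  show ?thesis
  proof (rule that[of "Suc N"])
    fix s t z assume st: "s \<in> {0..1}" "t \<in> {0..1}" "\<bar>s - t\<bar> \<le> 1 / real (Suc N)" "z \<in> topspace Z"
    obtain u where u: "u \<in> {0..1}" "ball s e \<subseteq> V u" using e(2) st(1) by blast
    have "s \<in> V u" "t \<in> V u" using u(2) N st e(1) by (auto simp: dist_real_def subset_iff)
    then have "d (H (u, z)) (H (s, z)) < \<epsilon> / 2" "d (H (u, z)) (H (t, z)) < \<epsilon> / 2"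
      using V[OF u(1)] st by auto
    moreover have "H (u, z) \<in> M" "H (s, z) \<in> M" "H (t, z) \<in> M"
      using continuous_map_in_M[OF H] u st by auto
    ultimately show "d (H (s, z)) (H (t, z)) < \<epsilon>"
      by (smt (verit) commute triangle field_sum_of_halves)
  qed simp
qed

end

text \<open>A uniform version of a covering map: the gap \<open>c\<close> within the fibres takes the place of evenly
  covered neighbourhoods.\<close>

locale metric_cover = E: Metric_space E d + X: Metric_space X d'
  for E :: "'e set" and d and X :: "'x set" and d' +
  fixes p :: "'e \<Rightarrow> 'x" and c :: real
  assumes p_in: "e \<in> E \<Longrightarrow> p e \<in> X"
    and p_dist: "\<lbrakk>e \<in> E; e' \<in> E\<rbrakk> \<Longrightarrow> d' (p e) (p e') \<le> d e e'"
    and p_lift: "\<lbrakk>e \<in> E; u \<in> X\<rbrakk> \<Longrightarrow> \<exists>e'\<in>E. p e' = u \<and> d e e' = d' (p e) u"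
    and p_surj: "u \<in> X \<Longrightarrow> \<exists>e\<in>E. p e = u"
    and c_pos: "c > 0"
    and p_sep: "\<lbrakk>e \<in> E; e' \<in> E; p e = p e'; d e e' < c\<rbrakk> \<Longrightarrow> e = e'"
begin

lemma continuous_map_p:
  assumes "continuous_map Z E.mtopology F"
  shows "continuous_map Z X.mtopology (\<lambda>z. p (F z))"
proof (rule X.continuous_map_mtopologyI)
  fix z assume "z \<in> topspace Z"
  then show "p (F z) \<in> X" using E.continuous_map_in_M[OF assms] p_in by auto
  fix \<epsilon> :: real assume "\<epsilon> > 0"
  then obtain U where "openin Z U" "z \<in> U" "\<forall>w\<in>U. d (F z) (F w) < \<epsilon>"
    using E.continuous_map_mtopologyD[OF assms \<open>z \<in> topspace Z\<close>] by blast
  moreover have "d' (p (F z)) (p (F w)) \<le> d (F z) (F w)" if "w \<in> U" for w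
    using p_dist E.continuous_map_in_M[OF assms] \<open>z \<in> topspace Z\<close> openin_subset[OF \<open>openin Z U\<close>] that
    by blast
  ultimately show "\<exists>U. openin Z U \<and> z \<in> U \<and> (\<forall>w\<in>U. d' (p (F z)) (p (F w)) < \<epsilon>)"
    by (intro exI[of _ U]) fastforce
qed

text \<open>The lift picks a point of the fibre within distance \<open>c/4\<close>. It is the only one in range, and the
  same uniqueness, used around \<open>F' z\<close> with some room to spare, gives continuity.\<close>

lemma lift_close:
  assumes F: "continuous_map Z E.mtopology F" and f: "continuous_map Z X.mtopology f"
    and close: "\<And>z. z \<in> topspace Z \<Longrightarrow> d' (p (F z)) (f z) < c / 4"
  obtains F' where "continuous_map Z E.mtopology F'" "\<And>z. z \<in> topspace Z \<Longrightarrow> p (F' z) = f z"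
    "\<And>z. z \<in> topspace Z \<Longrightarrow> d (F z) (F' z) < c / 4"
proof -
  have "\<exists>e. z \<in> topspace Z \<longrightarrow> e \<in> E \<and> p e = f z \<and> d (F z) e < c / 4" for z
    using p_lift[of "F z" "f z"] close[of z] E.continuous_map_in_M[OF F] X.continuous_map_in_M[OF f] by metis
  then obtain F' where F': "\<And>z. z \<in> topspace Z \<Longrightarrow> F' z \<in> E \<and> p (F' z) = f z \<and> d (F z) (F' z) < c / 4"
    by metis
  have "continuous_map Z E.mtopology F'"
  proof (rule E.continuous_map_mtopologyI)
    fix z assume z: "z \<in> topspace Z"
    then show "F' z \<in> E" using F' by blast
    fix \<epsilon> :: real assume \<epsilon>: "\<epsilon> > 0"
    obtain U where U: "openin Z U" "z \<in> U" "\<forall>w\<in>U. d (F z) (F w) < c / 8"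
      using E.continuous_map_mtopologyD[OF F z, of "c/8"] c_pos by auto
    obtain V where V: "openin Z V" "z \<in> V" "\<forall>w\<in>V. d' (f z) (f w) < min \<epsilon> (c / 8)"
      using X.continuous_map_mtopologyD[OF f z, of "min \<epsilon> (c/8)"] c_pos \<epsilon> by auto
    have "d (F' z) (F' w) < \<epsilon>" if w: "w \<in> U \<inter> V" for w
    proof -
      have wZ: "w \<in> topspace Z" using w U(1) openin_subset by blast
      note E_in = E.continuous_map_in_M[OF F wZ] E.continuous_map_in_M[OF F z]
      obtain e where e: "e \<in> E" "p e = f w" "d (F' z) e = d' (f z) (f w)"
        using p_lift[of "F' z" "f w"] F'[OF z] X.continuous_map_in_M[OF f wZ] by metis
      have "d (F' w) e \<le> d (F' w) (F w) + d (F w) (F z) + d (F z) (F' z) + d (F' z) e"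
        using E_in e(1) F'[OF z] F'[OF wZ] by (smt (verit) E.triangle)
      also have "\<dots> < c"
      proof -
        have "d (F' w) (F w) < c / 4" "d (F z) (F' z) < c / 4" "d (F w) (F z) < c / 8"
          "d (F' z) e < c / 8"
          using F'[OF z] F'[OF wZ] w U(3) V(3) e(3) by (auto simp: E.commute)
        then show ?thesis using c_pos by linarith
      qed
      finally have "F' w = e" using p_sep[of "F' w" e] F'[OF wZ] e by auto
      then show ?thesis using e(3) V(3) w by auto
    qed
    then show "\<exists>U. openin Z U \<and> z \<in> U \<and> (\<forall>w\<in>U. d (F' z) (F' w) < \<epsilon>)"
      using U V by (intro exI[of _ "U \<inter> V"]) auto
  qed
  then show ?thesis using that F' by blast
qed

text \<open>The distance of two lifts is continuous along the path and takes no value strictly between \<open>0\<close>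
  and \<open>c\<close>.\<close>

lemma path_lift_unique:
  assumes F: "continuous_map (top_of_set {0..1::real}) E.mtopology F"
    and F': "continuous_map (top_of_set {0..1}) E.mtopology F'"
    and eq: "\<And>t. t \<in> {0..1} \<Longrightarrow> p (F t) = p (F' t)" and 0: "F 0 = F' 0" and t: "t \<in> {0..1}"
  shows "F t = F' t"
proof (rule ccontr)
  assume ne: "F t \<noteq> F' t"
  let ?D = "\<lambda>t. d (F t) (F' t)"
  have inE: "F s \<in> E" "F' s \<in> E" if "s \<in> {0..1}" for s
    using E.continuous_map_in_M[OF F] E.continuous_map_in_M[OF F'] that by auto
  have D: "?D t \<ge> c" using ne p_sep[of "F t" "F' t"] inE[OF t] eq[OF t] by force
  have "continuous_on {0..1} ?D"
    using E.continuous_map_dist[OF F F'] by simp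
  then have "continuous_on {0..t} ?D" using t by (auto intro: continuous_on_subset)
  then obtain s where s: "0 \<le> s" "s \<le> t" "?D s = c / 2"
    using IVT'[of ?D 0 "c/2" t] D 0 inE[of 0] t c_pos by auto
  then have "F s = F' s" using p_sep[of "F s" "F' s"] inE[of s] eq[of s] t c_pos by auto
  then show False using s inE[of s] t c_pos by auto
qed

lemma path_constant:
  assumes F: "continuous_map (top_of_set {0..1::real}) E.mtopology F"
    and "\<And>t. t \<in> {0..1} \<Longrightarrow> p (F t) = p (F 0)" and t: "t \<in> {0..1}"
  shows "F t = F 0"
proof (rule path_lift_unique[OF F _ _ _ t, of "\<lambda>_. F 0"])
  have "F 0 \<in> E" using E.continuous_map_in_M[OF F, of 0] by auto
  then show "continuous_map (top_of_set {0..1}) E.mtopology (\<lambda>_. F 0)" by simp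
  show "p (F s) = p (F 0)" if "s \<in> {0..1}" for s using assms(2) that .
qed (rule refl)

text \<open>The maps \<open>(t, z) \<mapsto> H (t k / N, z)\<close> for \<open>k = 0, \<dots>, N\<close> join a map with a known lift to \<open>H\<close>, and for
  large \<open>N\<close> consecutive ones are uniformly close. Lifting them one after the other gives a lift of
  \<open>H\<close> that is continuous in both variables at once.\<close>

lemma homotopy_lift:
  assumes Z: "compact_space Z"
    and H: "continuous_map (prod_topology (top_of_set {0..1::real}) Z) X.mtopology H"
    and F: "continuous_map Z E.mtopology F" and H0: "\<And>z. z \<in> topspace Z \<Longrightarrow> H (0, z) = p (F z)"
  obtains K where "continuous_map (prod_topology (top_of_set {0..1::real}) Z) E.mtopology K"
    "\<And>t z. \<lbrakk>t \<in> {0..1}; z \<in> topspace Z\<rbrakk> \<Longrightarrow> p (K (t, z)) = H (t, z)"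
    "\<And>z. z \<in> topspace Z \<Longrightarrow> K (0, z) = F z"
proof -
  let ?I = "top_of_set {0..1::real}"
  let ?IZ = "prod_topology ?I Z"
  obtain N :: nat where N: "N > 0" "\<And>s t z. \<lbrakk>s \<in> {0..1}; t \<in> {0..1}; \<bar>s - t\<bar> \<le> 1 / N; z \<in> topspace Z\<rbrakk>
      \<Longrightarrow> d' (H (s, z)) (H (t, z)) < c / 4"
    using X.uniform_in_parameter[OF H Z, of "c/4"] c_pos by auto
  define h where "h k = (\<lambda>w::real \<times> _. H (fst w * (real k / real N), snd w))" for k :: nat
  have in01: "t * (real k / real N) \<in> {0..1}" if "t \<in> {0..1}" "k \<le> N" for t k
  proof -
    have "real k / real N \<le> 1" "0 \<le> real k / real N" using that N(1) by auto
    then show ?thesis using that mult_le_one[of t "real k / real N"]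
      by (auto simp del: times_divide_eq_right)
  qed
  have h: "continuous_map ?IZ X.mtopology (h k)" if "k \<le> N" for k
    unfolding h_def
  proof (rule continuous_map_compose[OF _ H, unfolded o_def], intro continuous_map_pairedI)
    have "continuous_map ?IZ euclideanreal (\<lambda>w. fst w * (real k / real N))"
      by (intro continuous_map_real_mult continuous_map_into_fulltopology[OF continuous_map_fst]) auto
    then show "continuous_map ?IZ ?I (\<lambda>w. fst w * (real k / real N))"
      using in01[OF _ that] by (auto simp: continuous_map_in_subtopology)
  qed (rule continuous_map_snd)
  have "k \<le> N \<Longrightarrow> \<exists>K. continuous_map ?IZ E.mtopology K \<and>
      (\<forall>w\<in>topspace ?IZ. p (K w) = h k w) \<and> (\<forall>z\<in>topspace Z. K (0, z) = F z)" for k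
  proof (induction k)
    case 0
    show ?case
    proof (intro exI[of _ "\<lambda>w. F (snd w)"] conjI)
      show "continuous_map ?IZ E.mtopology (\<lambda>w. F (snd w))"
        using continuous_map_compose[OF continuous_map_snd F, unfolded o_def] .
    qed (auto simp: h_def H0)
  next
    case (Suc k)
    then obtain K where K: "continuous_map ?IZ E.mtopology K"
      "\<forall>w\<in>topspace ?IZ. p (K w) = h k w" "\<forall>z\<in>topspace Z. K (0, z) = F z" by auto
    have close: "d' (p (K w)) (h (Suc k) w) < c / 4" if w: "w \<in> topspace ?IZ" for w
    proof -
      obtain t z where tz: "w = (t, z)" "t \<in> {0..1}" "z \<in> topspace Z" using w by auto
      have "t * (real k / real N) - t * (real (Suc k) / real N) = - (t / N)"
        using N(1) by (simp add: field_simps)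
      then have "\<bar>t * (real k / real N) - t * (real (Suc k) / real N)\<bar> = t / N"
        using tz(2) by simp
      also have "\<dots> \<le> 1 / N" using tz(2) by (simp add: divide_right_mono)
      finally have "d' (H (t * (real k / real N), z)) (H (t * (real (Suc k) / real N), z)) < c / 4"
        using Suc.prems by (intro N(2) in01 tz) auto
      moreover have "p (K w) = h k w" using K(2) w by blast
      ultimately show ?thesis by (simp add: h_def tz(1))
    qed
    obtain K' where K': "continuous_map ?IZ E.mtopology K'" "\<And>w. w \<in> topspace ?IZ \<Longrightarrow> p (K' w) = h (Suc k) w"
      "\<And>w. w \<in> topspace ?IZ \<Longrightarrow> d (K w) (K' w) < c / 4"
      using lift_close[OF K(1) h[OF Suc.prems] close] by metis
    have "K' (0, z) = F z" if z: "z \<in> topspace Z" for z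
    proof -
      have w: "(0, z) \<in> topspace ?IZ" using z by auto
      have "K (0, z) = K' (0, z)"
        using p_sep[OF E.continuous_map_in_M[OF K(1) w] E.continuous_map_in_M[OF K'(1) w]]
          K(2) K'(2)[OF w] K'(3)[OF w] w c_pos by (auto simp: h_def)
      then show ?thesis using K(3) z by auto
    qed
    then show ?case using K' by auto
  qed
  from this[of N] obtain K where "continuous_map ?IZ E.mtopology K"
      "\<forall>w\<in>topspace ?IZ. p (K w) = h N w" "\<forall>z\<in>topspace Z. K (0, z) = F z" by auto
  then show ?thesis using N(1) by (intro that[of K]) (auto simp: h_def)
qed

end


section \<open>Homotopy groups of the base of a contractible covering\<close>

text \<open>The shape of \<open>\<pi>\<^sub>1\<close>: loops modulo the kernel of a multiplicative invariant.\<close>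

lemma quotient_iso_by_invariant:
  assumes R: "R = {(f, g). f \<in> L \<and> g \<in> L \<and> \<Phi> f = \<Phi> g}" and surj: "\<Phi> ` L = carrier G"
    and cat: "\<And>f g. \<lbrakk>f \<in> L; g \<in> L\<rbrakk> \<Longrightarrow> cat f g \<in> L"
    and hom: "\<And>f g. \<lbrakk>f \<in> L; g \<in> L\<rbrakk> \<Longrightarrow> \<Phi> (cat f g) = \<Phi> f \<otimes>\<^bsub>G\<^esub> \<Phi> g"
  shows "\<lparr>carrier = L // R, mult = (\<lambda>A B. R `` {cat f g | f g. f \<in> A \<and> g \<in> B}), one = u\<rparr> \<cong> G" (is "?Q \<cong> G")
proof -
  define \<psi> where "\<psi> A = the_elem (\<Phi> ` A)" for A
  have cls: "R `` {f} = {g \<in> L. \<Phi> g = \<Phi> f}" if "f \<in> L" for f using that by (auto simp: R)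
  have \<psi>: "\<psi> (R `` {f}) = \<Phi> f" if "f \<in> L" for f
  proof -
    have "\<Phi> ` (R `` {f}) = {\<Phi> f}" using that by (auto simp: cls)
    then show ?thesis by (simp add: \<psi>_def)
  qed
  have mult: "R `` {cat f' g' | f' g'. f' \<in> R `` {f} \<and> g' \<in> R `` {g}} = R `` {cat f g}"
    if "f \<in> L" "g \<in> L" for f g
  proof -
    have "R `` {h} = R `` {cat f g}" if hin: "h \<in> {cat f' g' | f' g'. f' \<in> R `` {f} \<and> g' \<in> R `` {g}}" for h
    proof -
      obtain f' g' where h: "h = cat f' g'" "f' \<in> R `` {f}" "g' \<in> R `` {g}" using hin by blast
      then have "f' \<in> L" "g' \<in> L" "\<Phi> f' = \<Phi> f" "\<Phi> g' = \<Phi> g" by (auto simp: R)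
      then show ?thesis using cls[OF cat, of f' g'] cls[OF cat, of f g] hom \<open>f \<in> L\<close> \<open>g \<in> L\<close> h(1) by simp
    qed
    moreover have "cat f g \<in> {cat f' g' | f' g'. f' \<in> R `` {f} \<and> g' \<in> R `` {g}}"
      using that by (auto simp: cls)
    ultimately show ?thesis by blast
  qed
  have "\<psi> \<in> iso ?Q G"
  proof (rule isoI)
    show "\<psi> \<in> hom ?Q G"
    proof (rule homI)
      show "\<psi> A \<in> carrier G" if "A \<in> carrier ?Q" for A
        using that surj by (auto simp: quotient_def \<psi>)
      fix A B assume "A \<in> carrier ?Q"
        "B \<in> carrier ?Q"
      then obtain f g where "f \<in> L" "A = R `` {f}" "g \<in> L" "B = R `` {g}" by (auto simp: quotient_def)
      then show "\<psi> (A \<otimes>\<^bsub>?Q\<^esub> B)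
          = \<psi> A \<otimes>\<^bsub>G\<^esub> \<psi> B"
        by (simp add: mult \<psi> cat hom del: Image_singleton_iff)
    qed
    have "inj_on \<psi> (L // R)"
    proof (rule inj_onI)
      fix A B assume "A \<in> L // R" "B \<in> L // R" and eq: "\<psi> A = \<psi> B"
      then obtain f g where fg: "f \<in> L" "A = R `` {f}" "g \<in> L" "B = R `` {g}" by (auto simp: quotient_def)
      then have "\<Phi> f = \<Phi> g" using eq \<psi> by metis
      then show "A = B" using fg cls by simp
    qed
    moreover have "\<psi> ` (L // R) = carrier G"
    proof -
      have "\<psi> ` (L // R) = \<Phi> ` L" by (force simp: quotient_def \<psi> image_iff)
      then show ?thesis using surj by simp
    qed
    ultimately show "bij_betw \<psi> (carrier ?Q) (carrier G)"
      by (simp add: bij_betw_def)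
  qed
  then show ?thesis by (auto simp: is_iso_def)
qed

definition cube1_end :: "nat \<Rightarrow> real" where "cube1_end = (\<lambda>i. if i = 0 then 1 else 0)"

lemma cube1_point:
  assumes "x \<in> topspace (unit_cube 1)" shows "x = (\<lambda>i. if i = 0 then x 0 else 0)"
  using assms by (auto simp: topspace_unit_cube fun_eq_iff)

lemma cube_boundary_1: "cube_boundary 1 = {\<lambda>_. 0, cube1_end}" "cube_boundary (Suc 0) = {\<lambda>_. 0, cube1_end}"
proof -
  have "x = (\<lambda>_. 0) \<or> x = cube1_end" if "x \<in> cube_boundary 1" for x
  proof -
    have "x \<in> topspace (unit_cube 1)" "x 0 = 0 \<or> x 0 = 1"
      using that unfolding cube_boundary_def by auto
    then show ?thesis using cube1_point[of x] unfolding cube1_end_def by (metis (full_types))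
  qed
  moreover have "(\<lambda>_. 0) \<in> cube_boundary 1" "cube1_end \<in> cube_boundary 1"
    by (simp_all add: cube_boundary_def topspace_unit_cube cube1_end_def)
  ultimately show "cube_boundary 1 = {\<lambda>_. 0, cube1_end}" by blast
  then show "cube_boundary (Suc 0) = {\<lambda>_. 0, cube1_end}" by simp
qed

lemma zero_in_cube: "(\<lambda>_. 0) \<in> topspace (unit_cube n)" by (simp add: topspace_unit_cube)

lemma cube1_end_in_cube: "cube1_end \<in> topspace (unit_cube 1)"
  by (simp add: topspace_unit_cube cube1_end_def)

lemma continuous_map_scale_cube:
  "continuous_map (prod_topology (top_of_set {0..1::real}) (unit_cube n)) (unit_cube n)
     (\<lambda>w i. fst w * snd w i)"
proof -
  have "continuous_on A (\<lambda>w::real \<times> (nat \<Rightarrow> real). (\<lambda>i. fst w * snd w i))" for A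
    by (intro continuous_on_coordinatewise_then_product continuous_on_mult continuous_on_fst
        continuous_on_product_then_coordinatewise[OF continuous_on_snd] continuous_on_id)
  then show ?thesis
    unfolding unit_cube_eq continuous_map_in_subtopology by (auto intro: mult_le_one)
qed

lemma continuous_map_segment_cube:
  assumes "\<And>t. t \<in> {0..1} \<Longrightarrow> (\<lambda>i. (1 - t) * x i + t * y i) \<in> topspace (unit_cube n)"
  shows "continuous_map (top_of_set {0..1::real}) (unit_cube n) (\<lambda>t i. (1 - t) * x i + t * y i)"
proof -
  have "continuous_on A (\<lambda>t::real. (\<lambda>i. (1 - t) * x i + t * y i))" for A
    by (intro continuous_on_coordinatewise_then_product continuous_on_add continuous_on_mult
        continuous_on_diff continuous_on_id continuous_on_const)
  then show ?thesis
    using assms unfolding topspace_unit_cube unfolding unit_cube_eq continuous_map_in_subtopology by auto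
qed

text \<open>A covering with group \<open>G\<close> of deck transformations acting simply transitively on the fibres, whose
  total space is weakly contractible. The spaces \<open>Z\<close> in \<open>null_homotopic\<close> are boundaries of cubes.\<close>

locale galois_cover = metric_cover E d X d' p c + group G
  for E :: "'e set" and d and X :: "'x set" and d' p c and G :: "('g, 'h) monoid_scheme" (structure) +
  fixes act :: "'g \<Rightarrow> 'e \<Rightarrow> 'e"
  assumes act_in: "\<lbrakk>g \<in> carrier G; e \<in> E\<rbrakk> \<Longrightarrow> act g e \<in> E"
    and act_mult: "\<lbrakk>g \<in> carrier G; h \<in> carrier G; e \<in> E\<rbrakk> \<Longrightarrow> act (g \<otimes> h) e = act g (act h e)"
    and act_dist: "\<lbrakk>g \<in> carrier G; e \<in> E; e' \<in> E\<rbrakk> \<Longrightarrow> d (act g e) (act g e') = d e e'"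
    and act_p: "\<lbrakk>g \<in> carrier G; e \<in> E\<rbrakk> \<Longrightarrow> p (act g e) = p e"
    and act_trans: "\<lbrakk>e \<in> E; e' \<in> E; p e = p e'\<rbrakk> \<Longrightarrow> \<exists>g\<in>carrier G. act g e = e'"
    and act_inj: "\<lbrakk>e \<in> E; g \<in> carrier G; h \<in> carrier G; act g e = act h e\<rbrakk> \<Longrightarrow> g = h"
    and E_nonempty: "E \<noteq> {}"
    and null_homotopic: "\<And>(Z :: (nat \<Rightarrow> real) topology) F.
      \<lbrakk>compact_space Z; continuous_map Z E.mtopology F\<rbrakk> \<Longrightarrow>
      \<exists>e. homotopic_with (\<lambda>_. True) Z E.mtopology F (\<lambda>_. e)"
begin

lemma extend_from_boundary:
  assumes "n > 0" "continuous_map (subtopology (unit_cube n) (cube_boundary n)) E.mtopology b"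
  shows "\<exists>F. continuous_map (unit_cube n) E.mtopology F \<and> (\<forall>x\<in>cube_boundary n. F x = b x)"
  using null_homotopic[OF compact_space_cube_boundary assms(2)] cube_boundary_extension[OF assms(1)]
  by metis

lemma E_path:
  assumes "e \<in> E" "e' \<in> E"
  obtains F where "continuous_map (unit_cube 1) E.mtopology F" "F (\<lambda>_. 0) = e" "F cube1_end = e'"
proof -
  let ?b = "\<lambda>z::nat \<Rightarrow> real. if z 0 \<le> 1/2 then e else e'"
  let ?B = "subtopology (unit_cube 1) (cube_boundary 1)"
  have "continuous_map ?B E.mtopology ?b"
  proof (rule continuous_map_cases_le)
    show "continuous_map ?B euclideanreal (\<lambda>z. z 0)"
      by (auto simp: unit_cube_eq subtopology_subtopology intro!: continuous_intros)
    show "e = e'" if "z \<in> topspace ?B" "z 0 = 1/2" for z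
      using that by (auto simp: cube_boundary_1 cube1_end_def)
  qed (use assms in auto)
  then obtain F where "continuous_map (unit_cube 1) E.mtopology F" "\<forall>x\<in>cube_boundary 1. F x = ?b x"
    using extend_from_boundary[of 1] by auto
  then show ?thesis using that[of F] by (simp add: cube_boundary_1 cube1_end_def)
qed

text \<open>Contracting the cube to its corner \<open>0\<close> turns the map into a homotopy that starts at a constant.\<close>

lemma cube_lift:
  assumes f: "continuous_map (unit_cube n) X.mtopology f" and e: "e \<in> E" "p e = f (\<lambda>_. 0)"
  obtains F where "continuous_map (unit_cube n) E.mtopology F"
    "\<And>x. x \<in> topspace (unit_cube n) \<Longrightarrow> p (F x) = f x" "F (\<lambda>_. 0) = e"
proof -
  let ?H = "\<lambda>w::real \<times> (nat \<Rightarrow> real). f (\<lambda>i. fst w * snd w i)"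
  have H: "continuous_map (prod_topology (top_of_set {0..1::real}) (unit_cube n)) X.mtopology ?H"
    using continuous_map_compose[OF continuous_map_scale_cube f] by (simp add: o_def)
  have const: "continuous_map (unit_cube n) E.mtopology (\<lambda>_. e)" using e by simp
  obtain K where K: "continuous_map (prod_topology (top_of_set {0..1::real}) (unit_cube n)) E.mtopology K"
    "\<And>t z. \<lbrakk>t \<in> {0..1}; z \<in> topspace (unit_cube n)\<rbrakk> \<Longrightarrow> p (K (t, z)) = ?H (t, z)"
    "\<And>z. z \<in> topspace (unit_cube n) \<Longrightarrow> K (0, z) = e"
    using homotopy_lift[OF compact_space_unit_cube H const] e by auto
  show ?thesis
  proof (rule that[of "\<lambda>x. K (1, x)"])
    show "continuous_map (unit_cube n) E.mtopology (\<lambda>x. K (1, x))"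
      by (rule continuous_map_compose[OF _ K(1), unfolded o_def]) (intro continuous_map_pairedI; simp)
    show "p (K (1, x)) = f x" if "x \<in> topspace (unit_cube n)" for x
      using K(2)[of 1 x] that by simp
    have "K (1, \<lambda>_. 0) = K (0, \<lambda>_. 0)"
    proof (rule path_constant[where F = "\<lambda>t. K (t, \<lambda>_. 0)"])
      show "continuous_map (top_of_set {0..1}) E.mtopology (\<lambda>t. K (t, \<lambda>_. 0))"
        by (rule continuous_map_compose[OF _ K(1), unfolded o_def])
          (intro continuous_map_pairedI; simp add: topspace_unit_cube)
      show "p (K (t, \<lambda>_. 0)) = p (K (0, \<lambda>_. 0))" if "t \<in> {0..1}" for t
        using K(2)[of t "\<lambda>_. 0"] K(2)[of 0 "\<lambda>_. 0"] that zero_in_cube by simp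
    qed simp
    then show "K (1, \<lambda>_. 0) = e" using K(3)[OF zero_in_cube] by simp
  qed
qed

lemma cube_lift_unique:
  assumes F: "continuous_map (unit_cube n) E.mtopology F" and F': "continuous_map (unit_cube n) E.mtopology F'"
    and eq: "\<And>x. x \<in> topspace (unit_cube n) \<Longrightarrow> p (F x) = p (F' x)" and 0: "F (\<lambda>_. 0) = F' (\<lambda>_. 0)"
    and x: "x \<in> topspace (unit_cube n)"
  shows "F x = F' x"
proof -
  let ?s = "\<lambda>t i. (1 - t) * 0 + t * x i"
  have s: "?s t \<in> topspace (unit_cube n)" if "t \<in> {0..1}" for t
    using x that by (auto simp: topspace_unit_cube intro: mult_le_one)
  note cs = continuous_map_segment_cube[of "\<lambda>_. 0" x n, OF s]
  have "F (?s 1) = F' (?s 1)"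
  proof (rule path_lift_unique[of "\<lambda>t. F (?s t)" "\<lambda>t. F' (?s t)"])
    show "continuous_map (top_of_set {0..1}) E.mtopology (\<lambda>t. F (?s t))"
      by (rule continuous_map_compose[OF cs F, unfolded o_def])
    show "continuous_map (top_of_set {0..1}) E.mtopology (\<lambda>t. F' (?s t))"
      by (rule continuous_map_compose[OF cs F', unfolded o_def])
    show "p (F (?s t)) = p (F' (?s t))" if "t \<in> {0..1}" for t by (rule eq[OF s[OF that]])
  qed (use 0 in simp_all)
  then show ?thesis by simp
qed

text \<open>A homotopy relative to the boundary upstairs is projected to the base.\<close>

lemma lifts_homotopic:
  assumes F: "continuous_map (unit_cube n) E.mtopology F" and F': "continuous_map (unit_cube n) E.mtopology F'"
    and f: "f \<in> cube_maps n X.mtopology x0" "\<And>x. x \<in> topspace (unit_cube n) \<Longrightarrow> p (F x) = f x"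
    and f': "f' \<in> cube_maps n X.mtopology x0" "\<And>x. x \<in> topspace (unit_cube n) \<Longrightarrow> p (F' x) = f' x"
    and eq: "\<And>x. x \<in> cube_boundary n \<Longrightarrow> F x = F' x"
  shows "(f, f') \<in> cube_homotopy_rel n X.mtopology x0"
proof -
  obtain h where h: "continuous_map (prod_topology (top_of_set {0..1::real}) (unit_cube n)) E.mtopology h"
    "\<And>x. x \<in> topspace (unit_cube n) \<Longrightarrow> h (0, x) = F x"
    "\<And>x. x \<in> topspace (unit_cube n) \<Longrightarrow> h (1, x) = F' x"
    "\<And>t x. \<lbrakk>t \<in> {0..1}; x \<in> cube_boundary n\<rbrakk> \<Longrightarrow> h (t, x) = F x"
    using homotopy_rel_boundary[OF F F' eq extend_from_boundary] by auto
  have sub: "x \<in> topspace (unit_cube n)" if "x \<in> cube_boundary n" for x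
    using that cube_boundary_subset by blast
  have "homotopic_with (\<lambda>h. \<forall>x\<in>cube_boundary n. h x = x0) (unit_cube n) X.mtopology f f'"
  proof (subst homotopic_with)
    show "(\<forall>x\<in>cube_boundary n. h x = x0) \<longleftrightarrow> (\<forall>x\<in>cube_boundary n. k x = x0)"
      if "\<And>x. x \<in> topspace (unit_cube n) \<Longrightarrow> h x = k x" for h k
      using that sub by auto
    show "\<exists>h. continuous_map (prod_topology (top_of_set {0..1::real}) (unit_cube n)) X.mtopology h \<and>
        (\<forall>x\<in>topspace (unit_cube n). h (0, x) = f x) \<and> (\<forall>x\<in>topspace (unit_cube n). h (1, x) = f' x) \<and>
        (\<forall>t\<in>{0..1}. \<forall>x\<in>cube_boundary n. h (t, x) = x0)"
    proof (intro exI[of _ "\<lambda>w. p (h w)"] conjI ballI)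
      show "p (h (t, x)) = x0" if "t \<in> {0..1}" "x \<in> cube_boundary n" for t x
        using h(4)[OF that] f sub[OF that(2)] that(2) by (auto simp: cube_maps_def)
    qed (simp_all add: continuous_map_p[OF h(1)] h f f')
  qed
  then show ?thesis using f f' by (simp add: cube_homotopy_rel_def)
qed

text \<open>The boundary of a cube of dimension at least 2 is connected and the fibre is discrete, so a lift of a
  spheroid is constant on the boundary. Any two spheroids are therefore homotopic.\<close>

lemma higher_trivial:
  assumes n: "n \<ge> 2" and x0: "x0 \<in> X"
  shows "trivial_group (homotopy_group n X.mtopology x0)"
proof -
  let ?L = "cube_maps n X.mtopology x0" and ?R = "cube_homotopy_rel n X.mtopology x0"
  obtain e where e: "e \<in> E" "p e = x0" using p_surj[OF x0] by blast
  have zero_bd: "(\<lambda>_. 0) \<in> cube_boundary n"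
    using n by (auto simp: cube_boundary_def topspace_unit_cube intro!: exI[of _ 0])
  have lift: "\<exists>F. continuous_map (unit_cube n) E.mtopology F \<and>
      (\<forall>x\<in>topspace (unit_cube n). p (F x) = f x) \<and> (\<forall>x\<in>cube_boundary n. F x = e)" if f: "f \<in> ?L" for f
  proof -
    have fc: "continuous_map (unit_cube n) X.mtopology f" "\<And>x. x \<in> cube_boundary n \<Longrightarrow> f x = x0"
      using f by (auto simp: cube_maps_def)
    obtain F where F: "continuous_map (unit_cube n) E.mtopology F"
      "\<And>x. x \<in> topspace (unit_cube n) \<Longrightarrow> p (F x) = f x" "F (\<lambda>_. 0) = e"
      using cube_lift[OF fc(1) e(1)] e(2) fc(2)[OF zero_bd] by metis
    have "F x = e" if x: "x \<in> cube_boundary n" for x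
    proof -
      have "F x = F (\<lambda>_. 0)"
      proof (rule cube_boundary_constant[OF n _ x])
        fix x y :: "nat \<Rightarrow> real"
        let ?s = "\<lambda>t i. (1 - t) * x i + t * y i"
        assume s: "\<And>t. t \<in> {0..1} \<Longrightarrow> ?s t \<in> cube_boundary n"
        then have s': "?s t \<in> topspace (unit_cube n)" if "t \<in> {0..1}" for t
          using that cube_boundary_subset by blast
        have p: "p (F (?s t)) = x0" if "t \<in> {0..1}" for t
          using F(2)[OF s'[OF that]] fc(2)[OF s[OF that]] by simp
        have "F (?s 1) = F (?s 0)"
        proof (rule path_constant[where F = "\<lambda>t. F (?s t)"])
          show "continuous_map (top_of_set {0..1}) E.mtopology (\<lambda>t. F (?s t))"
            by (rule continuous_map_compose[OF continuous_map_segment_cube[OF s'] F(1), unfolded o_def])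
          show "p (F (?s t)) = p (F (?s 0))" if "t \<in> {0..1}" for t
            using p[OF that] p[of 0] by (metis atLeastAtMost_iff order_refl zero_le_one)
        qed simp
        then show "F x = F y" by simp
      qed
      then show ?thesis using F(3) by simp
    qed
    then show ?thesis using F by blast
  qed
  have all: "(f, f') \<in> ?R" if f: "f \<in> ?L" and f': "f' \<in> ?L" for f f'
  proof -
    obtain F where "continuous_map (unit_cube n) E.mtopology F"
      "\<forall>x\<in>topspace (unit_cube n). p (F x) = f x" "\<forall>x\<in>cube_boundary n. F x = e" using lift[OF f] by blast
    moreover obtain F' where "continuous_map (unit_cube n) E.mtopology F'"
      "\<forall>x\<in>topspace (unit_cube n). p (F' x) = f' x" "\<forall>x\<in>cube_boundary n. F' x = e" using lift[OF f'] by blast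
    ultimately show ?thesis using lifts_homotopic[of n F F' f x0 f'] f f' by auto
  qed
  have R: "?R = ?L \<times> ?L" using all by (auto simp: cube_homotopy_rel_def)
  have const: "(\<lambda>_. x0) \<in> ?L" using x0 by (simp add: cube_maps_def)
  have concat: "cube_concat (\<lambda>_. x0) (\<lambda>_. x0) = (\<lambda>_. x0)" by (simp add: cube_concat_def fun_eq_iff)
  have carrier: "carrier (homotopy_group n X.mtopology x0) = {?L}"
    using const by (auto simp: homotopy_group_def quotient_def R)
  have one: "\<one>\<^bsub>homotopy_group n X.mtopology x0\<^esub> = ?L"
  proof -
    have "?R `` {\<lambda>_. x0} = ?L" unfolding R using const by blast
    then show ?thesis by (simp add: homotopy_group_def)
  qed
  have "?R `` {cube_concat f g | f g. f \<in> ?L \<and> g \<in> ?L} = ?L"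
    unfolding R using const by (auto intro!: ImageI[of "\<lambda>_. x0"] exI[of _ "\<lambda>_. x0"] simp: concat)
  then have mult: "?L \<otimes>\<^bsub>homotopy_group n X.mtopology x0\<^esub> ?L = ?L"
    by (simp add: homotopy_group_def)
  have "group (homotopy_group n X.mtopology x0)"
    by (rule groupI) (simp_all add: carrier one mult)
  then show ?thesis by (simp add: trivial_group_def carrier one)
qed

lemma continuous_map_act:
  assumes g: "g \<in> carrier G" and F: "continuous_map Z E.mtopology F"
  shows "continuous_map Z E.mtopology (\<lambda>z. act g (F z))"
proof (rule E.continuous_map_mtopologyI)
  fix z assume z: "z \<in> topspace Z"
  show "act g (F z) \<in> E" using act_in[OF g] E.continuous_map_in_M[OF F z] .
  fix \<epsilon> :: real assume "\<epsilon> > 0"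
  then obtain U where U: "openin Z U" "z \<in> U" "\<forall>w\<in>U. d (F z) (F w) < \<epsilon>"
    using E.continuous_map_mtopologyD[OF F z] by blast
  have "d (act g (F z)) (act g (F w)) < \<epsilon>" if "w \<in> U" for w
    using U that act_dist[OF g] E.continuous_map_in_M[OF F] z openin_subset[OF U(1)] by auto
  then show "\<exists>U. openin Z U \<and> z \<in> U \<and> (\<forall>w\<in>U. d (act g (F z)) (act g (F w)) < \<epsilon>)" using U by blast
qed

text \<open>The deck transformation \<open>g\<close> that carries the start point \<open>e\<close> of the lifted path to its end point.\<close>

definition lift_end :: "'e \<Rightarrow> ((nat \<Rightarrow> real) \<Rightarrow> 'x) \<Rightarrow> 'g \<Rightarrow> bool" where
  "lift_end e f g \<longleftrightarrow> g \<in> carrier G \<and> (\<exists>F. continuous_map (unit_cube 1) E.mtopology F \<and>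
     (\<forall>x\<in>topspace (unit_cube 1). p (F x) = f x) \<and> F (\<lambda>_. 0) = e \<and> F cube1_end = act g e)"

lemma lift_end_exists:
  assumes e: "e \<in> E" "p e = x0" and f: "f \<in> cube_maps 1 X.mtopology x0"
  shows "\<exists>g. lift_end e f g"
proof -
  have f': "continuous_map (unit_cube 1) X.mtopology f" "f (\<lambda>_. 0) = x0" "f cube1_end = x0"
    using f by (auto simp: cube_maps_def cube_boundary_1)
  obtain F where F: "continuous_map (unit_cube 1) E.mtopology F"
      "\<And>x. x \<in> topspace (unit_cube 1) \<Longrightarrow> p (F x) = f x" "F (\<lambda>_. 0) = e"
    using cube_lift[OF f'(1) e(1)] e(2) f'(2) by metis
  have "p (F cube1_end) = p e" using F(2)[OF cube1_end_in_cube] f'(3) e(2) by simp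
  then obtain g where "g \<in> carrier G" "act g e = F cube1_end"
    using act_trans[OF e(1) E.continuous_map_in_M[OF F(1) cube1_end_in_cube]] by metis
  then show ?thesis unfolding lift_end_def using F by metis
qed

lemma lift_end_unique:
  assumes "e \<in> E" "lift_end e f g" "lift_end e f h" shows "g = h"
proof -
  obtain F where F: "continuous_map (unit_cube 1) E.mtopology F"
    "\<forall>x\<in>topspace (unit_cube 1). p (F x) = f x" "F (\<lambda>_. 0) = e" "F cube1_end = act g e"
    using assms(2) unfolding lift_end_def by blast
  obtain F' where F': "continuous_map (unit_cube 1) E.mtopology F'"
    "\<forall>x\<in>topspace (unit_cube 1). p (F' x) = f x" "F' (\<lambda>_. 0) = e" "F' cube1_end = act h e"
    using assms(3) unfolding lift_end_def by blast
  have "F cube1_end = F' cube1_end"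
    by (rule cube_lift_unique[OF F(1) F'(1) _ _ cube1_end_in_cube]) (use F F' in auto)
  then show ?thesis using act_inj[OF assms(1)] assms F F' by (simp add: lift_end_def)
qed

lemma lift_end_homotopic:
  assumes e: "e \<in> E" "p e = x0" and R: "(f, f') \<in> cube_homotopy_rel 1 X.mtopology x0"
    and g: "lift_end e f g"
  shows "lift_end e f' g"
proof -
  obtain F where F: "continuous_map (unit_cube 1) E.mtopology F"
    "\<And>x. x \<in> topspace (unit_cube 1) \<Longrightarrow> p (F x) = f x" "F (\<lambda>_. 0) = e" "F cube1_end = act g e"
    using g unfolding lift_end_def by blast
  obtain H where H: "continuous_map (prod_topology (top_of_set {0..1::real}) (unit_cube 1)) X.mtopology H"
    "\<And>x. H (0, x) = f x" "\<And>x. H (1, x) = f' x" "\<And>t x. \<lbrakk>t \<in> {0..1}; x \<in> cube_boundary 1\<rbrakk> \<Longrightarrow> H (t, x) = x0"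
    using R unfolding cube_homotopy_rel_def homotopic_with_def by auto
  obtain K where K: "continuous_map (prod_topology (top_of_set {0..1::real}) (unit_cube 1)) E.mtopology K"
    "\<And>t z. \<lbrakk>t \<in> {0..1}; z \<in> topspace (unit_cube 1)\<rbrakk> \<Longrightarrow> p (K (t, z)) = H (t, z)"
    "\<And>z. z \<in> topspace (unit_cube 1) \<Longrightarrow> K (0, z) = F z"
    using homotopy_lift[OF compact_space_unit_cube H(1) F(1)] H(2) F(2) by metis
  have bd: "K (1, x) = F x" if x: "x \<in> cube_boundary 1" for x
  proof -
    have xt: "x \<in> topspace (unit_cube 1)" using x cube_boundary_subset by blast
    have "K (1, x) = K (0, x)"
    proof (rule path_constant[where F = "\<lambda>t. K (t, x)"])
      show "continuous_map (top_of_set {0..1}) E.mtopology (\<lambda>t. K (t, x))"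
        by (rule continuous_map_compose[OF _ K(1), unfolded o_def])
          (intro continuous_map_pairedI; use xt in simp)
      show "p (K (t, x)) = p (K (0, x))" if "t \<in> {0..1}" for t
        using K(2)[OF that xt] K(2)[of 0 x] H(4)[OF that x] H(4)[of 0 x] x xt by simp
    qed simp
    then show ?thesis using K(3)[OF xt] by simp
  qed
  have "continuous_map (unit_cube 1) E.mtopology (\<lambda>x. K (1, x))"
    by (rule continuous_map_compose[OF _ K(1), unfolded o_def]) (intro continuous_map_pairedI; simp)
  moreover have "\<forall>x\<in>topspace (unit_cube 1). p (K (1, x)) = f' x" using K(2)[of 1] H(3) by simp
  moreover have "K (1, \<lambda>_. 0) = e" "K (1, cube1_end) = act g e"
    using bd F(3,4) by (auto simp: cube_boundary_1)
  ultimately show ?thesis using g unfolding lift_end_def by blast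
qed

text \<open>The lift of the second loop is translated by \<open>g\<close> to start where the first one ends, and then it
  ends at \<open>g h e\<close>. So the invariant is multiplicative and does not reverse the order.\<close>

lemma lift_end_concat:
  assumes e: "e \<in> E" and g: "lift_end e f g" and h: "lift_end e f' h"
  shows "lift_end e (cube_concat f f') (g \<otimes> h)"
proof -
  obtain F where F: "continuous_map (unit_cube 1) E.mtopology F"
    "\<And>x. x \<in> topspace (unit_cube 1) \<Longrightarrow> p (F x) = f x" "F (\<lambda>_. 0) = e" "F cube1_end = act g e"
    using g unfolding lift_end_def by blast
  obtain F' where F': "continuous_map (unit_cube 1) E.mtopology F'"
    "\<And>x. x \<in> topspace (unit_cube 1) \<Longrightarrow> p (F' x) = f' x" "F' (\<lambda>_. 0) = e" "F' cube1_end = act h e"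
    using h unfolding lift_end_def by blast
  have gh: "g \<in> carrier G" "h \<in> carrier G" using g h by (auto simp: lift_end_def)
  let ?K = "cube_concat F (\<lambda>x. act g (F' x))"
  have "continuous_map (unit_cube 1) E.mtopology ?K"
  proof (rule cube_concat_continuous)
    fix x assume x: "x \<in> topspace (unit_cube 1)" "x 0 = 1"
    then have "x = cube1_end" using cube1_point[OF x(1)] unfolding cube1_end_def by metis
    moreover have "cube1_end(0 := 0) = (\<lambda>_. 0)" by (auto simp: cube1_end_def)
    ultimately show "F x = act g (F' (x(0 := 0)))" using F F' by simp
  qed (use F F' gh continuous_map_act in auto)
  moreover have "p (?K x) = cube_concat f f' x" if x: "x \<in> topspace (unit_cube 1)" for x
  proof (cases "x 0 \<le> 1/2")
    case True
    then have "x(0 := 2 * x 0) \<in> topspace (unit_cube 1)" using x by (auto simp: topspace_unit_cube)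
    then show ?thesis using True F(2) by (simp add: cube_concat_def)
  next
    case False
    then have "x(0 := 2 * x 0 - 1) \<in> topspace (unit_cube 1)" using x by (auto simp: topspace_unit_cube)
    then show ?thesis using False F'(2) act_p[OF gh(1)] E.continuous_map_in_M[OF F'(1)]
      by (simp add: cube_concat_def)
  qed
  moreover have "?K (\<lambda>_. 0) = e"
  proof -
    have "(\<lambda>_::nat. 0::real)(0 := 0) = (\<lambda>_. 0)" by auto
    then show ?thesis using F(3) by (simp add: cube_concat_def)
  qed
  moreover have "?K cube1_end = act (g \<otimes> h) e"
  proof -
    have "cube1_end(0 := 1) = cube1_end" by (auto simp: cube1_end_def)
    then show ?thesis using F'(4) act_mult[OF gh e] by (simp add: cube_concat_def cube1_end_def)
  qed
  ultimately show ?thesis using gh unfolding lift_end_def by blast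
qed

lemma fundamental_group:
  assumes x0: "x0 \<in> X" shows "homotopy_group 1 X.mtopology x0 \<cong> G"
proof -
  let ?L = "cube_maps 1 X.mtopology x0" and ?R = "cube_homotopy_rel 1 X.mtopology x0"
  obtain e where e: "e \<in> E" "p e = x0" using p_surj[OF x0] by blast
  define \<Phi> where "\<Phi> f = (THE g. lift_end e f g)" for f
  have \<Phi>I: "\<Phi> f = g" if "lift_end e f g" for f g
    unfolding \<Phi>_def using that lift_end_unique[OF e(1)] by blast
  have \<Phi>: "lift_end e f (\<Phi> f)" if "f \<in> ?L" for f
    using lift_end_exists[OF e that] \<Phi>I by metis
  have RL: "f \<in> ?L" "f' \<in> ?L" if "(f, f') \<in> ?R" for f f'
    using that by (auto simp: cube_homotopy_rel_def)
  have hom: "(f, f') \<in> ?R" if f: "f \<in> ?L" and f': "f' \<in> ?L" and eq: "\<Phi> f = \<Phi> f'" for f f'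
  proof -
    obtain F where F: "continuous_map (unit_cube 1) E.mtopology F"
      "\<And>x. x \<in> topspace (unit_cube 1) \<Longrightarrow> p (F x) = f x" "F (\<lambda>_. 0) = e" "F cube1_end = act (\<Phi> f) e"
      using \<Phi>[OF f] unfolding lift_end_def by blast
    obtain F' where F': "continuous_map (unit_cube 1) E.mtopology F'"
      "\<And>x. x \<in> topspace (unit_cube 1) \<Longrightarrow> p (F' x) = f' x" "F' (\<lambda>_. 0) = e" "F' cube1_end = act (\<Phi> f) e"
      using \<Phi>[OF f'] eq unfolding lift_end_def by metis
    show ?thesis
      by (rule lifts_homotopic[OF F(1) F'(1) f F(2) f' F'(2)]) (use F F' in \<open>auto simp: cube_boundary_1\<close>)
  qed
  have R: "?R = {(f, f'). f \<in> ?L \<and> f' \<in> ?L \<and> \<Phi> f = \<Phi> f'}"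
  proof -
    have "\<Phi> f = \<Phi> f'" if "(f, f') \<in> ?R" for f f'
      using \<Phi>I[OF lift_end_homotopic[OF e that \<Phi>[OF RL(1)[OF that]]]] by simp
    then show ?thesis using RL hom by blast
  qed
  have surj: "\<Phi> ` ?L = carrier G"
  proof
    show "\<Phi> ` ?L \<subseteq> carrier G" using \<Phi> by (auto simp: lift_end_def)
    show "carrier G \<subseteq> \<Phi> ` ?L"
    proof
      fix g assume g: "g \<in> carrier G"
      obtain F where F: "continuous_map (unit_cube 1) E.mtopology F" "F (\<lambda>_. 0) = e" "F cube1_end = act g e"
        using E_path[OF e(1) act_in[OF g e(1)]] .
      have "(\<lambda>x. p (F x)) \<in> ?L"
        using continuous_map_p[OF F(1)] F e act_p[OF g e(1)] by (auto simp: cube_maps_def cube_boundary_1)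
      moreover have "lift_end e (\<lambda>x. p (F x)) g" unfolding lift_end_def using F g by blast
      ultimately show "g \<in> \<Phi> ` ?L" using \<Phi>I by (metis image_eqI)
    qed
  qed
  have concat: "cube_concat f f' \<in> ?L" if f: "f \<in> ?L" and f': "f' \<in> ?L" for f f'
  proof -
    have z: "(\<lambda>_::nat. 0::real)(0 := 0) = (\<lambda>_. 0)" "cube1_end(0 := 1) = cube1_end" "cube1_end(0 := 0) = (\<lambda>_. 0)"
      by (auto simp: cube1_end_def)
    have "continuous_map (unit_cube 1) X.mtopology (cube_concat f f')"
    proof (rule cube_concat_continuous)
      fix x assume x: "x \<in> topspace (unit_cube 1)" "x 0 = 1"
      then have "x = cube1_end" using cube1_point[OF x(1)] unfolding cube1_end_def by metis
      then show "f x = f' (x(0 := 0))" using f f' z by (simp add: cube_maps_def cube_boundary_1)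
    qed (use f f' in \<open>auto simp: cube_maps_def\<close>)
    moreover have "cube_concat f f' (\<lambda>_. 0) = x0"
      using f z by (simp add: cube_concat_def cube_maps_def cube_boundary_1)
    moreover have "cube_concat f f' cube1_end = x0"
    proof -
      have "cube1_end 0 = 1" by (simp add: cube1_end_def)
      then show ?thesis using f' z by (simp add: cube_concat_def cube_maps_def cube_boundary_1)
    qed
    ultimately show ?thesis by (simp add: cube_maps_def cube_boundary_1)
  qed
  show ?thesis
    unfolding homotopy_group_def
  proof (rule quotient_iso_by_invariant[OF R surj concat])
    show "\<Phi> (cube_concat f f') = \<Phi> f \<otimes> \<Phi> f'" if "f \<in> ?L" "f' \<in> ?L" for f f'
      by (rule \<Phi>I[OF lift_end_concat[OF e(1) \<Phi>[OF that(1)] \<Phi>[OF that(2)]]])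
  qed
qed

theorem eilenberg_maclane: "eilenberg_maclane_1 X.mtopology G"
proof -
  have "\<exists>g. pathin X.mtopology g \<and> g 0 = x \<and> g 1 = y" if "x \<in> X" "y \<in> X" for x y
  proof -
    obtain e where e: "e \<in> E" "p e = x" using p_surj \<open>x \<in> X\<close> by blast
    obtain e' where e': "e' \<in> E" "p e' = y" using p_surj \<open>y \<in> X\<close> by blast
    obtain F where F: "continuous_map (unit_cube 1) E.mtopology F" "F (\<lambda>_. 0) = e" "F cube1_end = e'"
      using E_path[OF e(1) e'(1)] .
    have "continuous_on A (\<lambda>t::real. (\<lambda>i::nat. if i = 0 then t else 0))" for A
    proof (rule continuous_on_coordinatewise_then_product)
      fix i :: nat show "continuous_on A (\<lambda>t::real. if i = 0 then t else 0)" by (cases "i = 0") auto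
    qed
    then have "continuous_map (top_of_set {0..1::real}) (unit_cube 1) (\<lambda>t i. if i = 0 then t else 0)"
      unfolding unit_cube_eq continuous_map_in_subtopology by auto
    then have "continuous_map (top_of_set {0..1::real}) X.mtopology (\<lambda>t. p (F (\<lambda>i. if i = 0 then t else 0)))"
      by (rule continuous_map_compose[OF _ continuous_map_p[OF F(1)], unfolded o_def])
    then show ?thesis using F e e' unfolding pathin_def cube1_end_def
      by (intro exI[of _ "\<lambda>t. p (F (\<lambda>i. if i = 0 then t else 0))"]) simp
  qed
  moreover have "X \<noteq> {}" using E_nonempty p_in by blast
  ultimately show ?thesis
    unfolding eilenberg_maclane_1_def path_connected_space_def
    using fundamental_group higher_trivial by simp
qed

end


section \<open>Finitely supported weights\<close>

definition supp :: "('v \<Rightarrow> real) \<Rightarrow> 'v set" where "supp x = {h. x h \<noteq> 0}"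

definition weights :: "('v \<Rightarrow> real) set" where
  "weights = {x. finite (supp x) \<and> (\<forall>h. 0 \<le> x h) \<and> (\<Sum>h\<in>supp x. x h) = 1}"

definition l1 :: "('v \<Rightarrow> real) \<Rightarrow> ('v \<Rightarrow> real) \<Rightarrow> real" where
  "l1 x y = (\<Sum>h\<in>supp x \<union> supp y. \<bar>x h - y h\<bar>)"

text \<open>The image measure; on a complex this is the linear extension of a vertex map.\<close>

definition push :: "('v \<Rightarrow> 'w) \<Rightarrow> ('v \<Rightarrow> real) \<Rightarrow> 'w \<Rightarrow> real" where
  "push f x k = (\<Sum>h\<in>supp x. if f h = k then x h else 0)"

definition mix :: "real \<Rightarrow> ('v \<Rightarrow> real) \<Rightarrow> ('v \<Rightarrow> real) \<Rightarrow> 'v \<Rightarrow> real" where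
  "mix t x y h = (1 - t) * x h + t * y h"

lemma in_supp: "h \<in> supp x \<longleftrightarrow> x h \<noteq> 0" by (simp add: supp_def)

lemma weights_finite: "x \<in> weights \<Longrightarrow> finite (supp x)" by (simp add: weights_def)

lemma weights_nonneg: "x \<in> weights \<Longrightarrow> 0 \<le> x h" by (simp add: weights_def)

lemma weights_sum:
  assumes "x \<in> weights" "finite F" "supp x \<subseteq> F" shows "(\<Sum>h\<in>F. x h) = 1"
proof -
  have "(\<Sum>h\<in>supp x. x h) = (\<Sum>h\<in>F. x h)"
    by (rule sum.mono_neutral_left) (use assms in \<open>auto simp: in_supp\<close>)
  then show ?thesis using assms by (simp add: weights_def)
qed

lemma weightsI:
  assumes "finite F" "supp x \<subseteq> F" "\<And>h. 0 \<le> x h" "(\<Sum>h\<in>F. x h) = 1" shows "x \<in> weights"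
proof -
  have "(\<Sum>h\<in>supp x. x h) = (\<Sum>h\<in>F. x h)"
    by (rule sum.mono_neutral_left) (use assms in \<open>auto simp: in_supp\<close>)
  then show ?thesis using assms finite_subset by (auto simp: weights_def)
qed

lemma weights_supp_nonempty: "x \<in> weights \<Longrightarrow> supp x \<noteq> {}" by (auto simp: weights_def)

lemma l1_eq:
  assumes "finite F" "supp x \<subseteq> F" "supp y \<subseteq> F" shows "l1 x y = (\<Sum>h\<in>F. \<bar>x h - y h\<bar>)"
  unfolding l1_def by (rule sum.mono_neutral_left) (use assms in \<open>auto simp: in_supp\<close>)

text \<open>Level sets of a weight are compared through single coordinates.\<close>

lemma l1_coordinate:
  assumes "x \<in> weights" "y \<in> weights" shows "\<bar>x h - y h\<bar> \<le> l1 x y"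
proof (cases "h \<in> supp x \<union> supp y")
  case True
  then show ?thesis unfolding l1_def
    by (intro member_le_sum[of h _ "\<lambda>h. \<bar>x h - y h\<bar>"]) (use assms in \<open>auto simp: weights_finite\<close>)
next
  case False
  then show ?thesis by (simp add: l1_def in_supp sum_nonneg)
qed

lemma Metric_space_l1: "W \<subseteq> weights \<Longrightarrow> Metric_space W l1"
proof
  show "0 \<le> l1 x y" for x y :: "'a \<Rightarrow> real" by (simp add: l1_def sum_nonneg)
  show "l1 x y = l1 y x" for x y :: "'a \<Rightarrow> real" by (simp add: l1_def Un_commute abs_minus_commute)
  assume W: "W \<subseteq> weights"
  show "l1 x y = 0 \<longleftrightarrow> x = y" if "x \<in> W" "y \<in> W" for x y
  proof
    assume 0: "l1 x y = 0"
    have "x h = y h" for h using l1_coordinate[of x y h] W that 0 by auto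
    then show "x = y" ..
  qed (simp add: l1_def)
  show "l1 x z \<le> l1 x y + l1 y z" if "x \<in> W" "y \<in> W" "z \<in> W" for x y z
  proof -
    let ?F = "supp x \<union> supp y \<union> supp z"
    have F: "finite ?F" using W that by (auto simp: weights_finite subset_iff)
    have "(\<Sum>h\<in>?F. \<bar>x h - z h\<bar>) \<le> (\<Sum>h\<in>?F. \<bar>x h - y h\<bar> + \<bar>y h - z h\<bar>)"
      by (intro sum_mono) auto
    moreover have "l1 x z = (\<Sum>h\<in>?F. \<bar>x h - z h\<bar>)" "l1 x y = (\<Sum>h\<in>?F. \<bar>x h - y h\<bar>)"
      "l1 y z = (\<Sum>h\<in>?F. \<bar>y h - z h\<bar>)"
      by (rule l1_eq[OF F]; blast)+
    ultimately show ?thesis by (simp add: sum.distrib)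
  qed
qed

lemma l1_disjoint:
  assumes x: "x \<in> weights" and y: "y \<in> weights" and "supp x \<inter> supp y = {}"
  shows "l1 x y = 2"
proof -
  let ?F = "supp x \<union> supp y"
  have F: "finite ?F" using x y by (simp add: weights_finite)
  have "l1 x y = (\<Sum>h\<in>?F. x h + y h)" unfolding l1_def
  proof (rule sum.cong)
    fix h
    have "x h = 0 \<or> y h = 0" using assms(3) by (auto simp: supp_def)
    then show "\<bar>x h - y h\<bar> = x h + y h"
      using weights_nonneg[OF x, of h] weights_nonneg[OF y, of h] by auto
  qed simp
  also have "\<dots> = 2" using weights_sum[OF x F] weights_sum[OF y F] by (simp add: sum.distrib)
  finally show ?thesis .
qed

lemma push_eq:
  assumes "finite F" "supp x \<subseteq> F" shows "push f x k = (\<Sum>h\<in>F. if f h = k then x h else 0)"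
  unfolding push_def by (rule sum.mono_neutral_left) (use assms in \<open>auto simp: in_supp\<close>)

lemma supp_push_subset: "supp (push f x) \<subseteq> f ` supp x"
proof
  fix k assume "k \<in> supp (push f x)"
  then have "(\<Sum>h\<in>supp x. if f h = k then x h else 0) \<noteq> 0" by (simp add: supp_def push_def)
  then obtain h where "h \<in> supp x" "(if f h = k then x h else 0) \<noteq> 0"
    by (rule sum.not_neutral_contains_not_neutral)
  then have "f h = k" by metis
  then show "k \<in> f ` supp x" using \<open>h \<in> supp x\<close> by blast
qed

lemma supp_push:
  assumes x: "x \<in> weights" shows "supp (push f x) = f ` supp x"
proof
  show "f ` supp x \<subseteq> supp (push f x)"
  proof
    fix k assume "k \<in> f ` supp x"
    then obtain h where h: "h \<in> supp x" "f h = k" by blast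
    have "(\<Sum>h\<in>supp x. if f h = k then x h else 0) \<ge> x h"
      using h weights_nonneg[OF x] weights_finite[OF x]
        member_le_sum[of h "supp x" "\<lambda>h. if f h = k then x h else 0"] by simp
    moreover have "x h > 0" using h weights_nonneg[OF x, of h] by (simp add: in_supp)
    ultimately show "k \<in> supp (push f x)" by (simp add: supp_def push_def)
  qed
qed (rule supp_push_subset)

lemma push_weights:
  assumes x: "x \<in> weights" shows "push f x \<in> weights"
proof (rule weightsI)
  show fin: "finite (f ` supp x)" using weights_finite[OF x] by simp
  show "supp (push f x) \<subseteq> f ` supp x" by (rule supp_push_subset)
  show "0 \<le> push f x k" for k unfolding push_def using weights_nonneg[OF x] by (simp add: sum_nonneg)
  have "(\<Sum>k\<in>f ` supp x. push f x k) = (\<Sum>h\<in>supp x. \<Sum>k\<in>f ` supp x. if f h = k then x h else 0)"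
    unfolding push_def by (rule sum.swap)
  also have "\<dots> = (\<Sum>h\<in>supp x. x h)" by (rule sum.cong) (use fin in auto)
  finally show "(\<Sum>k\<in>f ` supp x. push f x k) = 1" using x by (simp add: weights_def)
qed

lemma l1_push:
  assumes x: "x \<in> weights" and y: "y \<in> weights" shows "l1 (push f x) (push f y) \<le> l1 x y"
proof -
  let ?F = "supp x \<union> supp y"
  have F: "finite ?F" using x y by (simp add: weights_finite)
  have "l1 (push f x) (push f y) = (\<Sum>k\<in>f ` ?F. \<bar>push f x k - push f y k\<bar>)"
    by (rule l1_eq) (use F supp_push_subset in fast)+
  also have "\<dots> \<le> (\<Sum>k\<in>f ` ?F. \<Sum>h\<in>?F. if f h = k then \<bar>x h - y h\<bar> else 0)"
  proof (rule sum_mono)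
    fix k
    have "push f x k - push f y k = (\<Sum>h\<in>?F. if f h = k then x h - y h else 0)"
      by (subst (1 2) push_eq[OF F]) (auto simp flip: sum_subtractf intro!: sum.cong)
    also have "\<bar>\<dots>\<bar> \<le> (\<Sum>h\<in>?F. \<bar>if f h = k then x h - y h else 0\<bar>)" by (rule sum_abs)
    also have "\<dots> = (\<Sum>h\<in>?F. if f h = k then \<bar>x h - y h\<bar> else 0)" by (rule sum.cong) auto
    finally show "\<bar>push f x k - push f y k\<bar> \<le> \<dots>" .
  qed
  also have "\<dots> = (\<Sum>h\<in>?F. \<Sum>k\<in>f ` ?F. if f h = k then \<bar>x h - y h\<bar> else 0)" by (rule sum.swap)
  also have "\<dots> = (\<Sum>h\<in>?F. \<bar>x h - y h\<bar>)" by (rule sum.cong) (use F in auto)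
  finally show ?thesis by (simp add: l1_def)
qed

lemma push_at:
  assumes x: "x \<in> weights" and inj: "inj_on f A" and A: "supp x \<subseteq> A" "h \<in> A"
  shows "push f x (f h) = x h"
proof -
  have "push f x (f h) = (\<Sum>k\<in>insert h (supp x). if f k = f h then x k else 0)"
    by (rule push_eq) (use weights_finite[OF x] in auto)
  also have "\<dots> = (\<Sum>k\<in>insert h (supp x). if k = h then x k else 0)"
    by (rule sum.cong) (use inj A in \<open>auto simp: inj_on_def\<close>)
  finally show ?thesis using weights_finite[OF x] by simp
qed

lemma push_cong: "(\<And>h. h \<in> supp x \<Longrightarrow> f h = g h) \<Longrightarrow> push f x = push g x"
  by (auto simp: push_def fun_eq_iff intro!: sum.cong)

lemma push_id:
  assumes x: "x \<in> weights" and "\<And>h. h \<in> supp x \<Longrightarrow> f h = h" shows "push f x = x"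
proof -
  have "push f x = push (\<lambda>h. h) x" by (rule push_cong) (rule assms(2))
  also have "\<dots> = x" using push_at[OF x, of "\<lambda>h. h" UNIV] by auto
  finally show ?thesis .
qed

lemma push_comp:
  assumes x: "x \<in> weights" shows "push f (push g x) = push (\<lambda>h. f (g h)) x"
proof
  fix k
  have fin: "finite (supp x)" using weights_finite[OF x] .
  have "push f (push g x) k = (\<Sum>j\<in>g ` supp x. if f j = k then push g x j else 0)"
    by (rule push_eq) (simp_all add: fin supp_push_subset)
  also have "\<dots> = (\<Sum>j\<in>g ` supp x. \<Sum>h\<in>supp x. if g h = j then (if f (g h) = k then x h else 0) else 0)"
  proof (rule sum.cong[OF refl])
    fix j
    show "(if f j = k then push g x j else 0)
        = (\<Sum>h\<in>supp x. if g h = j then (if f (g h) = k then x h else 0) else 0)"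
    proof (cases "f j = k")
      case True
      then show ?thesis unfolding push_def by (auto intro!: sum.cong)
    next
      case False
      then have "(\<Sum>h\<in>supp x. if g h = j then (if f (g h) = k then x h else 0) else 0) = 0"
        by (intro sum.neutral) auto
      then show ?thesis using False by simp
    qed
  qed
  also have "\<dots> = (\<Sum>h\<in>supp x. \<Sum>j\<in>g ` supp x. if g h = j then (if f (g h) = k then x h else 0) else 0)"
    by (rule sum.swap)
  also have "\<dots> = push (\<lambda>h. f (g h)) x k"
    unfolding push_def by (rule sum.cong) (use fin in auto)
  finally show "push f (push g x) k = push (\<lambda>h. f (g h)) x k" .
qed

lemma push_const:
  assumes x: "x \<in> weights" and "\<And>h. h \<in> supp x \<Longrightarrow> f h = c"
  shows "push f x = (\<lambda>k. if k = c then 1 else 0)"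
proof
  fix k
  have "push f x k = (\<Sum>h\<in>supp x. if k = c then x h else 0)"
    unfolding push_def by (rule sum.cong) (use assms in auto)
  then show "push f x k = (if k = c then 1 else 0)" using x by (simp add: weights_def)
qed

lemma supp_mix: "supp (mix t x y) \<subseteq> supp x \<union> supp y"
  by (auto simp: supp_def mix_def)

lemma mix_weights:
  assumes x: "x \<in> weights" and y: "y \<in> weights" and t: "t \<in> {0..1}"
  shows "mix t x y \<in> weights"
proof (rule weightsI[OF _ supp_mix])
  show F: "finite (supp x \<union> supp y)" using x y by (simp add: weights_finite)
  show "0 \<le> mix t x y h" for h
    using weights_nonneg[OF x, of h] weights_nonneg[OF y, of h] t by (simp add: mix_def)
  show "sum (mix t x y) (supp x \<union> supp y) = 1"
    using weights_sum[OF x F] weights_sum[OF y F]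
    by (simp add: mix_def sum.distrib flip: sum_distrib_left)
qed

text \<open>Joint continuity of the straight line homotopy.\<close>

lemma l1_mix:
  assumes xy: "x \<in> weights" "y \<in> weights" and xy': "x' \<in> weights" "y' \<in> weights" and t: "t \<in> {0..1}"
  shows "l1 (mix t x y) (mix s x' y') \<le> l1 x x' + l1 y y' + 2 * \<bar>t - s\<bar>"
proof -
  let ?F = "supp x \<union> supp y \<union> supp x' \<union> supp y'"
  have F: "finite ?F" using xy xy' by (simp add: weights_finite)
  have "l1 (mix t x y) (mix s x' y') = (\<Sum>h\<in>?F. \<bar>mix t x y h - mix s x' y' h\<bar>)"
    by (rule l1_eq[OF F]) (use supp_mix in fast)+
  also have "\<dots> \<le> (\<Sum>h\<in>?F. \<bar>x h - x' h\<bar> + \<bar>y h - y' h\<bar> + \<bar>t - s\<bar> * (x' h + y' h))"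
  proof (rule sum_mono)
    fix h
    have "mix t x y h - mix s x' y' h = (1 - t) * (x h - x' h) + t * (y h - y' h) + (t - s) * (y' h - x' h)"
      by (simp add: mix_def algebra_simps)
    also have "\<bar>\<dots>\<bar> \<le> \<bar>(1 - t) * (x h - x' h)\<bar> + \<bar>t * (y h - y' h)\<bar> + \<bar>(t - s) * (y' h - x' h)\<bar>"
      by linarith
    also have "\<dots> \<le> \<bar>x h - x' h\<bar> + \<bar>y h - y' h\<bar> + \<bar>t - s\<bar> * (x' h + y' h)"
    proof (intro add_mono)
      show "\<bar>(1 - t) * (x h - x' h)\<bar> \<le> \<bar>x h - x' h\<bar>" "\<bar>t * (y h - y' h)\<bar> \<le> \<bar>y h - y' h\<bar>"
        using t by (auto simp: abs_mult intro: mult_left_le_one_le)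
      have "\<bar>y' h - x' h\<bar> \<le> x' h + y' h"
        using weights_nonneg[OF xy'(1), of h] weights_nonneg[OF xy'(2), of h] by linarith
      then show "\<bar>(t - s) * (y' h - x' h)\<bar> \<le> \<bar>t - s\<bar> * (x' h + y' h)"
        unfolding abs_mult by (rule mult_left_mono) simp
    qed
    finally show "\<bar>mix t x y h - mix s x' y' h\<bar> \<le> \<dots>" .
  qed
  also have "\<dots> = l1 x x' + l1 y y' + 2 * \<bar>t - s\<bar>"
  proof -
    have "l1 x x' = (\<Sum>h\<in>?F. \<bar>x h - x' h\<bar>)" "l1 y y' = (\<Sum>h\<in>?F. \<bar>y h - y' h\<bar>)"
      by (rule l1_eq[OF F]; blast)+
    moreover have "(\<Sum>h\<in>?F. x' h) = 1" "(\<Sum>h\<in>?F. y' h) = 1"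
      by (rule weights_sum[OF _ F]; use xy' in blast)+
    ultimately show ?thesis by (simp add: sum.distrib flip: sum_distrib_left)
  qed
  finally show ?thesis .
qed

lemma homotopic_mix:
  assumes W: "W \<subseteq> weights"
    and F0: "continuous_map Z (Metric_space.mtopology W l1) F0"
    and F1: "continuous_map Z (Metric_space.mtopology W l1) F1"
    and mix: "\<And>z t. \<lbrakk>z \<in> topspace Z; t \<in> {0..1}\<rbrakk> \<Longrightarrow> mix t (F0 z) (F1 z) \<in> W"
  shows "homotopic_with (\<lambda>_. True) Z (Metric_space.mtopology W l1) F0 F1"
proof -
  interpret Metric_space W l1 using Metric_space_l1[OF W] .
  let ?IZ = "prod_topology (top_of_set {0..1::real}) Z"
  let ?h = "\<lambda>w. mix (fst w) (F0 (snd w)) (F1 (snd w))"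
  have "continuous_map ?IZ mtopology ?h"
  proof (rule continuous_map_mtopologyI)
    fix w assume w: "w \<in> topspace ?IZ"
    obtain t z where tz: "w = (t, z)" "t \<in> {0..1}" "z \<in> topspace Z" using w by auto
    show "?h w \<in> W" using tz mix by simp
    fix \<epsilon> :: real assume e: "\<epsilon> > 0"
    obtain U where U: "openin Z U" "z \<in> U" "\<forall>v\<in>U. l1 (F0 z) (F0 v) < \<epsilon> / 4"
      using continuous_map_mtopologyD[OF F0 tz(3), of "\<epsilon>/4"] e by auto
    obtain V where V: "openin Z V" "z \<in> V" "\<forall>v\<in>V. l1 (F1 z) (F1 v) < \<epsilon> / 4"
      using continuous_map_mtopologyD[OF F1 tz(3), of "\<epsilon>/4"] e by auto
    let ?T = "{0..1} \<inter> ball t (\<epsilon> / 4)"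
    have "openin ?IZ (?T \<times> (U \<inter> V))"
      unfolding openin_prod_Times_iff using U V by (auto simp: openin_open)
    moreover have "w \<in> ?T \<times> (U \<inter> V)" using tz U V e by auto
    moreover have "l1 (?h w) (?h w') < \<epsilon>" if w': "w' \<in> ?T \<times> (U \<inter> V)" for w'
    proof -
      obtain s v where sv: "w' = (s, v)" "s \<in> ball t (\<epsilon>/4)" "v \<in> U" "v \<in> V" using w' by auto
      have v: "v \<in> topspace Z" using sv(3) openin_subset[OF U(1)] by blast
      have in_W: "F0 z \<in> weights" "F1 z \<in> weights" "F0 v \<in> weights" "F1 v \<in> weights"
        using continuous_map_in_M[OF F0] continuous_map_in_M[OF F1] tz(3) v W by auto
      have "l1 (?h w) (?h w') \<le> l1 (F0 z) (F0 v) + l1 (F1 z) (F1 v) + 2 * \<bar>t - s\<bar>"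
        unfolding tz(1) sv(1) fst_conv snd_conv by (rule l1_mix[OF in_W tz(2)])
      also have "\<dots> < \<epsilon>"
      proof -
        have "\<bar>t - s\<bar> < \<epsilon> / 4" "l1 (F0 z) (F0 v) < \<epsilon> / 4" "l1 (F1 z) (F1 v) < \<epsilon> / 4"
          using U V sv by (auto simp: dist_real_def)
        moreover have "a + b + 2 * k < \<epsilon>" if "k < \<epsilon> / 4" "a < \<epsilon> / 4" "b < \<epsilon> / 4" for a b k :: real
          using that by simp
        ultimately show ?thesis by blast
      qed
      finally show ?thesis .
    qed
    ultimately show "\<exists>U. openin ?IZ U \<and> w \<in> U \<and> (\<forall>w'\<in>U. l1 (?h w) (?h w') < \<epsilon>)" by blast
  qed
  then show ?thesis
    unfolding homotopic_with_def by (intro exI[of _ ?h]) (auto simp: mix_def fun_eq_iff)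
qed


section \<open>The complex of a Garside order and its orbit space\<close>

text \<open>Left divisibility on a Garside group, \<open>g \<le> h\<close> iff \<open>g\<inverse>h\<close> lies in the monoid, detached from the
  monoid that defines it.\<close>

locale garside_order = group G for G :: "('g, 'h) monoid_scheme" (structure) +
  fixes le :: "'g \<Rightarrow> 'g \<Rightarrow> bool" (infix "\<sqsubseteq>" 50) and \<Delta> :: 'g
  assumes \<Delta>_in [simp, intro]: "\<Delta> \<in> carrier G"
    and le_refl: "a \<in> carrier G \<Longrightarrow> a \<sqsubseteq> a"
    and le_antisym: "\<lbrakk>a \<in> carrier G; b \<in> carrier G; a \<sqsubseteq> b; b \<sqsubseteq> a\<rbrakk> \<Longrightarrow> a = b"
    and le_trans: "\<lbrakk>a \<in> carrier G; b \<in> carrier G; c \<in> carrier G; a \<sqsubseteq> b; b \<sqsubseteq> c\<rbrakk> \<Longrightarrow> a \<sqsubseteq> c"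
    and le_left: "\<lbrakk>a \<in> carrier G; b \<in> carrier G; c \<in> carrier G; a \<sqsubseteq> b\<rbrakk> \<Longrightarrow> c \<otimes> a \<sqsubseteq> c \<otimes> b"
    and le_right_\<Delta>: "\<lbrakk>a \<in> carrier G; b \<in> carrier G\<rbrakk> \<Longrightarrow> a \<otimes> \<Delta> \<sqsubseteq> b \<otimes> \<Delta> \<longleftrightarrow> a \<sqsubseteq> b"
    and one_le_\<Delta>: "\<one> \<sqsubseteq> \<Delta>"
    and finite_simples: "finite {h \<in> carrier G. \<one> \<sqsubseteq> h \<and> h \<sqsubseteq> \<Delta>}"
    and meet_ex: "\<lbrakk>a \<in> carrier G; b \<in> carrier G\<rbrakk> \<Longrightarrow>
      \<exists>m\<in>carrier G. m \<sqsubseteq> a \<and> m \<sqsubseteq> b \<and> (\<forall>l\<in>carrier G. l \<sqsubseteq> a \<and> l \<sqsubseteq> b \<longrightarrow> l \<sqsubseteq> m)"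
    and bounded: "g \<in> carrier G \<Longrightarrow> \<exists>k::nat. inv (\<Delta> [^] k) \<sqsubseteq> g \<and> g \<sqsubseteq> \<Delta> [^] k"
begin

lemma inv_mult_cancel [simp]:
  "\<lbrakk>g \<in> carrier G; h \<in> carrier G\<rbrakk> \<Longrightarrow> inv g \<otimes> (g \<otimes> h) = h"
  "\<lbrakk>g \<in> carrier G; h \<in> carrier G\<rbrakk> \<Longrightarrow> g \<otimes> (inv g \<otimes> h) = h"
  by (simp_all flip: m_assoc)

lemma le_mult_\<Delta>: "a \<in> carrier G \<Longrightarrow> a \<sqsubseteq> a \<otimes> \<Delta>"
  using le_left[OF _ _ _ one_le_\<Delta>, of a] by simp

definition is_glb :: "'g set \<Rightarrow> 'g \<Rightarrow> bool" where
  "is_glb B m \<longleftrightarrow> m \<in> carrier G \<and> (\<forall>b\<in>B. m \<sqsubseteq> b) \<and> (\<forall>l\<in>carrier G. (\<forall>b\<in>B. l \<sqsubseteq> b) \<longrightarrow> l \<sqsubseteq> m)"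

lemma is_glb_unique: "is_glb B m \<Longrightarrow> is_glb B m' \<Longrightarrow> m = m'"
  unfolding is_glb_def by (blast intro: le_antisym)

lemma is_glb_exists:
  assumes "finite B" "B \<noteq> {}" "B \<subseteq> carrier G" shows "\<exists>m. is_glb B m"
  using assms
proof (induction rule: finite_ne_induct)
  case (singleton b)
  then show ?case by (auto simp: is_glb_def intro: le_refl)
next
  case (insert b B)
  then obtain m where m: "is_glb B m" by auto
  then have mc: "m \<in> carrier G" by (simp add: is_glb_def)
  obtain n where n: "n \<in> carrier G" "n \<sqsubseteq> b" "n \<sqsubseteq> m" "\<forall>l\<in>carrier G. l \<sqsubseteq> b \<and> l \<sqsubseteq> m \<longrightarrow> l \<sqsubseteq> n"
    using meet_ex[of b m] mc insert.prems by auto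
  have "n \<sqsubseteq> x" if "x \<in> B" for x
    using le_trans[OF n(1) mc _ n(3), of x] m that insert.prems by (auto simp: is_glb_def)
  then have "is_glb (insert b B) n" using n m by (auto simp: is_glb_def)
  then show ?case ..
qed

lemma is_glb_translate:
  assumes m: "is_glb B m" and B: "B \<subseteq> carrier G" and g: "g \<in> carrier G"
  shows "is_glb ((\<otimes>) g ` B) (g \<otimes> m)"
proof -
  have mc: "m \<in> carrier G" using m by (simp add: is_glb_def)
  have "l \<sqsubseteq> g \<otimes> m" if l: "l \<in> carrier G" "\<forall>b\<in>(\<otimes>) g ` B. l \<sqsubseteq> b" for l
  proof -
    have "inv g \<otimes> l \<sqsubseteq> b" if b: "b \<in> B" for b
    proof -
      have "b \<in> carrier G" using b B by blast
      then show ?thesis using le_left[of l "g \<otimes> b" "inv g"] l b g by auto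
    qed
    then have "inv g \<otimes> l \<sqsubseteq> m" using m l g by (auto simp: is_glb_def)
    then have "g \<otimes> (inv g \<otimes> l) \<sqsubseteq> g \<otimes> m" using le_left[of "inv g \<otimes> l" m g] l g mc by simp
    then show "l \<sqsubseteq> g \<otimes> m" using l g by simp
  qed
  moreover have "g \<otimes> m \<sqsubseteq> g \<otimes> b" if "b \<in> B" for b
    by (rule le_left) (use m that B g in \<open>auto simp: is_glb_def\<close>)
  ultimately show ?thesis using mc g by (auto simp: is_glb_def)
qed

text \<open>A translation that permutes \<open>B\<close> fixes its greatest lower bound. In particular \<open>G\<close> is torsion-free,
  and no nontrivial translation maps a simplex to itself.\<close>

lemma translate_fixes_finite_set:
  assumes B: "finite B" "B \<noteq> {}" "B \<subseteq> carrier G" and g: "g \<in> carrier G" and sub: "(\<otimes>) g ` B \<subseteq> B"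
  shows "g = \<one>"
proof -
  have "inj_on ((\<otimes>) g) B" using B(3) g by (auto simp: inj_on_def subset_iff)
  then have "(\<otimes>) g ` B = B" using B(1) sub by (simp add: card_image card_subset_eq)
  moreover obtain m where m: "is_glb B m" using is_glb_exists[OF B] ..
  ultimately have "m = g \<otimes> m" using is_glb_unique is_glb_translate[OF m B(3) g] by metis
  then show ?thesis using g m by (simp add: is_glb_def)
qed

text \<open>The maximal simplices of the complex.\<close>

definition block :: "'g \<Rightarrow> 'g set" where
  "block g = {h \<in> carrier G. g \<sqsubseteq> h \<and> h \<sqsubseteq> g \<otimes> \<Delta>}"

lemma block_translate: "g \<in> carrier G \<Longrightarrow> k \<in> carrier G \<Longrightarrow> h \<in> block k \<Longrightarrow> g \<otimes> h \<in> block (g \<otimes> k)"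
  using le_left[of k h g] le_left[of h "k \<otimes> \<Delta>" g] by (auto simp: block_def m_assoc)

lemma block_eq: "g \<in> carrier G \<Longrightarrow> block g = (\<otimes>) g ` block \<one>"
proof
  assume g: "g \<in> carrier G"
  show "(\<otimes>) g ` block \<one> \<subseteq> block g" using block_translate[OF g, of \<one>] g by auto
  show "block g \<subseteq> (\<otimes>) g ` block \<one>"
  proof
    fix h assume h: "h \<in> block g"
    then have "inv g \<otimes> h \<in> block \<one>" using block_translate[of "inv g" g h] g by simp
    moreover have "h = g \<otimes> (inv g \<otimes> h)" using g h by (simp add: block_def)
    ultimately show "h \<in> (\<otimes>) g ` block \<one>" by blast
  qed
qed

lemma finite_block_one: "finite (block \<one>)"
  using finite_simples by (simp add: block_def)

lemma finite_block: "g \<in> carrier G \<Longrightarrow> finite (block g)"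
  using finite_block_one by (metis block_eq finite_imageI)

lemma card_block:
  assumes "g \<in> carrier G" shows "card (block g) = card (block \<one>)"
  unfolding block_eq[OF assms] using assms by (intro card_image) (auto simp: inj_on_def block_def)

lemma block_subset: "block g \<subseteq> carrier G" by (auto simp: block_def)

lemma one_in_block: "\<one> \<in> block \<one>" using one_le_\<Delta> le_refl by (simp add: block_def)

text \<open>The geometric realization of the complex, in barycentric coordinates.\<close>

definition E :: "('g \<Rightarrow> real) set" where
  "E = {x \<in> weights. \<exists>g\<in>carrier G. supp x \<subseteq> block g}"

lemma E_weights: "x \<in> E \<Longrightarrow> x \<in> weights" by (simp add: E_def)

lemma E_supp: "x \<in> E \<Longrightarrow> supp x \<subseteq> carrier G" using block_subset by (auto simp: E_def)

lemma E_finite: "x \<in> E \<Longrightarrow> finite (supp x)" using E_weights weights_finite by blast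

sublocale E: Metric_space E l1 by (rule Metric_space_l1) (simp add: E_def)

definition meet :: "'g \<Rightarrow> 'g \<Rightarrow> 'g" where
  "meet a b = (SOME m. m \<in> carrier G \<and> m \<sqsubseteq> a \<and> m \<sqsubseteq> b \<and> (\<forall>l\<in>carrier G. l \<sqsubseteq> a \<and> l \<sqsubseteq> b \<longrightarrow> l \<sqsubseteq> m))"

lemma meet:
  assumes "a \<in> carrier G" "b \<in> carrier G"
  shows meet_in: "meet a b \<in> carrier G" and meet_le1: "meet a b \<sqsubseteq> a" and meet_le2: "meet a b \<sqsubseteq> b"
    and meet_greatest: "\<And>l. \<lbrakk>l \<in> carrier G; l \<sqsubseteq> a; l \<sqsubseteq> b\<rbrakk> \<Longrightarrow> l \<sqsubseteq> meet a b"
proof -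
  have "meet a b \<in> carrier G \<and> meet a b \<sqsubseteq> a \<and> meet a b \<sqsubseteq> b \<and>
      (\<forall>l\<in>carrier G. l \<sqsubseteq> a \<and> l \<sqsubseteq> b \<longrightarrow> l \<sqsubseteq> meet a b)"
    unfolding meet_def by (rule someI_ex) (use meet_ex[OF assms] in blast)
  then show "meet a b \<in> carrier G" "meet a b \<sqsubseteq> a" "meet a b \<sqsubseteq> b"
    "\<And>l. \<lbrakk>l \<in> carrier G; l \<sqsubseteq> a; l \<sqsubseteq> b\<rbrakk> \<Longrightarrow> l \<sqsubseteq> meet a b" by auto
qed

lemma meet_eq1: "\<lbrakk>a \<in> carrier G; b \<in> carrier G; a \<sqsubseteq> b\<rbrakk> \<Longrightarrow> meet a b = a"
  using meet[of a b] le_antisym[of "meet a b" a] le_refl by blast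

lemma meet_eq2: "\<lbrakk>a \<in> carrier G; b \<in> carrier G; b \<sqsubseteq> a\<rbrakk> \<Longrightarrow> meet a b = b"
  using meet[of a b] le_antisym[of "meet a b" b] le_refl by blast

lemma meet_mono:
  assumes "a \<in> carrier G" "b \<in> carrier G" "a' \<in> carrier G" "b' \<in> carrier G" "a \<sqsubseteq> a'" "b \<sqsubseteq> b'"
  shows "meet a b \<sqsubseteq> meet a' b'"
  using meet[OF assms(1,2)] meet_greatest[OF assms(3,4)] assms le_trans by meson

text \<open>Order automorphisms commute with meets, and right multiplication by \<open>\<Delta>\<close> is one.\<close>

lemma meet_\<Delta>:
  assumes a: "a \<in> carrier G" and b: "b \<in> carrier G"
  shows "meet (a \<otimes> \<Delta>) (b \<otimes> \<Delta>) \<sqsubseteq> meet a b \<otimes> \<Delta>"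
proof -
  let ?m = "meet (a \<otimes> \<Delta>) (b \<otimes> \<Delta>)"
  have m: "?m \<in> carrier G" "?m \<sqsubseteq> a \<otimes> \<Delta>" "?m \<sqsubseteq> b \<otimes> \<Delta>" using meet[of "a \<otimes> \<Delta>" "b \<otimes> \<Delta>"] a b by auto
  define l where "l = ?m \<otimes> inv \<Delta>"
  have l: "l \<in> carrier G" "l \<otimes> \<Delta> = ?m" using m by (simp_all add: l_def m_assoc)
  then have "l \<sqsubseteq> meet a b" using m le_right_\<Delta> a b by (intro meet_greatest) metis+
  then show ?thesis using le_right_\<Delta>[of l "meet a b"] l meet_in[OF a b] by simp
qed

text \<open>The heart of contractibility: for \<open>g \<le> h \<le> g\<Delta>\<close> one has
  \<open>g \<and> z \<le> h \<and> z \<le> h \<and> z\<Delta> \<le> g\<Delta> \<and> z\<Delta> = (g \<and> z)\<Delta>\<close>. So both vertex maps send the block of \<open>g\<close>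
  to the same block.\<close>

lemma meet_block:
  assumes g: "g \<in> carrier G" and z: "z \<in> carrier G" and h: "h \<in> block g"
  shows "meet h z \<in> block (meet g z)" "meet h (z \<otimes> \<Delta>) \<in> block (meet g z)"
proof -
  have hc: "h \<in> carrier G" "g \<sqsubseteq> h" "h \<sqsubseteq> g \<otimes> \<Delta>" using h by (auto simp: block_def)
  have zz: "z \<sqsubseteq> z \<otimes> \<Delta>" using le_mult_\<Delta>[OF z] .
  note in_c = meet_in[OF g z] meet_in[OF hc(1) z] meet_in[OF hc(1), of "z \<otimes> \<Delta>"] meet_in[of "g \<otimes> \<Delta>" "z \<otimes> \<Delta>"]
  have 1: "meet g z \<sqsubseteq> meet h z" using meet_mono[OF g z hc(1) z hc(2) le_refl[OF z]] .
  have 2: "meet h z \<sqsubseteq> meet h (z \<otimes> \<Delta>)" using meet_mono[OF hc(1) z hc(1) _ le_refl[OF hc(1)] zz] z by simp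
  have 3: "meet h (z \<otimes> \<Delta>) \<sqsubseteq> meet g z \<otimes> \<Delta>"
    using meet_mono[OF hc(1) _ _ _ hc(3) le_refl, of "z \<otimes> \<Delta>"] meet_\<Delta>[OF g z] le_trans[OF in_c(3,4)] in_c g z
    by (metis \<Delta>_in m_closed)
  show "meet h z \<in> block (meet g z)"
    using le_trans[OF in_c(2,3) _ 2 3] 1 in_c g z by (simp add: block_def)
  show "meet h (z \<otimes> \<Delta>) \<in> block (meet g z)"
    using le_trans[OF in_c(1,2,3) 1 2] 3 in_c g z by (simp add: block_def)
qed

abbreviation retract :: "'g \<Rightarrow> ('g \<Rightarrow> real) \<Rightarrow> 'g \<Rightarrow> real" where
  "retract z \<equiv> push (\<lambda>h. meet h z)"

lemma retract_support:
  assumes x: "x \<in> E" and z: "z \<in> carrier G"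
  shows "\<exists>g\<in>carrier G. supp (retract z x) \<subseteq> block g \<and> supp (retract (z \<otimes> \<Delta>) x) \<subseteq> block g"
proof -
  obtain g where g: "g \<in> carrier G" "supp x \<subseteq> block g" using x by (auto simp: E_def)
  have "supp (retract z x) \<subseteq> block (meet g z)" "supp (retract (z \<otimes> \<Delta>) x) \<subseteq> block (meet g z)"
    unfolding supp_push[OF E_weights[OF x]] using meet_block[OF g(1) z] g(2) by auto
  then show ?thesis using meet_in[OF g(1) z] by blast
qed

lemma retract_in: "x \<in> E \<Longrightarrow> z \<in> carrier G \<Longrightarrow> retract z x \<in> E"
  using retract_support[of x z] push_weights[OF E_weights] by (auto simp: E_def)

lemma continuous_map_retract:
  assumes F: "continuous_map Z E.mtopology F" and z: "z \<in> carrier G"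
  shows "continuous_map Z E.mtopology (\<lambda>w. retract z (F w))"
proof (rule E.continuous_map_mtopologyI)
  fix w assume w: "w \<in> topspace Z"
  show "retract z (F w) \<in> E" using retract_in E.continuous_map_in_M[OF F w] z by blast
  fix \<epsilon> :: real assume "\<epsilon> > 0"
  then obtain U where U: "openin Z U" "w \<in> U" "\<forall>v\<in>U. l1 (F w) (F v) < \<epsilon>"
    using E.continuous_map_mtopologyD[OF F w] by blast
  have "l1 (retract z (F w)) (retract z (F v)) < \<epsilon>" if v: "v \<in> U" for v
  proof -
    have "F w \<in> weights" "F v \<in> weights"
      using E.continuous_map_in_M[OF F] w v openin_subset[OF U(1)] E_weights by blast+
    then show ?thesis using l1_push[of "F w" "F v" "\<lambda>h. meet h z"] U(3) v by fastforce
  qed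
  then show "\<exists>U. openin Z U \<and> w \<in> U \<and> (\<forall>v\<in>U. l1 (retract z (F w)) (retract z (F v)) < \<epsilon>)"
    using U by blast
qed

lemma retract_step:
  assumes F: "continuous_map Z E.mtopology F" and z: "z \<in> carrier G"
  shows "homotopic_with (\<lambda>_. True) Z E.mtopology (\<lambda>w. retract z (F w)) (\<lambda>w. retract (z \<otimes> \<Delta>) (F w))"
proof (rule homotopic_mix)
  fix w t assume w: "w \<in> topspace Z" and t: "t \<in> {0..1::real}"
  have Fw: "F w \<in> E" using E.continuous_map_in_M[OF F w] .
  obtain g where g: "g \<in> carrier G" "supp (retract z (F w)) \<subseteq> block g" "supp (retract (z \<otimes> \<Delta>) (F w)) \<subseteq> block g"
    using retract_support[OF Fw z] by blast
  have "mix t (retract z (F w)) (retract (z \<otimes> \<Delta>) (F w)) \<in> weights"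
    using push_weights[OF E_weights[OF Fw]] t by (intro mix_weights)
  moreover have "supp (mix t (retract z (F w)) (retract (z \<otimes> \<Delta>) (F w))) \<subseteq> block g"
    using supp_mix g by fast
  ultimately show "mix t (retract z (F w)) (retract (z \<otimes> \<Delta>) (F w)) \<in> E"
    using g(1) by (auto simp: E_def)
qed (use continuous_map_retract[OF F] z in \<open>auto simp: E_def\<close>)

lemma retract_homotopic:
  assumes F: "continuous_map Z E.mtopology F" and z: "z \<in> carrier G"
  shows "homotopic_with (\<lambda>_. True) Z E.mtopology (\<lambda>w. retract z (F w)) (\<lambda>w. retract (z \<otimes> \<Delta> [^] (k::nat)) (F w))"
proof (induction k)
  case 0
  show ?case using continuous_map_retract[OF F z] z by simp
next
  case (Suc k)
  have "homotopic_with (\<lambda>_. True) Z E.mtopology (\<lambda>w. retract (z \<otimes> \<Delta> [^] k) (F w))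
      (\<lambda>w. retract (z \<otimes> \<Delta> [^] k \<otimes> \<Delta>) (F w))"
    by (rule retract_step[OF F]) (use z in simp)
  then show ?case using homotopic_with_trans[OF Suc] z by (simp add: m_assoc)
qed

text \<open>Contains every block through \<open>h\<close>: such a block starts at \<open>h s\<inverse>\<close> for some \<open>s\<close> in the block of \<open>1\<close>.\<close>

definition star :: "'g \<Rightarrow> 'g set" where
  "star h = (\<Union>s\<in>block \<one>. block (h \<otimes> inv s))"

lemma finite_star: "h \<in> carrier G \<Longrightarrow> finite (star h)"
  unfolding star_def using finite_block_one block_subset by (intro finite_UN_I finite_block) blast+

lemma supp_subset_star:
  assumes "x \<in> E" "h \<in> supp x" shows "supp x \<subseteq> star h"
proof -
  obtain g where g: "g \<in> carrier G" "supp x \<subseteq> block g" using assms by (auto simp: E_def)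
  then have h: "h \<in> block g" using assms by blast
  then have hc: "h \<in> carrier G" by (simp add: block_def)
  have "inv g \<otimes> h \<in> block \<one>" using block_translate[of "inv g" g h] g h by simp
  moreover have "h \<otimes> inv (inv g \<otimes> h) = g" using g hc by (simp add: inv_mult_group flip: m_assoc)
  ultimately show ?thesis using g(2) unfolding star_def by force
qed

text \<open>Weights at distance less than 2 share a vertex, so a ball of radius 1 only meets the stars of
  the finitely many vertices in the support of its centre.\<close>

lemma finite_support_of_compact:
  assumes Z: "compact_space Z" and F: "continuous_map Z E.mtopology F"
  obtains K where "finite K" "K \<subseteq> carrier G" "\<And>w. w \<in> topspace Z \<Longrightarrow> supp (F w) \<subseteq> K"
proof -
  have "compactin E.mtopology (F ` topspace Z)"
    using Z F image_compactin unfolding compact_space_def by blast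
  then have "E.mtotally_bounded (F ` topspace Z)" by (rule E.compactin_imp_mtotally_bounded)
  then obtain C where C: "finite C" "C \<subseteq> F ` topspace Z" "F ` topspace Z \<subseteq> (\<Union>x\<in>C. E.mball x 1)"
    unfolding E.mtotally_bounded_def by (metis zero_less_one)
  have CE: "C \<subseteq> E" using C(2) E.continuous_map_in_M[OF F] by blast
  show ?thesis
  proof (rule that[of "\<Union>x\<in>C. \<Union>h\<in>supp x. star h"])
    show "finite (\<Union>x\<in>C. \<Union>h\<in>supp x. star h)"
      using C(1) CE E_finite E_supp finite_star by (intro finite_UN_I) blast+
    show "(\<Union>x\<in>C. \<Union>h\<in>supp x. star h) \<subseteq> carrier G" using block_subset by (auto simp: star_def)
    fix w assume w: "w \<in> topspace Z"
    then obtain x where x: "x \<in> C" "l1 x (F w) < 1" using C(3) by auto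
    have E: "x \<in> E" "F w \<in> E" using x CE E.continuous_map_in_M[OF F w] by auto
    have "supp x \<inter> supp (F w) \<noteq> {}" using l1_disjoint[of x "F w"] E_weights E x(2) by fastforce
    then obtain h where "h \<in> supp x" "h \<in> supp (F w)" by blast
    then show "supp (F w) \<subseteq> (\<Union>x\<in>C. \<Union>h\<in>supp x. star h)" using supp_subset_star[OF E(2)] x(1) by blast
  qed
qed

lemma \<Delta>_pow_mono: "i \<le> j \<Longrightarrow> \<Delta> [^] (i::nat) \<sqsubseteq> \<Delta> [^] (j::nat)"
proof (induction j rule: nat_induct_at_least)
  case base
  show ?case by (rule le_refl) simp
next
  case (Suc j)
  then show ?case using le_trans[OF _ _ _ Suc.IH le_mult_\<Delta>[of "\<Delta> [^] j"]] by simp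
qed

lemma inv_\<Delta>_pow_mono: "i \<le> j \<Longrightarrow> inv (\<Delta> [^] (j::nat)) \<sqsubseteq> inv (\<Delta> [^] (i::nat))"
proof -
  assume ij: "i \<le> j"
  have "\<Delta> [^] j = \<Delta> [^] (j - i) \<otimes> \<Delta> [^] i" using ij by (simp add: nat_pow_mult)
  then have "inv (\<Delta> [^] i) = inv (\<Delta> [^] j) \<otimes> \<Delta> [^] (j - i)"
    by (simp add: inv_mult_group m_assoc)
  moreover have "inv (\<Delta> [^] j) \<otimes> \<Delta> [^] (0::nat) \<sqsubseteq> inv (\<Delta> [^] j) \<otimes> \<Delta> [^] (j - i)"
    by (rule le_left[OF _ _ _ \<Delta>_pow_mono]) auto
  ultimately show ?thesis by simp
qed

lemma finite_bounded:
  assumes "finite K" "K \<subseteq> carrier G"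
  obtains k :: nat where "\<And>h. h \<in> K \<Longrightarrow> inv (\<Delta> [^] k) \<sqsubseteq> h \<and> h \<sqsubseteq> \<Delta> [^] k"
proof -
  obtain b :: "'g \<Rightarrow> nat" where b: "\<And>h. h \<in> carrier G \<Longrightarrow> inv (\<Delta> [^] b h) \<sqsubseteq> h \<and> h \<sqsubseteq> \<Delta> [^] b h"
    using bounded by metis
  define k where "k = Max (insert 0 (b ` K))"
  have "inv (\<Delta> [^] k) \<sqsubseteq> h \<and> h \<sqsubseteq> \<Delta> [^] k" if h: "h \<in> K" for h
  proof -
    have "b h \<le> k" unfolding k_def using assms h by (intro Max_ge) auto
    then show ?thesis
      using inv_\<Delta>_pow_mono \<Delta>_pow_mono b[of h] h assms(2) le_trans[of "inv (\<Delta> [^] k)" "inv (\<Delta> [^] b h)" h]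
        le_trans[of h "\<Delta> [^] b h" "\<Delta> [^] k"] by auto
  qed
  then show ?thesis using that by blast
qed

text \<open>Descend from \<open>z = \<Delta>\<^sup>k\<close>, where the vertex map is the identity on the finite support, to
  \<open>z = \<Delta>\<^sup>-\<^sup>k\<close>, where it is constant.\<close>

lemma null_homotopic:
  assumes Z: "compact_space Z" and F: "continuous_map Z E.mtopology F"
  shows "\<exists>e. homotopic_with (\<lambda>_. True) Z E.mtopology F (\<lambda>_. e)"
proof -
  obtain K where K: "finite K" "K \<subseteq> carrier G" "\<And>w. w \<in> topspace Z \<Longrightarrow> supp (F w) \<subseteq> K"
    by (rule finite_support_of_compact[OF Z F]) blast
  obtain k :: nat where k: "\<And>h. h \<in> K \<Longrightarrow> inv (\<Delta> [^] k) \<sqsubseteq> h \<and> h \<sqsubseteq> \<Delta> [^] k"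
    using finite_bounded[OF K(1,2)] by metis
  define z where "z = inv (\<Delta> [^] k)"
  have z: "z \<in> carrier G" by (simp add: z_def)
  have top: "z \<otimes> \<Delta> [^] (k + k) = \<Delta> [^] k" by (simp add: z_def flip: nat_pow_mult)
  have low: "retract z (F w) = (\<lambda>h. if h = z then 1 else 0)" if w: "w \<in> topspace Z" for w
  proof (rule push_const)
    show "F w \<in> weights" using E.continuous_map_in_M[OF F w] E_weights by blast
    show "meet h z = z" if "h \<in> supp (F w)" for h
      using K(2) K(3)[OF w] k that z unfolding z_def by (intro meet_eq2) auto
  qed
  have high: "retract (z \<otimes> \<Delta> [^] (k + k)) (F w) = F w" if w: "w \<in> topspace Z" for w
    unfolding top
  proof (rule push_id)
    show "F w \<in> weights" using E.continuous_map_in_M[OF F w] E_weights by blast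
    show "meet h (\<Delta> [^] k) = h" if "h \<in> supp (F w)" for h
      using K(2) K(3)[OF w] k that by (intro meet_eq1) auto
  qed
  have "homotopic_with (\<lambda>_. True) Z E.mtopology F (\<lambda>_. (\<lambda>h. if h = z then 1 else 0))"
    by (rule homotopic_with_eq[OF homotopic_with_symD[OF retract_homotopic[OF F z, of "k + k"]]])
      (use low high in auto)
  then show ?thesis by (rule exI[of _ "\<lambda>h. if h = z then 1 else 0"])
qed

definition act :: "'g \<Rightarrow> ('g \<Rightarrow> real) \<Rightarrow> 'g \<Rightarrow> real" where
  "act g = push ((\<otimes>) g)"

lemma inj_on_mult: "g \<in> carrier G \<Longrightarrow> inj_on ((\<otimes>) g) (carrier G)"
  by (auto simp: inj_on_def)

lemma act_at: "\<lbrakk>g \<in> carrier G; x \<in> E; h \<in> carrier G\<rbrakk> \<Longrightarrow> act g x (g \<otimes> h) = x h"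
  unfolding act_def by (rule push_at[OF E_weights inj_on_mult E_supp])

lemma supp_act: "x \<in> E \<Longrightarrow> supp (act g x) = (\<otimes>) g ` supp x"
  unfolding act_def by (rule supp_push[OF E_weights])

lemma act_in: "\<lbrakk>g \<in> carrier G; x \<in> E\<rbrakk> \<Longrightarrow> act g x \<in> E"
proof -
  assume g: "g \<in> carrier G" and x: "x \<in> E"
  then obtain k where "k \<in> carrier G" "supp x \<subseteq> block k" by (auto simp: E_def)
  then have "supp (act g x) \<subseteq> block (g \<otimes> k)" "g \<otimes> k \<in> carrier G"
    using block_translate[OF g] g unfolding supp_act[OF x] by auto
  then show ?thesis using push_weights[OF E_weights[OF x]] unfolding E_def act_def by auto
qed

lemma act_mult: "\<lbrakk>g \<in> carrier G; h \<in> carrier G; x \<in> E\<rbrakk> \<Longrightarrow> act (g \<otimes> h) x = act g (act h x)"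
  unfolding act_def push_comp[OF E_weights] by (rule push_cong) (use E_supp m_assoc in blast)

lemma act_one: "x \<in> E \<Longrightarrow> act \<one> x = x"
  unfolding act_def by (rule push_id[OF E_weights]) (use E_supp l_one in blast)+

lemma act_inv: "\<lbrakk>g \<in> carrier G; x \<in> E\<rbrakk> \<Longrightarrow> act (inv g) (act g x) = x"
  by (simp flip: act_mult add: act_one)

lemma l1_act:
  assumes g: "g \<in> carrier G" and x: "x \<in> E" and y: "y \<in> E" shows "l1 (act g x) (act g y) = l1 x y"
proof (rule antisym)
  have le: "l1 (act g x) (act g y) \<le> l1 x y" if "g \<in> carrier G" "x \<in> E" "y \<in> E" for g x y
    unfolding act_def using that E_weights by (intro l1_push) auto
  show "l1 (act g x) (act g y) \<le> l1 x y" using le assms .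
  show "l1 x y \<le> l1 (act g x) (act g y)"
    using le[of "inv g" "act g x" "act g y"] act_in assms by (simp add: act_inv)
qed

text \<open>With \<open>N\<close> vertices in a maximal simplex, a weight has a coordinate of size at least \<open>1/N\<close>, and
  \<open>N + 1\<close> half-open intervals of this length fit between the first multiple and \<open>1/N\<close>.\<close>

definition gap :: real where
  "gap = (let N = real (card (block \<one>)) in 1 / (N * (N + 2)))"

lemma card_block_pos: "card (block \<one>) > 0"
  using one_in_block finite_block_one card_gt_0_iff by blast

lemma gap_pos: "gap > 0"
  using card_block_pos by (simp add: gap_def Let_def)

text \<open>Pigeonhole: a weight has at most \<open>N\<close> nonzero coordinates, so one of the \<open>N + 1\<close> intervals contains
  none of them.\<close>

lemma level_gap:
  assumes x: "x \<in> E"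
  obtains j :: nat where "j \<ge> 1" "\<And>h. x h > real j * gap \<Longrightarrow> x h \<ge> real (Suc j) * gap"
    "\<exists>h. x h \<ge> real (Suc j) * gap"
proof -
  let ?N = "card (block \<one>)"
  have cardx: "card (supp x) \<le> ?N"
  proof -
    obtain g where "g \<in> carrier G" "supp x \<subseteq> block g" using x by (auto simp: E_def)
    then show ?thesis using card_mono[OF finite_block] card_block by metis
  qed
  have "\<exists>j\<in>{1..?N + 1}. \<forall>h. \<not> (real j * gap \<le> x h \<and> x h < real (Suc j) * gap)"
  proof (rule ccontr)
    assume "\<not> ?thesis"
    then have "\<forall>j\<in>{1..?N + 1}. \<exists>h. real j * gap \<le> x h \<and> x h < real (Suc j) * gap" by blast
    then obtain f where f: "\<And>j. j \<in> {1..?N + 1} \<Longrightarrow> real j * gap \<le> x (f j) \<and> x (f j) < real (Suc j) * gap"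
      by metis
    have "inj_on f {1..?N + 1}"
    proof (rule linorder_inj_onI)
      fix i j assume ij: "i < j" "i \<in> {1..?N + 1}" "j \<in> {1..?N + 1}"
      have "x (f i) < real (Suc i) * gap" using f ij by blast
      also have "\<dots> \<le> real j * gap" using ij gap_pos by (intro mult_right_mono) auto
      also have "\<dots> \<le> x (f j)" using f ij by blast
      finally show "f i \<noteq> f j" by auto
    qed auto
    moreover have "f ` {1..?N + 1} \<subseteq> supp x"
    proof
      fix h assume "h \<in> f ` {1..?N + 1}"
      then obtain j where j: "j \<in> {1..?N + 1}" "h = f j" by blast
      then have "0 < real j * gap" using gap_pos by simp
      then show "h \<in> supp x" using f[OF j(1)] j(2) by (simp add: in_supp)
    qed
    ultimately have "card {1..?N + 1} \<le> card (supp x)" using card_inj_on_le E_finite[OF x] by blast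
    then show False using cardx by simp
  qed
  then obtain j where j: "j \<in> {1..?N + 1}" "\<And>h. \<not> (real j * gap \<le> x h \<and> x h < real (Suc j) * gap)" by blast
  have "\<exists>h. x h \<ge> 1 / real ?N"
  proof (rule ccontr)
    assume "\<not> ?thesis"
    then have "(\<Sum>h\<in>supp x. x h) < (\<Sum>h\<in>supp x. 1 / real ?N)"
      using E_finite[OF x] weights_supp_nonempty[OF E_weights[OF x]] by (intro sum_strict_mono) (auto simp: not_le)
    also have "\<dots> \<le> 1" using cardx card_block_pos by simp
    finally show False using E_weights[OF x] by (simp add: weights_def)
  qed
  moreover have "real (Suc j) * gap \<le> 1 / real ?N"
  proof -
    have "real (Suc j) \<le> real ?N + 2" using j(1) by simp
    then have "real (Suc j) * gap \<le> (real ?N + 2) * gap" using gap_pos by (intro mult_right_mono) auto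
    also have "\<dots> = 1 / real ?N" using card_block_pos by (simp add: gap_def Let_def)
    finally show ?thesis .
  qed
  ultimately have "\<exists>h. x h \<ge> real (Suc j) * gap" by (meson order_trans)
  moreover have "x h \<ge> real (Suc j) * gap" if "x h > real j * gap" for h
    using j(2)[of h] that by linarith
  ultimately show ?thesis using that[of j] j(1) by auto
qed

text \<open>The coordinates above an empty interval of length \<open>gap\<close> stay above it when each of them moves by
  less than \<open>gap\<close>. So \<open>g\<inverse>\<close> maps a finite nonempty level set to itself.\<close>

lemma act_gap:
  assumes x: "x \<in> E" and g: "g \<in> carrier G" and close: "l1 x (act g x) < gap"
  shows "g = \<one>"
proof -
  obtain j :: nat where j: "j \<ge> 1" "\<And>h. x h > real j * gap \<Longrightarrow> x h \<ge> real (Suc j) * gap"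
    "\<exists>h. x h \<ge> real (Suc j) * gap" using level_gap[OF x] by metis
  let ?B = "{h. x h \<ge> real (Suc j) * gap}"
  have "real (Suc j) * gap > 0" using gap_pos by simp
  then have sub: "?B \<subseteq> supp x" by (auto simp: in_supp)
  have Bc: "?B \<subseteq> carrier G" using sub E_supp[OF x] by blast
  have "(\<otimes>) (inv g) ` ?B \<subseteq> ?B"
  proof
    fix k assume "k \<in> (\<otimes>) (inv g) ` ?B"
    then obtain h where h: "h \<in> ?B" "k = inv g \<otimes> h" by blast
    have hc: "h \<in> carrier G" using h Bc by blast
    have "\<bar>x h - act g x h\<bar> < gap"
      using l1_coordinate[OF E_weights[OF x] E_weights[OF act_in[OF g x]], of h] close by linarith
    moreover have "act g x h = x k" using act_at[OF g x, of k] h(2) g hc by simp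
    ultimately have "x k > real j * gap" using h(1) by (simp add: algebra_simps abs_less_iff)
    then show "k \<in> ?B" using j(2) by simp
  qed
  then have "inv g = \<one>"
    using translate_fixes_finite_set[of ?B "inv g"] finite_subset[OF sub E_finite[OF x]] j(3) Bc g by blast
  then show ?thesis using g by (metis inv_inv inv_one)
qed

text \<open>The point of the orbit whose support has meet \<open>1\<close>.\<close>

definition normal_form :: "('g \<Rightarrow> real) \<Rightarrow> 'g \<Rightarrow> real" where
  "normal_form x = act (inv (THE m. is_glb (supp x) m)) x"

lemma glb_supp:
  assumes x: "x \<in> E" shows "is_glb (supp x) (THE m. is_glb (supp x) m)"
proof -
  obtain m where "is_glb (supp x) m"
    using is_glb_exists[OF E_finite[OF x] weights_supp_nonempty[OF E_weights[OF x]] E_supp[OF x]] ..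
  then show ?thesis using is_glb_unique by (metis theI)
qed

lemma normal_form_orbit: "x \<in> E \<Longrightarrow> \<exists>g\<in>carrier G. normal_form x = act g x"
  using glb_supp[of x] unfolding normal_form_def is_glb_def by auto

lemma normal_form_in: "x \<in> E \<Longrightarrow> normal_form x \<in> E"
  using normal_form_orbit act_in by metis

lemma normal_form_glb: "x \<in> E \<Longrightarrow> is_glb (supp (normal_form x)) \<one>"
proof -
  assume x: "x \<in> E"
  let ?m = "THE m. is_glb (supp x) m"
  have m: "?m \<in> carrier G" using glb_supp[OF x] by (simp add: is_glb_def)
  show ?thesis
    using is_glb_translate[OF glb_supp[OF x] E_supp[OF x], of "inv ?m"] m
    by (simp add: normal_form_def supp_act[OF x])
qed

lemma glb_one_subset_block:
  assumes x: "x \<in> E" and glb: "is_glb (supp x) \<one>" shows "supp x \<subseteq> block \<one>"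
proof
  fix h assume h: "h \<in> supp x"
  obtain g where g: "g \<in> carrier G" "supp x \<subseteq> block g" using x by (auto simp: E_def)
  have hc: "h \<in> carrier G" using h E_supp[OF x] by blast
  have "g \<sqsubseteq> \<one>" using g glb by (auto simp: is_glb_def block_def)
  then have "g \<otimes> \<Delta> \<sqsubseteq> \<one> \<otimes> \<Delta>" using le_right_\<Delta>[of g \<one>] g(1) by blast
  moreover have "h \<sqsubseteq> g \<otimes> \<Delta>" using g h by (auto simp: block_def)
  ultimately have "h \<sqsubseteq> \<one> \<otimes> \<Delta>" using le_trans[OF hc] g by (meson \<Delta>_in m_closed one_closed)
  then show "h \<in> block \<one>" using glb h hc by (auto simp: is_glb_def block_def)
qed

lemma normal_form_act:
  assumes x: "x \<in> E" and g: "g \<in> carrier G" shows "normal_form (act g x) = normal_form x"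
proof -
  let ?m = "THE m. is_glb (supp x) m"
  have m: "?m \<in> carrier G" using glb_supp[OF x] by (simp add: is_glb_def)
  have "is_glb (supp (act g x)) (g \<otimes> ?m)"
    using is_glb_translate[OF glb_supp[OF x] E_supp[OF x] g] by (simp add: supp_act[OF x])
  then have "(THE m. is_glb (supp (act g x)) m) = g \<otimes> ?m" using is_glb_unique by blast
  then show ?thesis
    using act_mult[of "inv ?m" "inv g" "act g x"] act_in[OF g x] act_inv[OF g x] m g
    by (simp add: normal_form_def inv_mult_group)
qed

definition simple_index :: "'g \<Rightarrow> nat" where
  "simple_index = (SOME f. bij_betw f (block \<one>) {0..<card (block \<one>)})"

lemma simple_index: "bij_betw simple_index (block \<one>) {0..<card (block \<one>)}"
  unfolding simple_index_def by (rule someI_ex[OF ex_bij_betw_finite_nat[OF finite_block_one]])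

text \<open>The normal form is supported on the finite block of \<open>1\<close>, which is enumerated to store the
  orbit as a function on the naturals.\<close>

definition proj :: "('g \<Rightarrow> real) \<Rightarrow> nat \<Rightarrow> real" where
  "proj x = push simple_index (normal_form x)"

lemma proj_eq_iff:
  assumes x: "x \<in> E" and y: "y \<in> E" shows "proj x = proj y \<longleftrightarrow> (\<exists>g\<in>carrier G. act g x = y)"
proof
  assume eq: "proj x = proj y"
  have sub: "supp (normal_form u) \<subseteq> block \<one>" if "u \<in> E" for u
    using glb_one_subset_block[OF normal_form_in normal_form_glb] that by blast
  have "normal_form x h = normal_form y h" for h
  proof (cases "h \<in> block \<one>")
    case True
    have "proj u (simple_index h) = normal_form u h" if "u \<in> E" for u
      unfolding proj_def using simple_index True sub[OF that] normal_form_in[OF that]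
      by (intro push_at[OF E_weights, of _ _ "block \<one>"]) (auto simp: bij_betw_def)
    then show ?thesis using x y eq by metis
  next
    case False
    then have "h \<notin> supp (normal_form x)" "h \<notin> supp (normal_form y)" using sub x y by blast+
    then show ?thesis by (simp add: in_supp)
  qed
  then have nf: "normal_form x = normal_form y" ..
  obtain g where g: "g \<in> carrier G" "normal_form x = act g x" using normal_form_orbit[OF x] ..
  obtain h where h: "h \<in> carrier G" "normal_form y = act h y" using normal_form_orbit[OF y] ..
  have "act (inv h \<otimes> g) x = y"
    using act_mult[of "inv h" g x] act_inv[OF h(1) y] nf g h x by simp
  then show "\<exists>g\<in>carrier G. act g x = y" using g h by blast
next
  assume "\<exists>g\<in>carrier G. act g x = y"
  then show "proj x = proj y" using normal_form_act[OF x] unfolding proj_def by auto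
qed

definition orbit_space :: "(nat \<Rightarrow> real) set" where "orbit_space = proj ` E"

text \<open>The quotient metric. Off the orbit space the infimum would be over the empty set, and the value is
  set to 0 to keep the distance nonnegative everywhere.\<close>

definition orbit_dist :: "(nat \<Rightarrow> real) \<Rightarrow> (nat \<Rightarrow> real) \<Rightarrow> real" where
  "orbit_dist u v = (if u \<in> orbit_space \<and> v \<in> orbit_space
     then Inf {l1 x y | x y. x \<in> E \<and> y \<in> E \<and> proj x = u \<and> proj y = v} else 0)"

text \<open>Only finitely many translates of \<open>y\<close> share a vertex with \<open>x\<close>, and all others are at distance 2, so
  the infimum over the orbit is a minimum.\<close>

lemma orbit_dist_attained:
  assumes x: "x \<in> E" and y: "y \<in> E"
  shows "\<exists>y'\<in>E. proj y' = proj y \<and> l1 x y' = orbit_dist (proj x) (proj y)"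
    and "orbit_dist (proj x) (proj y) \<le> l1 x y"
proof -
  let ?V = "(\<lambda>g. l1 x (act g y)) ` carrier G"
  let ?D = "{l1 x' y' | x' y'. x' \<in> E \<and> y' \<in> E \<and> proj x' = proj x \<and> proj y' = proj y}"
  have "l1 x (act g y) \<in> insert 2 ((\<lambda>(h, k). l1 x (act (h \<otimes> inv k) y)) ` (supp x \<times> supp y))"
    if g: "g \<in> carrier G" for g
  proof (cases "supp x \<inter> supp (act g y) = {}")
    case True
    then show ?thesis using l1_disjoint[OF E_weights[OF x] E_weights[OF act_in[OF g y]]] by simp
  next
    case False
    then obtain h k where hk: "h \<in> supp x" "k \<in> supp y" "h = g \<otimes> k" using supp_act[OF y] by auto
    then have "g = h \<otimes> inv k" using g E_supp[OF y] by (auto simp: m_assoc subset_iff)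
    then have "l1 x (act g y) = (case (h, k) of (h, k) \<Rightarrow> l1 x (act (h \<otimes> inv k) y))" by simp
    then show ?thesis using hk(1,2) by blast
  qed
  then have "?V \<subseteq> insert 2 ((\<lambda>(h, k). l1 x (act (h \<otimes> inv k) y)) ` (supp x \<times> supp y))" by blast
  then have fin: "finite ?V" by (rule finite_subset) (simp add: E_finite x y)
  have DV: "?D = ?V"
  proof
    show "?V \<subseteq> ?D" using x y act_in proj_eq_iff[OF y act_in[OF _ y]] by fastforce
    show "?D \<subseteq> ?V"
    proof
      fix r assume "r \<in> ?D"
      then obtain x' y' where r: "r = l1 x' y'" "x' \<in> E" "y' \<in> E" "proj x = proj x'" "proj y = proj y'" by force
      obtain a where a: "a \<in> carrier G" "act a x = x'" using proj_eq_iff[OF x r(2)] r(4) by blast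
      obtain b where b: "b \<in> carrier G" "act b y = y'" using proj_eq_iff[OF y r(3)] r(5) by blast
      have "r = l1 (act (inv a) (act a x)) (act (inv a) (act b y))"
        using l1_act[of "inv a" x' y'] r a b by simp
      also have "\<dots> = l1 x (act (inv a \<otimes> b) y)"
        using act_inv[OF a(1) x] act_mult[of "inv a" b y] a b y by simp
      finally show "r \<in> ?V" using a b by blast
    qed
  qed
  have ne: "?V \<noteq> {}" by blast
  have Inf: "orbit_dist (proj x) (proj y) = Min ?V"
    using x y cInf_eq_Min[OF fin ne] unfolding orbit_dist_def DV by (simp add: orbit_space_def)
  have "Min ?V \<in> ?V" by (rule Min_in[OF fin ne])
  then obtain g where g: "g \<in> carrier G" "l1 x (act g y) = Min ?V" by force
  then show "\<exists>y'\<in>E. proj y' = proj y \<and> l1 x y' = orbit_dist (proj x) (proj y)"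
    using Inf act_in[OF g(1) y] proj_eq_iff[OF y act_in[OF g(1) y]] by metis
  have "l1 x y \<in> ?V" using act_one[OF y] by (metis image_eqI one_closed)
  then show "orbit_dist (proj x) (proj y) \<le> l1 x y" unfolding Inf by (rule Min_le[OF fin])
qed

lemma Metric_space_orbit: "Metric_space orbit_space orbit_dist"
proof
  have D: "\<exists>x\<in>E. \<exists>y\<in>E. proj x = u \<and> proj y = v \<and> l1 x y = orbit_dist u v"
    if uv: "u \<in> orbit_space" "v \<in> orbit_space" for u v
  proof -
    obtain x y0 where x: "x \<in> E" "proj x = u" and y0: "y0 \<in> E" "proj y0 = v"
      using uv unfolding orbit_space_def by blast
    then obtain y where "y \<in> E" "proj y = v" "l1 x y = orbit_dist u v"
      using orbit_dist_attained(1)[OF x(1) y0(1)] by auto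
    then show ?thesis using x by blast
  qed
  have comm: "orbit_dist u v = orbit_dist v u" for u v
  proof -
    have sub: "{l1 x y | x y. x \<in> E \<and> y \<in> E \<and> proj x = u \<and> proj y = v}
        \<subseteq> {l1 x y | x y. x \<in> E \<and> y \<in> E \<and> proj x = v \<and> proj y = u}" for u v
    proof
      fix r assume "r \<in> {l1 x y | x y. x \<in> E \<and> y \<in> E \<and> proj x = u \<and> proj y = v}"
      then obtain x y where r: "r = l1 x y" "x \<in> E" "y \<in> E" "proj x = u" "proj y = v" by blast
      have "r = l1 y x" using r(1) E.commute by simp
      then show "r \<in> {l1 x y | x y. x \<in> E \<and> y \<in> E \<and> proj x = v \<and> proj y = u}" using r by blast
    qed
    have "{l1 x y | x y. x \<in> E \<and> y \<in> E \<and> proj x = u \<and> proj y = v}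
        = {l1 x y | x y. x \<in> E \<and> y \<in> E \<and> proj x = v \<and> proj y = u}"
      by (rule subset_antisym; rule sub)
    then show ?thesis unfolding orbit_dist_def by simp
  qed
  then show "orbit_dist u v = orbit_dist v u" for u v .
  show "0 \<le> orbit_dist u v" for u v
  proof (cases "u \<in> orbit_space \<and> v \<in> orbit_space")
    case True
    then show ?thesis using D[of u v] E.nonneg by metis
  next
    case False
    then show ?thesis unfolding orbit_dist_def by auto
  qed
  show "orbit_dist u v = 0 \<longleftrightarrow> u = v" if uv: "u \<in> orbit_space" "v \<in> orbit_space" for u v
  proof
    assume "orbit_dist u v = 0"
    then obtain x y where "x \<in> E" "y \<in> E" "proj x = u" "proj y = v" "l1 x y = 0" using D[OF uv] by metis
    then show "u = v" by simp
  next
    assume "u = v"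
    obtain x where x: "x \<in> E" "proj x = u" using uv by (auto simp: orbit_space_def)
    then have "orbit_dist u u \<le> 0" using orbit_dist_attained(2)[OF x(1) x(1)] by simp
    moreover have "orbit_dist u u \<ge> 0" using D[OF uv(1) uv(1)] E.nonneg by metis
    ultimately show "orbit_dist u v = 0" using \<open>u = v\<close> by simp
  qed
  show "orbit_dist u w \<le> orbit_dist u v + orbit_dist v w"
    if uvw: "u \<in> orbit_space" "v \<in> orbit_space" "w \<in> orbit_space" for u v w
  proof -
    obtain x y where xy: "x \<in> E" "y \<in> E" "proj x = u" "proj y = v" "l1 x y = orbit_dist u v"
      using D[OF uvw(1,2)] by metis
    obtain z0 where "z0 \<in> E" "proj z0 = w" using uvw(3) by (auto simp: orbit_space_def)
    then obtain z where z: "z \<in> E" "proj z = w" "l1 y z = orbit_dist v w"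
      using orbit_dist_attained(1)[OF xy(2)] xy(4) by metis
    have "orbit_dist u w \<le> l1 x z" using orbit_dist_attained(2)[OF xy(1) z(1)] xy z by simp
    then show ?thesis using E.triangle[OF xy(1,2) z(1)] xy z by simp
  qed
qed

lemma galois_cover_proj: "galois_cover E l1 orbit_space orbit_dist proj gap G act"
proof -
  interpret X: Metric_space orbit_space orbit_dist by (rule Metric_space_orbit)
  have delta: "(\<lambda>h. if h = \<one> then 1 else 0) \<in> E"
  proof -
    have "(\<lambda>h. if h = \<one> then 1 else (0::real)) \<in> weights"
      by (rule weightsI[of "{\<one>}"]) (auto simp: supp_def)
    then show ?thesis using one_in_block by (auto simp: E_def supp_def intro!: bexI[of _ \<one>])
  qed
  show ?thesis
  proof (unfold_locales)
    show "proj e \<in> orbit_space" if "e \<in> E" for e using that by (simp add: orbit_space_def)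
    show "orbit_dist (proj e) (proj e') \<le> l1 e e'" if "e \<in> E" "e' \<in> E" for e e'
      using orbit_dist_attained(2) that .
    show "\<exists>e'\<in>E. proj e' = u \<and> l1 e e' = orbit_dist (proj e) u" if "e \<in> E" "u \<in> orbit_space" for e u
      using orbit_dist_attained(1)[OF that(1)] that(2) by (auto simp: orbit_space_def)
    show "\<exists>e\<in>E. proj e = u" if "u \<in> orbit_space" for u using that by (auto simp: orbit_space_def)
    show "gap > 0" by (rule gap_pos)
    show "e = e'" if e: "e \<in> E" "e' \<in> E" "proj e = proj e'" "l1 e e' < gap" for e e'
    proof -
      obtain g where g: "g \<in> carrier G" "act g e = e'" using proj_eq_iff[OF e(1,2)] e(3) by blast
      then have "g = \<one>" using act_gap[OF e(1) g(1)] e(4) by simp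
      then show ?thesis using g(2) act_one[OF e(1)] by simp
    qed
    show "\<exists>g\<in>carrier G. act g e = e'" if "e \<in> E" "e' \<in> E" "proj e = proj e'" for e e'
      using proj_eq_iff[OF that(1,2)] that(3) by blast
    show "proj (act g e) = proj e" if "g \<in> carrier G" "e \<in> E" for g e
      using proj_eq_iff[OF that(2) act_in[OF that]] that(1) by auto
    show "g = h" if e: "e \<in> E" and gh: "g \<in> carrier G" "h \<in> carrier G" "act g e = act h e" for e g h
    proof -
      have "act (inv h \<otimes> g) e = act (inv h) (act h e)"
        using act_mult[of "inv h" g e] e gh by (simp only: inv_closed)
      also have "\<dots> = e" by (rule act_inv[OF gh(2) e])
      finally have "l1 e (act (inv h \<otimes> g) e) < gap" using e gap_pos by simp
      then have "inv h \<otimes> g = \<one>" using act_gap[OF e, of "inv h \<otimes> g"] gh by blast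
      then show ?thesis using gh by (metis inv_mult_cancel(2) r_one)
    qed
    show "E \<noteq> {}" using delta by blast
    show "\<exists>e. homotopic_with (\<lambda>_. True) Z E.mtopology F (\<lambda>_. e)"
      if "compact_space Z" "continuous_map Z E.mtopology F" for Z :: "(nat \<Rightarrow> real) topology" and F
      using null_homotopic that .
  qed (fact act_in act_mult l1_act)+
qed

end


section \<open>Cells of the orbit space\<close>

context garside_order begin

text \<open>The simplices with meet \<open>1\<close>, one from each orbit of simplices.\<close>

definition cells :: "'g set set" where
  "cells = {A. A \<subseteq> block \<one> \<and> A \<noteq> {} \<and> is_glb A \<one>}"

definition cell_dim :: "'g set \<Rightarrow> nat" where "cell_dim A = card A - 1"

definition cell_index :: "'g set \<Rightarrow> 'g \<Rightarrow> nat" where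
  "cell_index A = (SOME f. bij_betw f A {0..<card A})"

definition cell_point :: "'g set \<Rightarrow> (nat \<Rightarrow> real) \<Rightarrow> 'g \<Rightarrow> real" where
  "cell_point A y h = (if h \<in> A then disc_to_simplex (cell_dim A) y (cell_index A h) else 0)"

definition char_map :: "'g set \<Rightarrow> (nat \<Rightarrow> real) \<Rightarrow> nat \<Rightarrow> real" where
  "char_map A y = proj (cell_point A y)"

lemma finite_cell: "A \<in> cells \<Longrightarrow> finite A"
  unfolding cells_def using finite_block_one finite_subset by blast

lemma cell_subset: "A \<in> cells \<Longrightarrow> A \<subseteq> carrier G"
  unfolding cells_def using block_subset by blast

lemma cell_index:
  assumes A: "A \<in> cells" shows "bij_betw (cell_index A) A {..cell_dim A}"
proof -
  have "bij_betw (cell_index A) A {0..<card A}"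
    unfolding cell_index_def by (rule someI_ex[OF ex_bij_betw_finite_nat[OF finite_cell[OF A]]])
  moreover have "card A > 0" using A finite_cell[OF A] by (simp add: cells_def card_gt_0_iff)
  then have "{0..<card A} = {..cell_dim A}" by (auto simp: cell_dim_def)
  ultimately show ?thesis by simp
qed

lemma cell_index_le: "A \<in> cells \<Longrightarrow> h \<in> A \<Longrightarrow> cell_index A h \<le> cell_dim A"
  using cell_index bij_betwE by fastforce

lemma supp_cell_point_subset: "supp (cell_point A y) \<subseteq> A"
  by (auto simp: supp_def cell_point_def)

lemma cell_point_in:
  assumes A: "A \<in> cells" and y: "y \<in> topspace (closed_disc (cell_dim A))"
  shows "cell_point A y \<in> E"
proof -
  have "cell_point A y \<in> weights"
  proof (rule weightsI[OF finite_cell[OF A] supp_cell_point_subset])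
    show "0 \<le> cell_point A y h" for h
      using disc_to_simplex_nonneg[OF y cell_index_le[OF A]] by (simp add: cell_point_def)
    have "(\<Sum>h\<in>A. cell_point A y h) = (\<Sum>h\<in>A. disc_to_simplex (cell_dim A) y (cell_index A h))"
      by (rule sum.cong) (auto simp: cell_point_def)
    also have "\<dots> = (\<Sum>i\<le>cell_dim A. disc_to_simplex (cell_dim A) y i)"
      by (rule sum.reindex_bij_betw[OF cell_index[OF A]])
    finally show "sum (cell_point A y) A = 1" by (simp add: sum_disc_to_simplex)
  qed
  moreover have "supp (cell_point A y) \<subseteq> block \<one>"
    using supp_cell_point_subset A by (fastforce simp: cells_def)
  ultimately show ?thesis by (auto simp: E_def)
qed

lemma open_disc_subset: "open_disc n \<subseteq> topspace (closed_disc n)"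
  by (auto simp: open_disc_def closed_disc_eq topspace_Euclidean_space)

lemma supp_cell_point_iff:
  assumes A: "A \<in> cells" and y: "y \<in> topspace (closed_disc (cell_dim A))"
  shows "supp (cell_point A y) = A \<longleftrightarrow> y \<in> open_disc (cell_dim A)"
proof -
  have "supp (cell_point A y) = A \<longleftrightarrow> (\<forall>h\<in>A. disc_to_simplex (cell_dim A) y (cell_index A h) > 0)"
  proof -
    have "0 \<le> disc_to_simplex (cell_dim A) y (cell_index A h)" if "h \<in> A" for h
      using disc_to_simplex_nonneg[OF y cell_index_le[OF A that]] .
    then have "supp (cell_point A y) = {h \<in> A. disc_to_simplex (cell_dim A) y (cell_index A h) > 0}"
      by (force simp: supp_def cell_point_def less_le)
    then show ?thesis by blast
  qed
  also have "\<dots> \<longleftrightarrow> (\<forall>i\<le>cell_dim A. disc_to_simplex (cell_dim A) y i > 0)"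
    using cell_index[OF A] by (metis atMost_iff bij_betw_def image_iff)
  also have "\<dots> \<longleftrightarrow> y \<in> open_disc (cell_dim A)" by (rule disc_to_simplex_pos_iff[OF y])
  finally show ?thesis .
qed

lemma cell_point_inj:
  assumes A: "A \<in> cells" and y: "y \<in> topspace (closed_disc (cell_dim A))"
    and z: "z \<in> topspace (closed_disc (cell_dim A))" and eq: "cell_point A y = cell_point A z"
  shows "y = z"
proof (rule disc_to_simplex_inj[OF y z])
  fix i assume "i \<le> cell_dim A"
  then obtain h where h: "h \<in> A" "i = cell_index A h"
    using cell_index[OF A] by (metis atMost_iff bij_betw_def imageE)
  then show "disc_to_simplex (cell_dim A) y i = disc_to_simplex (cell_dim A) z i"
    using fun_cong[OF eq, of h] by (simp add: cell_point_def)
qed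

lemma cell_point_surj:
  assumes A: "A \<in> cells" and x: "x \<in> E" "supp x = A"
  obtains y where "y \<in> open_disc (cell_dim A)" "cell_point A y = x"
proof -
  let ?f = "cell_index A" let ?g = "inv_into A (cell_index A)"
  have bij: "bij_betw ?g {..cell_dim A} A" by (rule bij_betw_inv_into[OF cell_index[OF A]])
  have gf: "?g (?f h) = h" if "h \<in> A" for h
    using bij_betw_inv_into_left[OF cell_index[OF A] that] .
  have pos: "x (?g i) > 0" if "i \<le> cell_dim A" for i
  proof -
    have "?g i \<in> supp x" using bij that x(2) by (auto simp: bij_betw_def)
    then show ?thesis using weights_nonneg[OF E_weights[OF x(1)], of "?g i"] by (simp add: in_supp)
  qed
  have "(\<Sum>i\<le>cell_dim A. x (?g i)) = (\<Sum>h\<in>A. x h)" by (rule sum.reindex_bij_betw[OF bij])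
  also have "\<dots> = 1" using E_weights[OF x(1)] x(2) by (simp add: weights_def)
  finally obtain y where y: "y \<in> open_disc (cell_dim A)" "\<And>i. i \<le> cell_dim A \<Longrightarrow> disc_to_simplex (cell_dim A) y i = x (?g i)"
    using disc_to_simplex_surj[of "cell_dim A" "\<lambda>i. x (?g i)"] pos by metis
  have "cell_point A y h = x h" for h
  proof (cases "h \<in> A")
    case True
    then show ?thesis using y(2)[OF cell_index_le[OF A True]] gf[OF True] by (simp add: cell_point_def)
  next
    case False
    then show ?thesis using x(2) by (auto simp: cell_point_def supp_def)
  qed
  then show ?thesis using that[OF y(1)] by blast
qed

lemma continuous_map_cell_point:
  assumes A: "A \<in> cells"
  shows "continuous_map (closed_disc (cell_dim A)) E.mtopology (cell_point A)"
proof (rule E.continuous_map_mtopologyI)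
  let ?D = "closed_disc (cell_dim A)"
  fix y assume y: "y \<in> topspace ?D"
  show "cell_point A y \<in> E" by (rule cell_point_in[OF A y])
  fix \<epsilon> :: real assume \<epsilon>: "\<epsilon> > 0"
  have l1: "l1 (cell_point A y) (cell_point A z) = (\<Sum>h\<in>A. \<bar>disc_to_simplex (cell_dim A) y (cell_index A h)
      - disc_to_simplex (cell_dim A) z (cell_index A h)\<bar>)" for z
    by (subst l1_eq[OF finite_cell[OF A] supp_cell_point_subset supp_cell_point_subset])
      (auto simp: cell_point_def intro!: sum.cong)
  have "continuous_map ?D euclideanreal (\<lambda>z. l1 (cell_point A y) (cell_point A z))"
    unfolding l1 closed_disc_eq continuous_map_iff_continuous
    by (intro continuous_on_sum continuous_on_rabs continuous_on_diff continuous_on_const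
        continuous_on_disc_to_simplex cell_index_le[OF A])
  then have "openin ?D {z \<in> topspace ?D. l1 (cell_point A y) (cell_point A z) \<in> {..<\<epsilon>}}"
    by (rule openin_continuous_map_preimage) auto
  then show "\<exists>U. openin ?D U \<and> y \<in> U \<and> (\<forall>w\<in>U. l1 (cell_point A y) (cell_point A w) < \<epsilon>)"
    using y \<epsilon> by (intro exI[of _ "{z \<in> topspace ?D. l1 (cell_point A y) (cell_point A z) \<in> {..<\<epsilon>}}"]) (auto simp: l1)
qed

lemma char_map_eqD:
  assumes A: "A \<in> cells" and y: "y \<in> open_disc (cell_dim A)" and x: "x \<in> E" "proj x = char_map A y"
  shows "\<exists>g\<in>carrier G. act g (cell_point A y) = x \<and> supp x = (\<otimes>) g ` A"
proof -
  have y': "y \<in> topspace (closed_disc (cell_dim A))" using y open_disc_subset by blast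
  obtain g where g: "g \<in> carrier G" "act g (cell_point A y) = x"
    using proj_eq_iff[OF cell_point_in[OF A y'] x(1)] x(2) by (auto simp: char_map_def)
  then have "supp x = (\<otimes>) g ` A"
    using supp_act[OF cell_point_in[OF A y'], of g] supp_cell_point_iff[OF A y'] y by simp
  then show ?thesis using g by blast
qed

lemma char_map_inj:
  assumes A: "A \<in> cells" and y: "y \<in> open_disc (cell_dim A)"
    and z: "z \<in> topspace (closed_disc (cell_dim A))" and eq: "char_map A z = char_map A y"
  shows "z = y"
proof -
  have y': "y \<in> topspace (closed_disc (cell_dim A))" using y open_disc_subset by blast
  obtain g where g: "g \<in> carrier G" "act g (cell_point A y) = cell_point A z" "supp (cell_point A z) = (\<otimes>) g ` A"
    using char_map_eqD[OF A y cell_point_in[OF A z]] eq by (auto simp: char_map_def)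
  have "g = \<one>"
    by (rule translate_fixes_finite_set[OF finite_cell[OF A] _ cell_subset[OF A] g(1)])
      (use A supp_cell_point_subset[of A z] g(3) in \<open>auto simp: cells_def\<close>)
  then have "cell_point A y = cell_point A z" using g(2) act_one[OF cell_point_in[OF A y']] by simp
  then show ?thesis using cell_point_inj[OF A y' z] by simp
qed

text \<open>Points in the same orbit have supports that differ by a translation \<open>g\<close>, which maps the meet of
  one to the meet of the other; as both meets are \<open>1\<close>, so is \<open>g\<close>.\<close>

lemma cells_disjoint:
  assumes A: "A \<in> cells" and B: "B \<in> cells" and y: "y \<in> open_disc (cell_dim A)" and z: "z \<in> open_disc (cell_dim B)"
    and eq: "char_map A y = char_map B z"
  shows "A = B"
proof -
  have z': "z \<in> topspace (closed_disc (cell_dim B))" using z open_disc_subset by blast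
  obtain g where g: "g \<in> carrier G" "supp (cell_point B z) = (\<otimes>) g ` A"
    using char_map_eqD[OF A y cell_point_in[OF B z']] eq by (auto simp: char_map_def)
  then have gA: "(\<otimes>) g ` A = B" using supp_cell_point_iff[OF B z'] z by simp
  have "is_glb B (g \<otimes> \<one>)"
    using is_glb_translate[OF _ cell_subset[OF A] g(1), of \<one>] A gA by (simp add: cells_def)
  then have "g = \<one>" using is_glb_unique[of B \<one> g] B g(1) by (simp add: cells_def)
  then show ?thesis using gA cell_subset[OF A] by (auto simp: image_iff subset_iff)
qed

lemma point_in_cell:
  assumes x: "x \<in> E"
  obtains A y where "A \<in> cells" "card A = card (supp x)" "y \<in> open_disc (cell_dim A)" "char_map A y = proj x"
proof -
  let ?n = "normal_form x"
  have n: "?n \<in> E" by (rule normal_form_in[OF x])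
  have A: "supp ?n \<in> cells"
    using glb_one_subset_block[OF n normal_form_glb[OF x]] normal_form_glb[OF x]
      weights_supp_nonempty[OF E_weights[OF n]] by (simp add: cells_def)
  obtain g where g: "g \<in> carrier G" "?n = act g x" using normal_form_orbit[OF x] ..
  have "card (supp ?n) = card (supp x)"
    unfolding g(2) supp_act[OF x]
    by (rule card_image) (use inj_on_subset[OF inj_on_mult[OF g(1)] E_supp[OF x]] in simp)
  moreover obtain y where y: "y \<in> open_disc (cell_dim (supp ?n))" "cell_point (supp ?n) y = ?n"
    using cell_point_surj[OF A n refl] .
  moreover have "proj ?n = proj x" using proj_eq_iff[OF x n] g by metis
  ultimately show ?thesis using that[OF A] by (simp add: char_map_def)
qed

theorem finite_CW: "finite_CW_complex (Metric_space.mtopology orbit_space orbit_dist)"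
proof -
  interpret C: galois_cover E l1 orbit_space orbit_dist proj gap G act by (rule galois_cover_proj)
  let ?X = "C.X.mtopology"
  let ?c = "\<lambda>A. (cell_dim A, char_map A)"
  let ?\<C> = "?c ` cells"
  have cont: "continuous_map (closed_disc (cell_dim A)) ?X (char_map A)" if "A \<in> cells" for A
    using C.continuous_map_p[OF continuous_map_cell_point[OF that]] unfolding char_map_def[abs_def] .
  have fin: "finite ?\<C>"
  proof -
    have "cells \<subseteq> Pow (block \<one>)" by (auto simp: cells_def)
    then show ?thesis using finite_block_one by (meson finite_Pow_iff finite_imageI finite_subset)
  qed
  have emb: "embedding_map (subtopology (closed_disc (cell_dim A)) (open_disc (cell_dim A))) ?X (char_map A)"
    if A: "A \<in> cells" for A
  proof -
    let ?D = "closed_disc (cell_dim A)" and ?O = "open_disc (cell_dim A)"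
    have "closed_map ?D ?X (char_map A)"
      by (rule T1_Spaces.continuous_imp_closed_map[OF cont[OF A] compact_space_closed_disc C.X.Hausdorff_space_mtopology])
    moreover have "{y \<in> topspace ?D. char_map A y \<in> char_map A ` ?O} = ?O"
      using char_map_inj[OF A] open_disc_subset by (auto simp: image_iff)
    ultimately have "closed_map (subtopology ?D ?O) (subtopology ?X (char_map A ` ?O)) (char_map A)"
      by (rule closed_map_restriction)
    moreover have "continuous_map (subtopology ?D ?O) (subtopology ?X (char_map A ` ?O)) (char_map A)"
      by (auto simp: continuous_map_in_subtopology continuous_map_from_subtopology[OF cont[OF A]])
    moreover have "inj_on (char_map A) (topspace (subtopology ?D ?O))"
      using char_map_inj[OF A] by (auto simp: inj_on_def)
    ultimately have "embedding_map (subtopology ?D ?O) (subtopology ?X (char_map A ` ?O)) (char_map A)"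
      by (intro injective_closed_imp_embedding_map)
    then show ?thesis by (simp add: embedding_map_in_subtopology)
  qed
  have bd: "char_map A ` disc_boundary (cell_dim A)
      \<subseteq> (\<Union>(m, \<psi>)\<in>{(m, \<psi>)\<in>?\<C>. m < cell_dim A}. \<psi> ` open_disc m)" if A: "A \<in> cells" for A
  proof
    fix u assume "u \<in> char_map A ` disc_boundary (cell_dim A)"
    then obtain y where y: "y \<in> disc_boundary (cell_dim A)" "u = char_map A y" by blast
    then have y': "y \<in> topspace (closed_disc (cell_dim A))" "y \<notin> open_disc (cell_dim A)"
      by (auto simp: disc_boundary_def open_disc_def closed_disc_eq topspace_Euclidean_space)
    have x: "cell_point A y \<in> E" by (rule cell_point_in[OF A y'(1)])
    have "supp (cell_point A y) \<subset> A"
      using supp_cell_point_iff[OF A y'(1)] y'(2) supp_cell_point_subset by blast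
    then have less: "card (supp (cell_point A y)) < card A" by (rule psubset_card_mono[OF finite_cell[OF A]])
    obtain B z where B: "B \<in> cells" "card B = card (supp (cell_point A y))" "z \<in> open_disc (cell_dim B)"
      "char_map B z = proj (cell_point A y)" by (rule point_in_cell[OF x])
    have "card B > 0" using B(1) finite_cell[OF B(1)] by (simp add: cells_def card_gt_0_iff)
    then have "cell_dim B < cell_dim A" using less B(2) by (simp add: cell_dim_def)
    moreover have "u = char_map B z" using y(2) B(4) by (simp add: char_map_def)
    ultimately show "u \<in> (\<Union>(m, \<psi>)\<in>{(m, \<psi>)\<in>?\<C>. m < cell_dim A}. \<psi> ` open_disc m)"
      using B(1,3) by (intro UN_I[of "?c B"]) auto
  qed
  have disj: "disjoint_family_on (\<lambda>(n, \<phi>). \<phi> ` open_disc n) ?\<C>"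
    unfolding disjoint_family_on_def using cells_disjoint by (clarsimp simp: disjoint_iff) metis
  have "orbit_space \<subseteq> (\<Union>(n, \<phi>)\<in>?\<C>. \<phi> ` open_disc n)"
  proof
    fix u assume "u \<in> orbit_space"
    then obtain x where x: "x \<in> E" "proj x = u" by (auto simp: orbit_space_def)
    obtain A y where "A \<in> cells" "y \<in> open_disc (cell_dim A)" "char_map A y = proj x"
      using point_in_cell[OF x(1)] by metis
    then show "u \<in> (\<Union>(n, \<phi>)\<in>?\<C>. \<phi> ` open_disc n)" using x(2) by auto
  qed
  moreover have "char_map A y \<in> orbit_space" if "A \<in> cells" "y \<in> open_disc (cell_dim A)" for A y
    using cell_point_in[OF that(1)] that(2) open_disc_subset by (auto simp: char_map_def orbit_space_def)
  then have "(\<Union>(n, \<phi>)\<in>?\<C>. \<phi> ` open_disc n) \<subseteq> orbit_space" by auto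
  ultimately have "topspace ?X = (\<Union>(n, \<phi>)\<in>?\<C>. \<phi> ` open_disc n)" by simp
  then have "finite_cell_structure ?X ?\<C>"
    unfolding finite_cell_structure_def
  proof (intro conjI ballI)
    fix C assume "C \<in> ?\<C>"
    then obtain A where A: "A \<in> cells" "C = (cell_dim A, char_map A)" by blast
    show "case C of (n, \<phi>) \<Rightarrow> continuous_map (closed_disc n) ?X \<phi> \<and>
        embedding_map (subtopology (closed_disc n) (open_disc n)) ?X \<phi> \<and>
        \<phi> ` disc_boundary n \<subseteq> (\<Union>(m, \<psi>)\<in>{(m, \<psi>)\<in>?\<C>. m < n}. \<psi> ` open_disc m)"
      unfolding A(2) prod.case using cont[OF A(1)] emb[OF A(1)] bd[OF A(1)] by (intro conjI)
  qed (rule fin, rule disj)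
  then show ?thesis unfolding finite_CW_complex_def using C.X.Hausdorff_space_mtopology by blast
qed

end


section \<open>The order on the group of fractions\<close>

text \<open>Because the left and the right divisors of \<open>\<Delta>\<close> coincide and generate \<open>M\<close>, conjugation by \<open>\<Delta>\<close>
  preserves \<open>M\<close> in both directions. Meets reduce to gcds in \<open>M\<close>, since any two elements of the
  group have a common lower bound \<open>k\<close>; the gcd does not depend on \<open>k\<close> because it commutes with
  left multiplication.\<close>

lemma garside_fractions_order:
  fixes M :: "('a, 'b) monoid_scheme" (structure) and G :: "('g, 'h) monoid_scheme"
  assumes M: "garside_monoid M" and G: "group G" and hom: "\<iota> \<in> hom M G"
    and inj: "inj_on \<iota> (carrier M)" and \<iota>1: "\<iota> \<one> = \<one>\<^bsub>G\<^esub>"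
    and frac: "\<And>g. g \<in> carrier G \<Longrightarrow> \<exists>a\<in>carrier M. \<exists>b\<in>carrier M. \<iota> a \<otimes>\<^bsub>G\<^esub> g = \<iota> b"
    and ore: "\<And>a b. \<lbrakk>a \<in> carrier M; b \<in> carrier M\<rbrakk> \<Longrightarrow>
      \<exists>u\<in>carrier M. \<exists>v\<in>carrier M. u \<otimes> a = v \<otimes> b"
  shows "\<exists>le \<Delta>. garside_order G le \<Delta>"
proof -
  interpret M: monoid_cancel M using M by (simp add: garside_monoid_def)
  interpret G: group G by fact
  obtain D where D: "garside_element M D" using M by (auto simp: garside_monoid_def)
  let ?S = "left_divisors M D"
  have D_in [simp]: "D \<in> carrier M" and SR: "?S = right_divisors M D" and fin: "finite ?S"
    and gen: "generates_monoid M ?S"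
    using D by (auto simp: garside_element_def)
  have S_left: "s \<in> ?S \<longleftrightarrow> s \<in> carrier M \<and> (\<exists>c\<in>carrier M. D = s \<otimes> c)" for s
    by (auto simp: left_divisors_def factor_def)
  have S_right: "s \<in> ?S \<longleftrightarrow> s \<in> carrier M \<and> (\<exists>c\<in>carrier M. D = c \<otimes> s)" for s
    unfolding SR by (auto simp: right_divisors_def left_divisors_def factor_def opposite_monoid_def)
  have gcd: "\<exists>d\<in>carrier M. (\<exists>c\<in>carrier M. a = d \<otimes> c) \<and> (\<exists>c\<in>carrier M. b = d \<otimes> c) \<and>
      (\<forall>y\<in>carrier M. (\<exists>c\<in>carrier M. a = y \<otimes> c) \<and> (\<exists>c\<in>carrier M. b = y \<otimes> c) \<longrightarrow> (\<exists>c\<in>carrier M. d = y \<otimes> c))"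
    if "a \<in> carrier M" "b \<in> carrier M" for a b
    using M that by (simp add: garside_monoid_def has_gcd_lcm_def isgcd_def factor_def)
  have no_units: "m = \<one>" if "m \<in> carrier M" "n \<in> carrier M" "m \<otimes> n = \<one>" for m n
    using atomic_no_units[of M m n] M that by (simp add: garside_monoid_def)

  \<comment> \<open>If \<open>D = s t = t u\<close>, then \<open>s D = s t u = D u\<close>.\<close>
  have right_step: "\<exists>m'\<in>carrier M. m \<otimes> D = D \<otimes> m'" if "m \<in> carrier M" for m
  proof (rule generates_monoid_induct[OF gen that M.monoid_axioms])
    show "\<exists>m'\<in>carrier M. \<one> \<otimes> D = D \<otimes> m'" by (intro bexI[of _ \<one>]) auto
    fix s m assume s: "s \<in> ?S" and m: "m \<in> carrier M" and IH: "\<exists>m'\<in>carrier M. m \<otimes> D = D \<otimes> m'"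
    obtain m' where m': "m' \<in> carrier M" "m \<otimes> D = D \<otimes> m'" using IH by blast
    obtain t where t: "t \<in> carrier M" "D = s \<otimes> t" and sc: "s \<in> carrier M" using s S_left by blast
    have "t \<in> ?S" using S_right t sc by blast
    then obtain u where u: "u \<in> carrier M" "D = t \<otimes> u" using S_left by blast
    have "s \<otimes> m \<otimes> D = s \<otimes> D \<otimes> m'" using m m' sc by (simp add: M.m_assoc)
    also have "s \<otimes> D = D \<otimes> u" using u t sc by (metis M.m_assoc)
    finally have "s \<otimes> m \<otimes> D = D \<otimes> (u \<otimes> m')" using u(1) m'(1) by (simp add: M.m_assoc)
    then show "\<exists>m'\<in>carrier M. s \<otimes> m \<otimes> D = D \<otimes> m'" using u m' by blast
  qed
  \<comment> \<open>If \<open>D = t s = u t\<close>, then \<open>D s = u t s = u D\<close>.\<close>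
  have left_step: "\<exists>m'\<in>carrier M. D \<otimes> m = m' \<otimes> D" if "m \<in> carrier M" for m
  proof (rule generates_monoid_induct[OF gen that M.monoid_axioms])
    show "\<exists>m'\<in>carrier M. D \<otimes> \<one> = m' \<otimes> D" by (intro bexI[of _ \<one>]) auto
    fix s m assume s: "s \<in> ?S" and m: "m \<in> carrier M" and IH: "\<exists>m'\<in>carrier M. D \<otimes> m = m' \<otimes> D"
    obtain m' where m': "m' \<in> carrier M" "D \<otimes> m = m' \<otimes> D" using IH by blast
    obtain t where t: "t \<in> carrier M" "D = t \<otimes> s" and sc: "s \<in> carrier M" using s S_right by blast
    have "t \<in> ?S" using S_left t sc by blast
    then obtain u where u: "u \<in> carrier M" "D = u \<otimes> t" using S_right by blast
    have "D \<otimes> s = u \<otimes> D" using u t sc by (metis M.m_assoc)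
    then have "D \<otimes> (s \<otimes> m) = u \<otimes> (D \<otimes> m)" using m u sc by (metis D_in M.m_assoc)
    then have "D \<otimes> (s \<otimes> m) = u \<otimes> m' \<otimes> D" using u(1) m' by (simp add: M.m_assoc)
    then show "\<exists>m'\<in>carrier M. D \<otimes> (s \<otimes> m) = m' \<otimes> D" using u m' by blast
  qed
  have right_pow: "\<exists>m'\<in>carrier M. m \<otimes> D [^] k = D [^] k \<otimes> m'" if m: "m \<in> carrier M" for m and k :: nat
  proof (induction k)
    case 0
    show ?case using m by (intro bexI[of _ m]) auto
  next
    case (Suc k)
    then obtain m' where m': "m' \<in> carrier M" "m \<otimes> D [^] k = D [^] k \<otimes> m'" by blast
    obtain m'' where m'': "m'' \<in> carrier M" "m' \<otimes> D = D \<otimes> m''" using right_step[OF m'(1)] by blast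
    have "m \<otimes> (D [^] k \<otimes> D) = (m \<otimes> D [^] k) \<otimes> D" using m by (simp add: M.m_assoc)
    also have "\<dots> = D [^] k \<otimes> (m' \<otimes> D)" using m' by (simp add: M.m_assoc)
    also have "\<dots> = D [^] k \<otimes> D \<otimes> m''" using m'' by (simp add: M.m_assoc)
    finally show ?case using m'' by auto
  qed
  have left_pow: "\<exists>m'\<in>carrier M. D [^] k \<otimes> m = m' \<otimes> D [^] k" if m: "m \<in> carrier M" for m and k :: nat
    using m
  proof (induction k arbitrary: m)
    case 0
    then show ?case by (intro bexI[of _ m]) auto
  next
    case (Suc k)
    obtain m' where m': "m' \<in> carrier M" "D \<otimes> m = m' \<otimes> D" using left_step[OF Suc.prems] by blast
    obtain m'' where m'': "m'' \<in> carrier M" "D [^] k \<otimes> m' = m'' \<otimes> D [^] k" using Suc.IH[OF m'(1)] by blast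
    have "D [^] k \<otimes> D \<otimes> m = D [^] k \<otimes> m' \<otimes> D" using Suc.prems m' by (simp add: M.m_assoc)
    also have "\<dots> = m'' \<otimes> (D [^] k \<otimes> D)" using m'' by (simp add: M.m_assoc)
    finally show ?case using m'' by auto
  qed
  have div_pow: "\<exists>k::nat. \<exists>n\<in>carrier M. m \<otimes> n = D [^] k" if "m \<in> carrier M" for m
  proof (rule generates_monoid_induct[OF gen that M.monoid_axioms])
    show "\<exists>k::nat. \<exists>n\<in>carrier M. \<one> \<otimes> n = D [^] k" by (intro exI[of _ 0] bexI[of _ \<one>]) auto
    fix s m assume s: "s \<in> ?S" and m: "m \<in> carrier M" and IH: "\<exists>k::nat. \<exists>n\<in>carrier M. m \<otimes> n = D [^] k"
    obtain k :: nat and n where n: "n \<in> carrier M" "m \<otimes> n = D [^] k" using IH by blast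
    obtain t where t: "t \<in> carrier M" "D = s \<otimes> t" and sc: "s \<in> carrier M" using s S_left by blast
    obtain t' where t': "t' \<in> carrier M" "t \<otimes> D [^] k = D [^] k \<otimes> t'" using right_pow[OF t(1)] by blast
    have "s \<otimes> m \<otimes> (n \<otimes> t') = s \<otimes> ((m \<otimes> n) \<otimes> t')" using sc m n(1) t'(1) by (simp add: M.m_assoc)
    also have "\<dots> = s \<otimes> (t \<otimes> D [^] k)" using n(2) t'(2) by simp
    also have "\<dots> = D \<otimes> D [^] k" using sc t by (simp flip: M.m_assoc)
    also have "\<dots> = D [^] Suc k" by (rule M.nat_pow_Suc2[symmetric]) simp
    finally show "\<exists>k::nat. \<exists>n\<in>carrier M. s \<otimes> m \<otimes> n = D [^] k" using n t' by blast
  qed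
  \<comment> \<open>A left divisor of a power is also a right divisor: conjugate the cofactor by the power.\<close>
  have div_pow_left: "\<exists>n'\<in>carrier M. n' \<otimes> m = D [^] k"
    if m: "m \<in> carrier M" and n: "n \<in> carrier M" and mn: "m \<otimes> n = D [^] k" for m n and k :: nat
  proof -
    obtain n' where n': "n' \<in> carrier M" "D [^] k \<otimes> n = n' \<otimes> D [^] k" using left_pow[OF n] by blast
    have "D [^] k \<otimes> n = (n' \<otimes> m) \<otimes> n" using n' m n by (simp add: M.m_assoc mn)
    then have "D [^] k = n' \<otimes> m" by (rule M.r_cancel) (use n' m n in auto)
    then show ?thesis using n' by metis
  qed

  have \<iota>_in [simp]: "\<iota> m \<in> carrier G" if "m \<in> carrier M" for m using hom that by (rule hom_in_carrier)
  have \<iota>_mult: "\<iota> (m \<otimes> n) = \<iota> m \<otimes>\<^bsub>G\<^esub> \<iota> n" if "m \<in> carrier M" "n \<in> carrier M" for m n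
    using hom that by (rule hom_mult)
  have \<iota>_inj: "m = n" if "m \<in> carrier M" "n \<in> carrier M" "\<iota> m = \<iota> n" for m n
    using inj that by (auto simp: inj_on_def)
  have \<iota>_pow: "\<iota> (D [^] k) = \<iota> D [^]\<^bsub>G\<^esub> k" for k :: nat
    by (induction k) (auto simp: \<iota>1 \<iota>_mult)
  define le where "le g h \<longleftrightarrow> (\<exists>m\<in>carrier M. h = g \<otimes>\<^bsub>G\<^esub> \<iota> m)" for g h
  have common_lower: "\<exists>k\<in>carrier G. \<exists>a\<in>carrier M. \<exists>b\<in>carrier M. g = k \<otimes>\<^bsub>G\<^esub> \<iota> a \<and> h = k \<otimes>\<^bsub>G\<^esub> \<iota> b"
    if g: "g \<in> carrier G" and h: "h \<in> carrier G" for g h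
  proof -
    obtain a b where ab: "a \<in> carrier M" "b \<in> carrier M" "\<iota> a \<otimes>\<^bsub>G\<^esub> g = \<iota> b" using frac[OF g] by blast
    obtain a' b' where ab': "a' \<in> carrier M" "b' \<in> carrier M" "\<iota> a' \<otimes>\<^bsub>G\<^esub> h = \<iota> b'" using frac[OF h] by blast
    obtain u v where uv: "u \<in> carrier M" "v \<in> carrier M" "u \<otimes> a = v \<otimes> a'" using ore[OF ab(1) ab'(1)] by blast
    let ?w = "\<iota> (u \<otimes> a)"
    have w: "?w \<in> carrier G" using uv(1) ab(1) by simp
    have "?w \<otimes>\<^bsub>G\<^esub> g = \<iota> (u \<otimes> b)" using ab uv(1) g by (simp add: \<iota>_mult G.m_assoc)
    then have 1: "g = inv\<^bsub>G\<^esub> ?w \<otimes>\<^bsub>G\<^esub> \<iota> (u \<otimes> b)" using G.inv_solve_left[OF g w, of "\<iota> (u \<otimes> b)"] uv(1) ab(2) by simp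
    have "?w \<otimes>\<^bsub>G\<^esub> h = \<iota> (v \<otimes> b')" unfolding uv(3) using ab' uv(2) h by (simp add: \<iota>_mult G.m_assoc)
    then have "h = inv\<^bsub>G\<^esub> ?w \<otimes>\<^bsub>G\<^esub> \<iota> (v \<otimes> b')" using G.inv_solve_left[OF h w, of "\<iota> (v \<otimes> b')"] uv(2) ab'(2) by simp
    then show ?thesis using 1 G.inv_closed[OF w] M.m_closed[OF uv(1) ab(2)] M.m_closed[OF uv(2) ab'(2)] by blast
  qed
  have "garside_order G le (\<iota> D)"
  proof (unfold_locales)
    show "\<iota> D \<in> carrier G" by simp
    show "le a a" if "a \<in> carrier G" for a
      unfolding le_def using that by (intro bexI[of _ \<one>]) (auto simp: \<iota>1)
    show "a = b" if a: "a \<in> carrier G" and b: "b \<in> carrier G" and ab: "le a b" and ba: "le b a" for a b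
    proof -
      obtain m where m: "m \<in> carrier M" "b = a \<otimes>\<^bsub>G\<^esub> \<iota> m" using ab by (auto simp: le_def)
      obtain n where n: "n \<in> carrier M" "a = b \<otimes>\<^bsub>G\<^esub> \<iota> n" using ba by (auto simp: le_def)
      have "a \<otimes>\<^bsub>G\<^esub> \<iota> (m \<otimes> n) = a \<otimes>\<^bsub>G\<^esub> \<iota> m \<otimes>\<^bsub>G\<^esub> \<iota> n"
        using m(1) n(1) a by (simp add: \<iota>_mult G.m_assoc)
      also have "\<dots> = a" using m(2) n(2) by metis
      finally have "a \<otimes>\<^bsub>G\<^esub> \<iota> (m \<otimes> n) = a" .
      then have "\<iota> (m \<otimes> n) = \<iota> \<one>" using a m(1) n(1) \<iota>1 G.r_cancel_one[of a "\<iota> (m \<otimes> n)"] by simp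
      then have "m \<otimes> n = \<one>" using m(1) n(1) by (intro \<iota>_inj) auto
      then have "m = \<one>" using no_units m(1) n(1) by blast
      then show ?thesis using m a \<iota>1 by simp
    qed
    show "le a c" if a: "a \<in> carrier G" and bc: "b \<in> carrier G" "c \<in> carrier G" "le a b" "le b c" for a b c
    proof -
      obtain m where m: "m \<in> carrier M" "b = a \<otimes>\<^bsub>G\<^esub> \<iota> m" using bc by (auto simp: le_def)
      obtain n where n: "n \<in> carrier M" "c = b \<otimes>\<^bsub>G\<^esub> \<iota> n" using bc by (auto simp: le_def)
      have "c = a \<otimes>\<^bsub>G\<^esub> \<iota> (m \<otimes> n)" using m n a by (simp add: \<iota>_mult G.m_assoc)
      then show ?thesis unfolding le_def using m n by blast
    qed
    show "le (c \<otimes>\<^bsub>G\<^esub> a) (c \<otimes>\<^bsub>G\<^esub> b)" if abc: "a \<in> carrier G" "b \<in> carrier G" "c \<in> carrier G" "le a b" for a b c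
      using abc by (auto simp: le_def G.m_assoc)
    show "le (a \<otimes>\<^bsub>G\<^esub> \<iota> D) (b \<otimes>\<^bsub>G\<^esub> \<iota> D) \<longleftrightarrow> le a b" if a: "a \<in> carrier G" and b: "b \<in> carrier G" for a b
    proof
      assume "le (a \<otimes>\<^bsub>G\<^esub> \<iota> D) (b \<otimes>\<^bsub>G\<^esub> \<iota> D)"
      then obtain m where m: "m \<in> carrier M" "b \<otimes>\<^bsub>G\<^esub> \<iota> D = a \<otimes>\<^bsub>G\<^esub> \<iota> D \<otimes>\<^bsub>G\<^esub> \<iota> m" by (auto simp: le_def)
      obtain m' where m': "m' \<in> carrier M" "D \<otimes> m = m' \<otimes> D" using left_step[OF m(1)] by blast
      have "b \<otimes>\<^bsub>G\<^esub> \<iota> D = a \<otimes>\<^bsub>G\<^esub> \<iota> m' \<otimes>\<^bsub>G\<^esub> \<iota> D"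
        using m m' a \<iota>_mult[of D m] \<iota>_mult[of m' D] by (simp add: G.m_assoc)
      then have "b = a \<otimes>\<^bsub>G\<^esub> \<iota> m'" using a b m'(1) by simp
      then show "le a b" unfolding le_def using m' by blast
    next
      assume "le a b"
      then obtain m where m: "m \<in> carrier M" "b = a \<otimes>\<^bsub>G\<^esub> \<iota> m" by (auto simp: le_def)
      obtain m' where m': "m' \<in> carrier M" "m \<otimes> D = D \<otimes> m'" using right_step[OF m(1)] by blast
      have "b \<otimes>\<^bsub>G\<^esub> \<iota> D = a \<otimes>\<^bsub>G\<^esub> \<iota> D \<otimes>\<^bsub>G\<^esub> \<iota> m'"
        using m m' a \<iota>_mult[of m D] \<iota>_mult[of D m'] by (simp add: G.m_assoc)
      then show "le (a \<otimes>\<^bsub>G\<^esub> \<iota> D) (b \<otimes>\<^bsub>G\<^esub> \<iota> D)" unfolding le_def using m' by blast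
    qed
    show "le \<one>\<^bsub>G\<^esub> (\<iota> D)" unfolding le_def by (intro bexI[of _ D]) auto
    have "{h \<in> carrier G. le \<one>\<^bsub>G\<^esub> h \<and> le h (\<iota> D)} \<subseteq> \<iota> ` ?S"
    proof
      fix h assume h: "h \<in> {h \<in> carrier G. le \<one>\<^bsub>G\<^esub> h \<and> le h (\<iota> D)}"
      then obtain m where m: "m \<in> carrier M" "h = \<iota> m" by (auto simp: le_def)
      obtain n where n: "n \<in> carrier M" "\<iota> D = h \<otimes>\<^bsub>G\<^esub> \<iota> n" using h by (auto simp: le_def)
      have "D = m \<otimes> n" using m n by (intro \<iota>_inj) (auto simp: \<iota>_mult)
      then have "m \<in> ?S" using S_left m n by blast
      then show "h \<in> \<iota> ` ?S" using m by blast
    qed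
    then show "finite {h \<in> carrier G. le \<one>\<^bsub>G\<^esub> h \<and> le h (\<iota> D)}"
      by (rule finite_subset) (use fin in simp)
    show "\<exists>m\<in>carrier G. le m a \<and> le m b \<and> (\<forall>l\<in>carrier G. le l a \<and> le l b \<longrightarrow> le l m)"
      if g: "a \<in> carrier G" and h: "b \<in> carrier G" for a b
    proof -
      obtain k x y where k: "k \<in> carrier G" "x \<in> carrier M" "y \<in> carrier M"
        "a = k \<otimes>\<^bsub>G\<^esub> \<iota> x" "b = k \<otimes>\<^bsub>G\<^esub> \<iota> y" using common_lower[OF g h] by blast
      obtain d where d: "d \<in> carrier M" "\<exists>c\<in>carrier M. x = d \<otimes> c" "\<exists>c\<in>carrier M. y = d \<otimes> c"
        "\<And>e. \<lbrakk>e \<in> carrier M; \<exists>c\<in>carrier M. x = e \<otimes> c; \<exists>c\<in>carrier M. y = e \<otimes> c\<rbrakk> \<Longrightarrow> \<exists>c\<in>carrier M. d = e \<otimes> c"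
        using gcd[OF k(2,3)] by blast
      let ?m = "k \<otimes>\<^bsub>G\<^esub> \<iota> d"
      have "le ?m a" using d(1,2) k(1) unfolding le_def k(4) by (auto simp: \<iota>_mult G.m_assoc)
      moreover have "le ?m b" using d(1,3) k(1) unfolding le_def k(5) by (auto simp: \<iota>_mult G.m_assoc)
      moreover have "le l ?m" if l: "l \<in> carrier G" "le l a" "le l b" for l
      proof -
        obtain p where p: "p \<in> carrier M" "a = l \<otimes>\<^bsub>G\<^esub> \<iota> p" using l by (auto simp: le_def)
        obtain q where q: "q \<in> carrier M" "b = l \<otimes>\<^bsub>G\<^esub> \<iota> q" using l by (auto simp: le_def)
        obtain k' u v where k': "k' \<in> carrier G" "u \<in> carrier M" "v \<in> carrier M"
          "k = k' \<otimes>\<^bsub>G\<^esub> \<iota> u" "l = k' \<otimes>\<^bsub>G\<^esub> \<iota> v" using common_lower[OF k(1) l(1)] by blast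
        have cancel: "u \<otimes> x = v \<otimes> p" if x: "x \<in> carrier M" "p \<in> carrier M" "k \<otimes>\<^bsub>G\<^esub> \<iota> x = l \<otimes>\<^bsub>G\<^esub> \<iota> p" for x p
        proof -
          have "k' \<otimes>\<^bsub>G\<^esub> \<iota> (u \<otimes> x) = k' \<otimes>\<^bsub>G\<^esub> \<iota> (v \<otimes> p)" using x k' by (simp add: \<iota>_mult flip: G.m_assoc)
          then show ?thesis using x k' by (intro \<iota>_inj) auto
        qed
        have ux: "u \<otimes> x = v \<otimes> p" using cancel[OF k(2) p(1)] k p by simp
        have uy: "u \<otimes> y = v \<otimes> q" using cancel[OF k(3) q(1)] k q by simp
        obtain d' where d': "d' \<in> carrier M" "\<exists>c\<in>carrier M. u \<otimes> x = d' \<otimes> c" "\<exists>c\<in>carrier M. u \<otimes> y = d' \<otimes> c"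
          "\<And>e. \<lbrakk>e \<in> carrier M; \<exists>c\<in>carrier M. u \<otimes> x = e \<otimes> c; \<exists>c\<in>carrier M. u \<otimes> y = e \<otimes> c\<rbrakk> \<Longrightarrow> \<exists>c\<in>carrier M. d' = e \<otimes> c"
          using gcd[of "u \<otimes> x" "u \<otimes> y"] k k' by blast
        obtain e where e: "e \<in> carrier M" "d' = u \<otimes> e" using d'(4)[OF k'(2)] k by blast
        obtain w where w: "w \<in> carrier M" "d' = v \<otimes> w" using d'(4)[OF k'(3)] ux uy p q by blast
        have e_div: "\<exists>c\<in>carrier M. x = e \<otimes> c" if x: "x \<in> carrier M" "\<exists>c\<in>carrier M. u \<otimes> x = d' \<otimes> c" for x
        proof -
          obtain c where c: "c \<in> carrier M" "u \<otimes> x = d' \<otimes> c" using x(2) by blast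
          then have "u \<otimes> x = u \<otimes> (e \<otimes> c)" using e k' by (simp add: M.m_assoc)
          then have "x = e \<otimes> c" by (rule M.l_cancel) (use x c e k' in auto)
          then show ?thesis using c by blast
        qed
        obtain f where f: "f \<in> carrier M" "d = e \<otimes> f"
          using d(4)[OF e(1) e_div[OF k(2) d'(2)] e_div[OF k(3) d'(3)]] by blast
        have "u \<otimes> d = d' \<otimes> f" using e f k' by (simp add: M.m_assoc)
        also have "\<dots> = v \<otimes> (w \<otimes> f)" unfolding w(2) using w(1) f k' by (simp add: M.m_assoc)
        finally have ud: "u \<otimes> d = v \<otimes> (w \<otimes> f)" .
        have "?m = k' \<otimes>\<^bsub>G\<^esub> \<iota> (u \<otimes> d)" using k' d(1) by (simp add: \<iota>_mult G.m_assoc)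
        also have "\<dots> = l \<otimes>\<^bsub>G\<^esub> \<iota> (w \<otimes> f)" unfolding ud k'(5) using k' w f by (simp add: \<iota>_mult G.m_assoc)
        finally show ?thesis unfolding le_def using w f by blast
      qed
      ultimately show ?thesis using k(1) d(1) by (intro bexI[of _ ?m]) auto
    qed
    show "\<exists>k::nat. le (inv\<^bsub>G\<^esub> (\<iota> D [^]\<^bsub>G\<^esub> k)) g \<and> le g (\<iota> D [^]\<^bsub>G\<^esub> k)" if g: "g \<in> carrier G" for g
    proof -
      obtain a b where ab: "a \<in> carrier M" "b \<in> carrier M" "\<iota> a \<otimes>\<^bsub>G\<^esub> g = \<iota> b" using frac[OF g] by blast
      obtain i :: nat and n where n: "n \<in> carrier M" "a \<otimes> n = D [^] i" using div_pow[OF ab(1)] by blast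
      obtain j :: nat and n' where n': "n' \<in> carrier M" "b \<otimes> n' = D [^] j" using div_pow[OF ab(2)] by blast
      define k where "k = i + j"
      have an: "a \<otimes> (n \<otimes> D [^] j) = D [^] k"
        using n ab by (simp add: k_def M.nat_pow_mult flip: M.m_assoc)
      have bn: "b \<otimes> (n' \<otimes> D [^] i) = D [^] k"
        using n' ab by (simp add: k_def M.nat_pow_mult add.commute flip: M.m_assoc)
      obtain c where c: "c \<in> carrier M" "c \<otimes> a = D [^] k" using div_pow_left[OF ab(1) _ an] n by auto
      have "\<iota> (D [^] k) \<otimes>\<^bsub>G\<^esub> g = \<iota> (c \<otimes> b)"
        unfolding c(2)[symmetric] using c(1) ab g by (simp add: \<iota>_mult G.m_assoc)
      then have "g = inv\<^bsub>G\<^esub> (\<iota> (D [^] k)) \<otimes>\<^bsub>G\<^esub> \<iota> (c \<otimes> b)"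
        using G.inv_solve_left[OF g, of "\<iota> (D [^] k)" "\<iota> (c \<otimes> b)"] c ab by simp
      then have "le (inv\<^bsub>G\<^esub> (\<iota> D [^]\<^bsub>G\<^esub> k)) g" unfolding le_def \<iota>_pow using c ab by blast
      moreover have "le g (\<iota> D [^]\<^bsub>G\<^esub> k)"
      proof -
        obtain a' where a': "a' \<in> carrier M" "a \<otimes> D [^] k = D [^] k \<otimes> a'" using right_pow[OF ab(1)] by blast
        let ?r = "n' \<otimes> D [^] i \<otimes> a'"
        have r: "?r \<in> carrier M" using n' a' by simp
        have "b \<otimes> ?r = b \<otimes> (n' \<otimes> D [^] i) \<otimes> a'" using ab(2) n'(1) a'(1) by (simp add: M.m_assoc)
        then have eq: "a \<otimes> D [^] k = b \<otimes> ?r" unfolding bn a'(2) by simp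
        have "\<iota> a \<otimes>\<^bsub>G\<^esub> \<iota> (D [^] k) = \<iota> (a \<otimes> D [^] k)" using ab(1) by (simp add: \<iota>_mult)
        also have "\<dots> = \<iota> b \<otimes>\<^bsub>G\<^esub> \<iota> ?r" unfolding eq using ab(2) r by (rule \<iota>_mult)
        also have "\<dots> = \<iota> a \<otimes>\<^bsub>G\<^esub> (g \<otimes>\<^bsub>G\<^esub> \<iota> ?r)"
          unfolding ab(3)[symmetric] using ab(1) g r by (simp only: G.m_assoc \<iota>_in)
        finally have "\<iota> (D [^] k) = g \<otimes>\<^bsub>G\<^esub> \<iota> ?r"
          using G.Units_l_cancel[of "\<iota> a" "\<iota> (D [^] k)" "g \<otimes>\<^bsub>G\<^esub> \<iota> ?r"] ab(1) g r by simp
        then show ?thesis unfolding le_def \<iota>_pow using r by blast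
      qed
      ultimately show ?thesis by blast
    qed
  qed
  then show ?thesis by blast
qed

theorem mainTheorem1:
  fixes M :: "('a, 'b) monoid_scheme" and G :: "('g, 'h) monoid_scheme"
  assumes "garside_monoid M"
    and "group G"
    and "G \<cong> group_of_fractions M"
  shows "\<exists>X :: (nat \<Rightarrow> real) topology. finite_CW_complex X \<and> eilenberg_maclane_1 X G"
proof -
  have ore: "\<exists>u\<in>carrier M. \<exists>v\<in>carrier M. u \<otimes>\<^bsub>M\<^esub> a = v \<otimes>\<^bsub>M\<^esub> b"
    if ab: "a \<in> carrier M" "b \<in> carrier M" for a b
  proof -
    have "has_gcd_lcm (opposite_monoid M)" using assms(1) by (simp add: garside_monoid_def)
    then obtain m where "m lcmof\<^bsub>opposite_monoid M\<^esub> a b"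
      using ab unfolding has_gcd_lcm_def by (force simp: opposite_monoid_def)
    then show ?thesis by (auto simp: islcm_def factor_def opposite_monoid_def)
  qed
  have "monoid_cancel M" using assms(1) by (simp add: garside_monoid_def)
  then obtain \<iota> where "\<iota> \<in> hom M G" "inj_on \<iota> (carrier M)" "\<iota> \<one>\<^bsub>M\<^esub> = \<one>\<^bsub>G\<^esub>"
    "\<And>g. g \<in> carrier G \<Longrightarrow> \<exists>a\<in>carrier M. \<exists>b\<in>carrier M. \<iota> a \<otimes>\<^bsub>G\<^esub> g = \<iota> b"
    using fractions_hom[OF _ assms(2,3) ore] by metis
  then obtain le \<Delta> where "garside_order G le \<Delta>"
    using garside_fractions_order[OF assms(1,2) _ _ _ _ ore] by metis
  then interpret garside_order G le \<Delta> .
  interpret C: galois_cover E l1 orbit_space orbit_dist proj gap G act by (rule galois_cover_proj)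
  show ?thesis using finite_CW C.eilenberg_maclane by blast
qed

end
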